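(* Let $\varphi$ be a quasi-psh function on a complex manifold $X$. Suppose $\sigma_0$ is a positive continuous function on $X$ such that $\mathcal{I}(\varphi)=\mathcal{I}\left((1+\sigma_0)\varphi\right)$. Let $L$ be a holomorphic line bundle over $X$. Let $W$ be a finite dimensional subspace of $H^{0}(X,L)$ such that $W$ generates all fibers $L_x$, $x\in X$. Then there exists a measure zero set $N\subset P(W)$ such that for each $[s]\in P(W)\setminus N$ the multiplier ideal sheaf $\mathcal{I}(\varphi)$ can be written as \[\mathcal{I}(\varphi)_{x}=\left\{f\in\mathscr{O}_{X,x};\ \exists\,U_x\ \text{such that}\ \int_{U_x}\frac{|f|^{2}}{|s|^{2(1-\varepsilon)}}e^{-2(1+\sigma)\varphi}\,dV<+\infty\right\}\] for $0<\sigma\leqslant\sigma_0$ and $0<\varepsilon<\sigma$, where $dV$ is a smooth volume form on $X$.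
   Context: Complex manifolds are assumed second countable. A quasi-psh function is a function that is locally the sum of a plurisubharmonic function and a smooth function. For $\psi=\varphi$ or $\psi=(1+\sigma_0)\varphi$, $\mathcal{I}(\psi)_x=\{f\in\mathscr{O}_{X,x};\ |f|^2e^{-2\psi}\text{ is integrable in a neighborhood of }x\}$. "$W$ generates all fibers" means the evaluation map $W\to L_x$ is surjective for every $x\in X$. $P(W)$ is the projective space of lines in $W$, and $[s]$ is the class of $s\in W\setminus\{0\}$. $U_x$ denotes a neighborhood of $x$, and $|s|$ is the absolute value of $s$ in a local trivialization of $L$ (the condition does not depend on the choice). *)

theory Defs
  imports "HOL-Analysis.Analysis"
begin

section \<open>Analysis on open subsets of complex n-space\<close>

text \<open>
  Complex n-space, for an arbitrary natural number n (possibly 0), is the set of functions from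
  {..<n} to the complex numbers, extended by \<^term>\<open>undefined\<close> outside {..<n}. This is the
  space of the product measure over {..<n}; its topology is the subspace topology of the product
  topology on \<^typ>\<open>nat \<Rightarrow> complex\<close>.
\<close>

type_synonym cvec = "nat \<Rightarrow> complex"

definition Cn :: "nat \<Rightarrow> cvec set" where
  "Cn n = (\<Pi>\<^sub>E i\<in>{..<n}. UNIV)"

abbreviation Leb :: "nat \<Rightarrow> cvec measure" where
  "Leb n \<equiv> (\<Pi>\<^sub>M i\<in>{..<n}. lborel)"

definition open_in_Cn :: "nat \<Rightarrow> cvec set \<Rightarrow> bool" where
  "open_in_Cn n D \<longleftrightarrow> openin (top_of_set (Cn n)) D"

text \<open>Holomorphic means continuous and holomorphic in each variable separately.\<close>

definition holomorphic_Cn :: "nat \<Rightarrow> cvec set \<Rightarrow> (cvec \<Rightarrow> complex) \<Rightarrow> bool" where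
  "holomorphic_Cn n D f \<longleftrightarrow> continuous_on D f \<and>
     (\<forall>z\<in>D. \<forall>i<n. (\<lambda>w. f (z(i := w))) field_differentiable at (z i))"

text \<open>
  Partial derivative of a real function in the i-th coordinate, in the real direction u; the
  directions 1 and \<^term>\<open>\<i>\<close> give the derivatives with respect to the real and imaginary part.
\<close>

definition real_partial :: "nat \<Rightarrow> complex \<Rightarrow> (cvec \<Rightarrow> real) \<Rightarrow> cvec \<Rightarrow> real" where
  "real_partial i u g z = deriv (\<lambda>t::real. g (z(i := z i + of_real t * u))) 0"

primrec Ck_Cn :: "nat \<Rightarrow> nat \<Rightarrow> cvec set \<Rightarrow> (cvec \<Rightarrow> real) \<Rightarrow> bool" where
  "Ck_Cn 0 n D g \<longleftrightarrow> continuous_on D g"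
| "Ck_Cn (Suc k) n D g \<longleftrightarrow> continuous_on D g \<and>
     (\<forall>i<n. \<forall>u\<in>{1, \<i>}.
        (\<forall>z\<in>D. (\<lambda>t::real. g (z(i := z i + of_real t * u))) differentiable at 0) \<and>
        Ck_Cn k n D (real_partial i u g))"

definition smooth_Cn :: "nat \<Rightarrow> cvec set \<Rightarrow> (cvec \<Rightarrow> real) \<Rightarrow> bool" where
  "smooth_Cn n D g \<longleftrightarrow> (\<forall>k. Ck_Cn k n D g)"

definition line_point :: "nat \<Rightarrow> cvec \<Rightarrow> cvec \<Rightarrow> complex \<Rightarrow> cvec" where
  "line_point n a \<xi> w = (\<lambda>i\<in>{..<n}. a i + w * \<xi> i)"

text \<open>
  Mean over a circle of an extended real function, as integral of the positive part minus integral
  of the negative part (\<^const>\<open>e2ennreal\<close> sends negative numbers to 0). For an upper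
  semicontinuous function with values below \<open>\<infinity>\<close> the first integral is finite, so that the
  difference is never of the form \<open>\<infinity> - \<infinity>\<close>.
\<close>

definition circle_mean :: "(real \<Rightarrow> ereal) \<Rightarrow> ereal" where
  "circle_mean v =
     (enn2ereal (\<integral>\<^sup>+\<theta>\<in>{0..2*pi}. e2ennreal (v \<theta>) \<partial>lborel)
      - enn2ereal (\<integral>\<^sup>+\<theta>\<in>{0..2*pi}. e2ennreal (- v \<theta>) \<partial>lborel)) / ereal (2 * pi)"

text \<open>
  Plurisubharmonic: values in \<open>[-\<infinity>, \<infinity>)\<close>, upper semicontinuous, and the mean value inequality on
  each closed disc inside a complex line. The function \<open>-\<infinity>\<close> is allowed.
\<close>

definition psh_Cn :: "nat \<Rightarrow> cvec set \<Rightarrow> (cvec \<Rightarrow> ereal) \<Rightarrow> bool" where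
  "psh_Cn n D u \<longleftrightarrow>
     (\<forall>z\<in>D. u z < \<infinity>) \<and>
     (\<forall>c::ereal. openin (top_of_set D) {z\<in>D. u z < c}) \<and>
     (\<forall>a\<in>D. \<forall>\<xi>\<in>Cn n. line_point n a \<xi> ` cball 0 1 \<subseteq> D \<longrightarrow>
        u a \<le> circle_mean (\<lambda>\<theta>. u (line_point n a \<xi> (cis \<theta>))))"


section \<open>Complex manifolds\<close>

text \<open>
  The manifold is the whole type \<open>'a\<close>, which is required to be Hausdorff and second countable by
  its type class. A chart is a pair of its domain and the coordinate map; the coordinate map is
  only relevant on the domain.
\<close>

type_synonym 'a chart = "'a set \<times> ('a \<Rightarrow> cvec)"

definition is_chart :: "nat \<Rightarrow> ('a::topological_space) chart \<Rightarrow> bool" where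
  "is_chart n c \<longleftrightarrow> (case c of (V, \<kappa>) \<Rightarrow>
     open V \<and> open_in_Cn n (\<kappa> ` V) \<and> homeomorphism V (\<kappa> ` V) \<kappa> (inv_into V \<kappa>))"

definition complex_manifold ::
    "nat \<Rightarrow> ('a::{t2_space, second_countable_topology}) chart set \<Rightarrow> bool" where
  "complex_manifold n A \<longleftrightarrow>
     (\<forall>c\<in>A. is_chart n c) \<and> (\<Union>(V, \<kappa>)\<in>A. V) = UNIV \<and>
     (\<forall>(V, \<kappa>)\<in>A. \<forall>(V', \<kappa>')\<in>A. \<forall>i<n.
        holomorphic_Cn n (\<kappa> ` (V \<inter> V')) (\<lambda>z. \<kappa>' (inv_into V \<kappa> z) i))"

definition holomorphic_fun :: "nat \<Rightarrow> 'a chart set \<Rightarrow> 'a set \<Rightarrow> ('a \<Rightarrow> complex) \<Rightarrow> bool" where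
  "holomorphic_fun n A U f \<longleftrightarrow>
     (\<forall>(V, \<kappa>)\<in>A. holomorphic_Cn n (\<kappa> ` (U \<inter> V)) (\<lambda>z. f (inv_into V \<kappa> z)))"

definition quasi_psh :: "nat \<Rightarrow> ('a::topological_space) chart set \<Rightarrow> ('a \<Rightarrow> ereal) \<Rightarrow> bool" where
  "quasi_psh n A \<phi> \<longleftrightarrow>
     (\<forall>x. \<exists>(V, \<kappa>)\<in>A. \<exists>U u g. open U \<and> x \<in> U \<and> U \<subseteq> V \<and>
        psh_Cn n (\<kappa> ` U) u \<and> smooth_Cn n (\<kappa> ` U) g \<and>
        (\<forall>y\<in>U. \<phi> y = u (\<kappa> y) + ereal (g (\<kappa> y))))"

text \<open>A smooth volume form, viewed as the Borel measure it defines.\<close>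

definition smooth_volume ::
    "nat \<Rightarrow> ('a::topological_space) chart set \<Rightarrow> 'a measure \<Rightarrow> bool" where
  "smooth_volume n A dV \<longleftrightarrow> sets dV = sets borel \<and>
     (\<forall>(V, \<kappa>)\<in>A. \<exists>\<rho>. smooth_Cn n (\<kappa> ` V) \<rho> \<and> (\<forall>z\<in>\<kappa> ` V. 0 < \<rho> z) \<and>
        (\<forall>B\<in>sets borel. B \<subseteq> V \<longrightarrow>
           emeasure dV B = (\<integral>\<^sup>+z\<in>\<kappa> ` B. ennreal (\<rho> z) \<partial>Leb n)))"


section \<open>Multiplier ideals\<close>

text \<open>
  Germs at x are classes of functions agreeing near x. A germ of a holomorphic function is
  represented by a total function; its values away from x are irrelevant.
\<close>

definition germ :: "('a::topological_space) \<Rightarrow> ('a \<Rightarrow> complex) \<Rightarrow> ('a \<Rightarrow> complex) set" where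
  "germ x f = {g. \<forall>\<^sub>F y in nhds x. g y = f y}"

definition exp_ext :: "ereal \<Rightarrow> ennreal" where
  "exp_ext e = (case e of ereal r \<Rightarrow> ennreal (exp r) | PInfty \<Rightarrow> \<infinity> | MInfty \<Rightarrow> 0)"

text \<open>Real powers of a nonnegative number, with values in \<open>[0, \<infinity>]\<close>; negative powers of 0 are \<open>\<infinity>\<close>.\<close>

definition pow_ext :: "real \<Rightarrow> real \<Rightarrow> ennreal" where
  "pow_ext t a = (if t = 0 then (if a > 0 then 0 else if a = 0 then 1 else \<infinity>)
                  else ennreal (t powr a))"

text \<open>
  The stalk at x of the multiplier ideal sheaf of \<open>\<psi>\<close>; integrability is with respect to Lebesgue
  measure in a coordinate chart around x.
\<close>

definition multiplier_ideal ::
    "nat \<Rightarrow> ('a::topological_space) chart set \<Rightarrow> ('a \<Rightarrow> ereal) \<Rightarrow> 'a \<Rightarrow> ('a \<Rightarrow> complex) set set"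
  where
  "multiplier_ideal n A \<psi> x =
     {germ x f | f. \<exists>(V, \<kappa>)\<in>A. \<exists>U. open U \<and> x \<in> U \<and> U \<subseteq> V \<and> holomorphic_fun n A U f \<and>
        (\<integral>\<^sup>+z\<in>\<kappa> ` U. ennreal ((cmod (f (inv_into V \<kappa> z)))\<^sup>2) * exp_ext (- 2 * \<psi> (inv_into V \<kappa> z))
           \<partial>Leb n) < \<infinity>}"


section \<open>Holomorphic line bundles\<close>

text \<open>
  A line bundle is given by its total space, the type \<open>'l\<close>, with its projection, the fibrewise
  vector space operations and a set of local trivializations \<open>(U, h)\<close>, where \<open>h\<close> is the
  complex-valued component of the isomorphism from the part of the total space over U to the
  product of U and the complex plane. The operation \<open>ladd\<close> is only relevant for two vectors in the
  same fibre. The complex structure of the total space is the one induced by the trivializations.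
\<close>

record ('a, 'l) line_bundle =
  proj :: "'l \<Rightarrow> 'a"
  lzero :: "'a \<Rightarrow> 'l"
  ladd :: "'l \<Rightarrow> 'l \<Rightarrow> 'l"
  lscale :: "complex \<Rightarrow> 'l \<Rightarrow> 'l"
  trivs :: "('a set \<times> ('l \<Rightarrow> complex)) set"

definition local_trivialization ::
    "('a::topological_space, 'l) line_bundle \<Rightarrow> 'a set \<Rightarrow> ('l \<Rightarrow> complex) \<Rightarrow> bool" where
  "local_trivialization L U h \<longleftrightarrow> open U \<and>
     bij_betw (\<lambda>v. (proj L v, h v)) {v. proj L v \<in> U} (U \<times> UNIV) \<and>
     (\<forall>x\<in>U. h (lzero L x) = 0) \<and>
     (\<forall>v w. proj L v \<in> U \<longrightarrow> proj L w = proj L v \<longrightarrow> h (ladd L v w) = h v + h w) \<and>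
     (\<forall>c v. proj L v \<in> U \<longrightarrow> h (lscale L c v) = c * h v)"

definition holomorphic_line_bundle ::
    "nat \<Rightarrow> ('a::topological_space) chart set \<Rightarrow> ('a, 'l) line_bundle \<Rightarrow> bool" where
  "holomorphic_line_bundle n A L \<longleftrightarrow>
     (\<forall>x. proj L (lzero L x) = x) \<and>
     (\<forall>v w. proj L w = proj L v \<longrightarrow> proj L (ladd L v w) = proj L v) \<and>
     (\<forall>c v. proj L (lscale L c v) = proj L v) \<and>
     (\<Union>(U, h)\<in>trivs L. U) = UNIV \<and>
     (\<forall>(U, h)\<in>trivs L. local_trivialization L U h) \<and>
     (\<forall>(U, h)\<in>trivs L. \<forall>(U', h')\<in>trivs L. \<exists>g. holomorphic_fun n A (U \<inter> U') g \<and>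
        (\<forall>v. proj L v \<in> U \<inter> U' \<longrightarrow> h' v = g (proj L v) * h v))"

definition hol_sections ::
    "nat \<Rightarrow> 'a chart set \<Rightarrow> ('a, 'l) line_bundle \<Rightarrow> ('a \<Rightarrow> 'l) set" where
  "hol_sections n A L = {s. (\<forall>x. proj L (s x) = x) \<and>
     (\<forall>(U, h)\<in>trivs L. holomorphic_fun n A U (\<lambda>x. h (s x)))}"

definition sec_add :: "('a, 'l) line_bundle \<Rightarrow> ('a \<Rightarrow> 'l) \<Rightarrow> ('a \<Rightarrow> 'l) \<Rightarrow> 'a \<Rightarrow> 'l" where
  "sec_add L s t = (\<lambda>x. ladd L (s x) (t x))"

definition sec_scale :: "('a, 'l) line_bundle \<Rightarrow> complex \<Rightarrow> ('a \<Rightarrow> 'l) \<Rightarrow> 'a \<Rightarrow> 'l" where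
  "sec_scale L c s = (\<lambda>x. lscale L c (s x))"

definition sec_subspace ::
    "nat \<Rightarrow> 'a chart set \<Rightarrow> ('a, 'l) line_bundle \<Rightarrow> ('a \<Rightarrow> 'l) set \<Rightarrow> bool" where
  "sec_subspace n A L W \<longleftrightarrow> W \<subseteq> hol_sections n A L \<and> lzero L \<in> W \<and>
     (\<forall>s\<in>W. \<forall>t\<in>W. sec_add L s t \<in> W) \<and> (\<forall>c. \<forall>s\<in>W. sec_scale L c s \<in> W)"

text \<open>The linear combination of the sections \<open>b 0, \<dots>, b (d - 1)\<close> with coefficients \<open>z\<close>.\<close>

primrec lincomb ::
    "('a, 'l) line_bundle \<Rightarrow> (nat \<Rightarrow> 'a \<Rightarrow> 'l) \<Rightarrow> nat \<Rightarrow> cvec \<Rightarrow> 'a \<Rightarrow> 'l" where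
  "lincomb L b 0 z = lzero L"
| "lincomb L b (Suc d) z = sec_add L (lincomb L b d z) (sec_scale L (z d) (b d))"

definition finite_dim_sec :: "('a, 'l) line_bundle \<Rightarrow> ('a \<Rightarrow> 'l) set \<Rightarrow> bool" where
  "finite_dim_sec L W \<longleftrightarrow> (\<exists>d b. (\<forall>i<d. b i \<in> W) \<and> lincomb L b d ` Cn d = W)"

definition basis_sec ::
    "('a, 'l) line_bundle \<Rightarrow> ('a \<Rightarrow> 'l) set \<Rightarrow> nat \<Rightarrow> (nat \<Rightarrow> 'a \<Rightarrow> 'l) \<Rightarrow> bool" where
  "basis_sec L W d b \<longleftrightarrow> (\<forall>i<d. b i \<in> W) \<and> bij_betw (lincomb L b d) (Cn d) W"

definition generates_fibers :: "('a, 'l) line_bundle \<Rightarrow> ('a \<Rightarrow> 'l) set \<Rightarrow> bool" where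
  "generates_fibers L W \<longleftrightarrow> (\<forall>x. (\<lambda>s. s x) ` W = {v. proj L v = x})"


section \<open>The projective space of lines\<close>

definition line_of :: "('a, 'l) line_bundle \<Rightarrow> ('a \<Rightarrow> 'l) \<Rightarrow> ('a \<Rightarrow> 'l) set" where
  "line_of L s = {sec_scale L c s | c. True}"

definition proj_space :: "('a, 'l) line_bundle \<Rightarrow> ('a \<Rightarrow> 'l) set \<Rightarrow> ('a \<Rightarrow> 'l) set set" where
  "proj_space L W = line_of L ` (W - {lzero L})"

text \<open>
  A basis \<open>b 0, \<dots>, b m\<close> of W defines the affine parametrization sending
  \<open>(z 0, \<dots>, z (m - 1))\<close> to the class of \<open>z 0 b 0 + \<dots> + z (m - 1) b (m - 1) + b m\<close>.
  Since all bases are considered, permutations included, these parametrizations are inverse to the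
  charts of an atlas of the projective space. A subset has measure zero if it is Lebesgue
  negligible in all of these charts.
\<close>

definition measure_zero_proj ::
    "('a, 'l) line_bundle \<Rightarrow> ('a \<Rightarrow> 'l) set \<Rightarrow> ('a \<Rightarrow> 'l) set set \<Rightarrow> bool" where
  "measure_zero_proj L W N \<longleftrightarrow>
     (\<forall>m b. basis_sec L W (Suc m) b \<longrightarrow>
        {z\<in>Cn m. line_of L (sec_add L (lincomb L b m z) (b m)) \<in> N} \<in> null_sets (completion (Leb m)))"


section \<open>The ideal defined by a section\<close>

text \<open>
  The absolute value of s is taken in a local trivialization of L over a neighbourhood of x.
\<close>

definition section_ideal ::
    "nat \<Rightarrow> ('a::topological_space) chart set \<Rightarrow> ('a, 'l) line_bundle \<Rightarrow> 'a measure \<Rightarrow>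
     ('a \<Rightarrow> ereal) \<Rightarrow> ('a \<Rightarrow> 'l) \<Rightarrow> ('a \<Rightarrow> real) \<Rightarrow> ('a \<Rightarrow> real) \<Rightarrow> 'a \<Rightarrow> ('a \<Rightarrow> complex) set set"
  where
  "section_ideal n A L dV \<phi> s \<sigma> \<epsilon> x =
     {germ x f | f. \<exists>(V, h)\<in>trivs L. \<exists>U. open U \<and> x \<in> U \<and> U \<subseteq> V \<and> holomorphic_fun n A U f \<and>
        (\<integral>\<^sup>+y\<in>U. ennreal ((cmod (f y))\<^sup>2) / pow_ext (cmod (h (s y))) (2 * (1 - \<epsilon> y))
                  * exp_ext (- 2 * ereal (1 + \<sigma> y) * \<phi> y) \<partial>dV) < \<infinity>}"

end

theory Submission
  imports Defs "HOL-Complex_Analysis.Complex_Analysis"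
begin

text \<open>
  Put \<open>w = exp (- 2 \<phi>)\<close> and \<open>w\<^sub>0 = exp (- 2 (1 + \<sigma>\<^sub>0) \<phi>)\<close>. By the uniform boundedness principle, equality of the two ideals
  bounds the \<open>w\<^sub>0\<close>-norm on a smaller domain by the \<open>w\<close>-norm on a larger one, for holomorphic functions.
  Choose an orthonormal basis of the \<open>w\<close>-space over a polydisc that is adapted to evaluation at finer
  and finer grids, so that its late members are exponentially small on a smaller polydisc. The
  elementary inequality \<open>w \<le> t w\<^sub>0 + t powr - b\<close> then makes their \<open>w\<close>-norms, hence their
  \<open>w\<^sub>0\<close>-norms, summable. So the reproducing kernel G, for which \<open>|f|\<^sup>2 \<le> C G\<close> for all f of the
  space at once, is locally integrable against \<open>w\<^sub>0\<close>; this replaces the coherence of the multiplier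
  ideal sheaf. As the integral of \<open>|s y| powr - 2 p\<close> over the sections s in a ball of W is locally
  bounded in y for \<open>p < 1\<close>, Tonelli's theorem makes \<open>G w\<^sub>0 |s| powr - 2 p\<close> locally integrable for
  almost every s, for countably many polydiscs and exponents simultaneously, which gives one inclusion.
  The other one follows from Young's inequality \<open>b \<le> a b powr (1 + \<sigma>) + a powr (- 1 / \<sigma>)\<close> with \<open>b = w\<close>
  and \<open>a = |s| powr (2 (\<epsilon> - 1))\<close>.
\<close>

section \<open>Complete quadratic function spaces\<close>

text \<open>The exceptional set has to serve all points, germs, exponents and volumes at once, so
  genericity of s may only consist of countably many integrability conditions that mention no germ.
  One function G dominating a whole space of holomorphic functions over a domain makes this
  possible. The obstacle is that equality of the ideals is qualitative, and that uniform boundedness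
  turns it into an operator bound only, whereas integrability of G is a trace condition. Smallness
  must come from restriction to a smaller domain. But w is unbounded near the poles of \<phi>, so a
  uniformly small function need not have a small w-norm. Hence the splitting of w, and two
  applications of the norm comparison on three nested polydiscs: one bounds the part that carries
  \<open>w\<^sub>0\<close>, the other converts a small w-norm into a small
  \<open>w\<^sub>0\<close>-norm. Hilbert spaces enter only through a squared seminorm Q on total
  functions: the parallelogram law, Young's inequality and limits of rapidly converging sequences
  replace the inner product.\<close>

locale quadratic_space =
  fixes E :: "('x \<Rightarrow> complex) set" and Q :: "('x \<Rightarrow> complex) \<Rightarrow> real"
  assumes zero_mem: "(\<lambda>_. 0) \<in> E"
    and lin: "f \<in> E \<Longrightarrow> g \<in> E \<Longrightarrow> (\<lambda>x. a * f x + b * g x) \<in> E"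
    and nonneg: "f \<in> E \<Longrightarrow> 0 \<le> Q f"
    and scale: "f \<in> E \<Longrightarrow> Q (\<lambda>x. a * f x) = (cmod a)\<^sup>2 * Q f"
    and parallelogram: "f \<in> E \<Longrightarrow> g \<in> E \<Longrightarrow>
      Q (\<lambda>x. f x + g x) + Q (\<lambda>x. f x - g x) = 2 * Q f + 2 * Q g"
    and young: "f \<in> E \<Longrightarrow> g \<in> E \<Longrightarrow> 0 < t \<Longrightarrow>
      Q (\<lambda>x. f x + g x) \<le> (1 + t) * Q f + (1 + 1 / t) * Q g"
    and complete: "\<forall>k. u k \<in> E \<Longrightarrow> \<forall>k. Q (\<lambda>x. u (Suc k) x - u k x) \<le> (1/16) ^ k \<Longrightarrow>
      \<exists>f\<in>E. \<forall>k. Q (\<lambda>x. f x - u k x) \<le> 4 * (1/16) ^ k"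
begin

lemma add_mem: "f \<in> E \<Longrightarrow> g \<in> E \<Longrightarrow> (\<lambda>x. f x + g x) \<in> E"
  using lin[of f g 1 1] by simp

lemma diff_mem: "f \<in> E \<Longrightarrow> g \<in> E \<Longrightarrow> (\<lambda>x. f x - g x) \<in> E"
  using lin[of f g 1 "-1"] by simp

lemma scale_mem: "f \<in> E \<Longrightarrow> (\<lambda>x. a * f x) \<in> E"
  using lin[of f f a 0] by simp

lemma sum_mem: "finite S \<Longrightarrow> (\<And>p. p \<in> S \<Longrightarrow> e p \<in> E) \<Longrightarrow> (\<lambda>x. \<Sum>p\<in>S. a p * e p x) \<in> E"
proof (induction S rule: finite_induct)
  case (insert q S)
  then have "(\<lambda>x. a q * e q x + (\<Sum>p\<in>S. a p * e p x)) \<in> E"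
    by (intro add_mem scale_mem) auto
  with insert.hyps show ?case by simp
qed (simp add: zero_mem)

text \<open>Evaluations at points of P are bounded with respect to Q, so vanishing on P passes to
  the limits supplied by \<open>complete\<close>. The other axioms are inherited by every linear
  subspace.\<close>

lemma vanishing_subspace:
  assumes ev: "\<And>p. p \<in> P \<Longrightarrow> \<exists>C. \<forall>f\<in>E. (cmod (f p))\<^sup>2 \<le> C * Q f"
  shows "quadratic_space {f\<in>E. \<forall>p\<in>P. f p = 0} Q"
proof
  fix u :: "nat \<Rightarrow> 'x \<Rightarrow> complex"
  assume u: "\<forall>k. u k \<in> {f\<in>E. \<forall>p\<in>P. f p = 0}"
    and fast: "\<forall>k. Q (\<lambda>x. u (Suc k) x - u k x) \<le> (1/16) ^ k"
  obtain f where f: "f \<in> E" "\<And>k. Q (\<lambda>x. f x - u k x) \<le> 4 * (1/16) ^ k"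
    using complete[of u] u fast by auto
  have "f p = 0" if p: "p \<in> P" for p
  proof -
    obtain C where C: "\<And>f. f \<in> E \<Longrightarrow> (cmod (f p))\<^sup>2 \<le> C * Q f" using ev[OF p] by blast
    have "(cmod (f p))\<^sup>2 \<le> \<bar>C\<bar> * (4 * (1/16) ^ k)" for k
    proof -
      have mem: "(\<lambda>x. f x - u k x) \<in> E" using f u by (auto intro: diff_mem)
      have "(cmod (f p))\<^sup>2 \<le> C * Q (\<lambda>x. f x - u k x)" using C[OF mem] u p by auto
      also have "\<dots> \<le> \<bar>C\<bar> * Q (\<lambda>x. f x - u k x)" using nonneg[OF mem] by (intro mult_right_mono) auto
      also have "\<dots> \<le> \<bar>C\<bar> * (4 * (1/16) ^ k)" using f(2) by (intro mult_left_mono) auto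
      finally show ?thesis .
    qed
    moreover have "(\<lambda>k. \<bar>C\<bar> * (4 * (1/16) ^ k)) \<longlonglongrightarrow> \<bar>C\<bar> * (4 * 0)"
      by (intro tendsto_intros) (auto intro!: LIMSEQ_power_zero)
    ultimately have "(cmod (f p))\<^sup>2 \<le> 0" by (intro LIMSEQ_le_const) auto
    then show ?thesis by simp
  qed
  with f show "\<exists>f\<in>{f \<in> E. \<forall>p\<in>P. f p = 0}. \<forall>k. Q (\<lambda>x. f x - u k x) \<le> 4 * (1/16) ^ k" by blast
qed (use zero_mem lin nonneg scale parallelogram young in auto)

text \<open>Midpoints of functions with value 1 at p again have value 1, so the parallelogram law
  makes a minimizing sequence converge rapidly. Boundedness of the evaluation keeps the value 1 in
  the limit.\<close>

lemma minimizer_exists: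
  assumes C: "\<And>f. f \<in> E \<Longrightarrow> (cmod (f p))\<^sup>2 \<le> C * Q f"
    and f1: "f1 \<in> E" "f1 p = 1"
  obtains e where "e \<in> E" "e p = 1" "\<And>g. g \<in> E \<Longrightarrow> g p = 1 \<Longrightarrow> Q e \<le> Q g"
proof -
  define m where "m = Inf (Q ` {g\<in>E. g p = 1})"
  have bdd: "bdd_below (Q ` {g\<in>E. g p = 1})" using nonneg by (auto intro!: bdd_belowI)
  have m_le: "m \<le> Q g" if "g \<in> E" "g p = 1" for g
    unfolding m_def using that bdd by (intro cInf_lower) auto
  \<comment> \<open>With this slack the parallelogram law bounds Q of successive differences by
    17/32 * (1/16)^k, within the rate demanded by \<open>complete\<close>.\<close>
  have "\<exists>g\<in>E. g p = 1 \<and> Q g < m + (1/16)^k / 4" for k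
  proof -
    have "\<exists>y\<in>Q ` {g\<in>E. g p = 1}. y < m + (1/16)^k / 4"
      using f1 bdd unfolding m_def by (subst cInf_less_iff[symmetric]) auto
    then show ?thesis by auto
  qed
  then obtain u where u: "\<And>k. u k \<in> E" "\<And>k. u k p = 1" "\<And>k. Q (u k) < m + (1/16)^k / 4" by metis
  have fast: "Q (\<lambda>x. u (Suc k) x - u k x) \<le> (1/16)^k" for k
  proof -
    have mem: "(\<lambda>x. 1/2 * u j x) \<in> E" for j by (rule scale_mem[OF u(1)])
    have "Q (\<lambda>x. 1/2 * u (Suc k) x + 1/2 * u k x) + Q (\<lambda>x. 1/2 * u (Suc k) x - 1/2 * u k x)
       = 2 * Q (\<lambda>x. 1/2 * u (Suc k) x) + 2 * Q (\<lambda>x. 1/2 * u k x)"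
      by (rule parallelogram[OF mem mem])
    also have "\<dots> = Q (u (Suc k)) / 2 + Q (u k) / 2"
      using scale[OF u(1)[of k], of "1/2"] scale[OF u(1)[of "Suc k"], of "1/2"]
      by (simp add: norm_divide power2_eq_square)
    finally have 1: "Q (\<lambda>x. 1/2 * u (Suc k) x + 1/2 * u k x) + Q (\<lambda>x. 1/2 * u (Suc k) x - 1/2 * u k x)
      = Q (u (Suc k)) / 2 + Q (u k) / 2" .
    have 2: "m \<le> Q (\<lambda>x. 1/2 * u (Suc k) x + 1/2 * u k x)"
      by (rule m_le) (use lin[OF u(1) u(1), of "1/2" "Suc k" "1/2" k] u(2) in auto)
    have "(\<lambda>x. 1/2 * u (Suc k) x - 1/2 * u k x) = (\<lambda>x. 1/2 * (u (Suc k) x - u k x))"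
      by (auto simp: algebra_simps)
    then have 3: "Q (\<lambda>x. 1/2 * u (Suc k) x - 1/2 * u k x) = Q (\<lambda>x. u (Suc k) x - u k x) / 4"
      using scale[OF diff_mem[OF u(1) u(1)], of "1/2" "Suc k" k]
      by (simp add: norm_divide power2_eq_square)
    define P :: real where "P = (1/16) ^ k"
    have P: "0 \<le> P" "(1/16) ^ Suc k = P / 16" by (simp_all add: P_def)
    show ?thesis
      using u(3)[of "Suc k"] u(3)[of k] 1 2 3 unfolding P(2) P_def[symmetric] using P(1) by linarith
  qed
  obtain f where f: "f \<in> E" "\<And>k. Q (\<lambda>x. f x - u k x) \<le> 4 * (1/16) ^ k"
    using complete[of u] u fast by auto
  have mem: "(\<lambda>x. f x - u k x) \<in> E" for k using f u by (auto intro: diff_mem)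
  have lim: "(\<lambda>k. c * (d * (1/16) ^ k)) \<longlonglongrightarrow> 0" for c d :: real
    by (intro tendsto_mult_right_zero) (auto intro!: LIMSEQ_power_zero)
  have "(cmod (f p - 1))\<^sup>2 \<le> \<bar>C\<bar> * (4 * (1/16) ^ k)" for k
  proof -
    have "(cmod (f p - 1))\<^sup>2 \<le> C * Q (\<lambda>x. f x - u k x)" using C[OF mem, of k] u by auto
    also have "\<dots> \<le> \<bar>C\<bar> * Q (\<lambda>x. f x - u k x)" using nonneg[OF mem] by (intro mult_right_mono) auto
    also have "\<dots> \<le> \<bar>C\<bar> * (4 * (1/16) ^ k)" using f(2) by (intro mult_left_mono) auto
    finally show ?thesis .
  qed
  then have "(cmod (f p - 1))\<^sup>2 \<le> 0" using lim[of "\<bar>C\<bar>" 4] by (intro LIMSEQ_le_const) auto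
  then have fp: "f p = 1" by simp
  \<comment> \<open>Continuity of Q is replaced by Young's inequality for f = u k + (f - u k); the
    loss factor 1 + t is removed afterwards.\<close>
  have t: "Q f \<le> (1 + t) * m" if t: "0 < t" for t
  proof -
    have "Q f \<le> (1 + t) * m + ((1 + t) * (1/4 * (1/16)^k) + (1 + 1/t) * (4 * (1/16)^k))" for k
    proof -
      have "Q f \<le> (1 + t) * Q (u k) + (1 + 1/t) * Q (\<lambda>x. f x - u k x)"
        using young[OF u(1) mem t, of k k] by simp
      also have "\<dots> \<le> (1 + t) * (m + (1/16)^k / 4) + (1 + 1/t) * (4 * (1/16)^k)"
        using u(3)[of k] f(2)[of k] t by (intro add_mono mult_left_mono) auto
      finally show ?thesis by (simp add: algebra_simps)
    qed
    moreover have "(\<lambda>k. (1 + t) * m + ((1 + t) * (1/4 * (1/16)^k) + (1 + 1/t) * (4 * (1/16)^k)))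
        \<longlonglongrightarrow> (1 + t) * m + (0 + 0)"
      by (intro tendsto_intros lim)
    ultimately show ?thesis by (intro LIMSEQ_le_const) auto
  qed
  have m0: "0 \<le> m" unfolding m_def using f1 nonneg by (intro cInf_greatest) auto
  have "Q f \<le> m"
  proof (rule field_le_epsilon)
    fix d :: real assume d: "0 < d"
    \<comment> \<open>The denominator m + 1 covers m = 0 without a case distinction.\<close>
    have "Q f \<le> (1 + d / (m + 1)) * m" using d m0 by (intro t) auto
    also have "\<dots> = m + d * (m / (m + 1))" by (simp add: algebra_simps)
    also have "\<dots> \<le> m + d * 1" using d m0 by (intro add_mono mult_left_mono) (auto simp: field_simps)
    finally show "Q f \<le> m + d" by simp
  qed
  with f(1) fp m_le show ?thesis by (intro that[of f]) force+
qed

text \<open>With the deviation \<open>D g = Q (e + g) - Q e - Q g\<close>, the parallelogram law gives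
  \<open>D (2 g) = 2 * D g\<close> and \<open>D (- g) = - D g\<close>, while minimality gives \<open>D g \<ge> - Q g\<close>. By the first,
  \<open>D g \<ge> - Q g / 2 ^ k\<close> for all k.\<close>

lemma minimizer_orthogonal:
  assumes e: "e \<in> E" "e p = 1" "\<And>g. g \<in> E \<Longrightarrow> g p = 1 \<Longrightarrow> Q e \<le> Q g"
    and g: "g \<in> E" "g p = 0"
  shows "Q (\<lambda>x. e x + g x) = Q e + Q g"
proof -
  define D where "D h = Q (\<lambda>x. e x + h x) - Q e - Q h" for h
  have double: "D (\<lambda>x. 2 * h x) = 2 * D h" if h: "h \<in> E" for h
    using parallelogram[OF add_mem[OF e(1) h] h] scale[OF h, of 2]
    by (simp add: D_def algebra_simps)
  have neg: "D (\<lambda>x. - h x) = - D h" if h: "h \<in> E" for h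
    using parallelogram[OF e(1) h] scale[OF h, of "-1"] by (simp add: D_def)
  have lower: "- Q h / 2 ^ k \<le> D h" if h: "h \<in> E" "h p = 0" for h k
    using h
  proof (induction k arbitrary: h)
    case 0
    then show ?case using e(3)[OF add_mem[OF e(1) 0(1)]] e(2) by (simp add: D_def)
  next
    case (Suc k)
    let ?h = "\<lambda>x. 1/2 * h x"
    have h: "?h \<in> E" using Suc by (intro scale_mem)
    have "D h = 2 * D ?h" using double[OF h] by simp
    moreover have "Q ?h = Q h / 4" using scale[OF Suc(2), of "1/2"] by (simp add: norm_divide power2_eq_square)
    ultimately show ?case using Suc.IH[OF h] Suc(3) by (simp add: field_simps)
  qed
  have nn: "0 \<le> D h" if h: "h \<in> E" "h p = 0" for h
  proof -
    have "(\<lambda>k. - Q h * (1/2) ^ k) \<longlonglongrightarrow> - Q h * 0" by (intro tendsto_intros LIMSEQ_power_zero) auto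
    then show ?thesis using lower[OF h]
      by (intro LIMSEQ_le_const2) (auto simp: power_one_over field_simps)
  qed
  have "0 \<le> D (\<lambda>x. - g x)" using g scale_mem[of g "-1"] by (intro nn) auto
  then show ?thesis using nn[OF g] neg[OF g(1)] by (simp add: D_def)
qed

text \<open>The vector e is the minimizer with value 1 at p, divided by its norm: the normalized
  reproducing kernel at p. Subtracting the component along it projects orthogonally onto the
  functions vanishing at p. If all members vanish at p, the zero function serves as e.\<close>

lemma split_at_point:
  assumes C: "\<And>f. f \<in> E \<Longrightarrow> (cmod (f p))\<^sup>2 \<le> C * Q f"
  shows "\<exists>e\<in>E. Q e \<le> 1 \<and>
    (\<forall>f\<in>E. \<exists>a. (cmod a)\<^sup>2 + Q (\<lambda>x. f x - a * e x) \<le> Q f \<and> f p - a * e p = 0)"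
proof (cases "\<forall>f\<in>E. f p = 0")
  case True
  have "Q (\<lambda>_. 0) = 0" using scale[OF zero_mem, of 0] by simp
  with True show ?thesis by (intro bexI[OF _ zero_mem]) (auto intro!: exI[of _ 0])
next
  case False
  then obtain h where h: "h \<in> E" "h p \<noteq> 0" by auto
  obtain e where e: "e \<in> E" "e p = 1" "\<And>g. g \<in> E \<Longrightarrow> g p = 1 \<Longrightarrow> Q e \<le> Q g"
  proof (rule minimizer_exists[OF C])
    show "(\<lambda>x. 1 / h p * h x) \<in> E" by (rule scale_mem[OF h(1)])
    show "1 / h p * h p = 1" using h(2) by simp
    fix e assume "e \<in> E" "e p = 1" "\<And>g. g \<in> E \<Longrightarrow> g p = 1 \<Longrightarrow> Q e \<le> Q g"
    then show thesis by (rule that)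
  qed
  define m where "m = Q e"
  \<comment> \<open>The evaluation bound for the minimizer reads 1 <= C * Q e, which excludes Q e =
    0.\<close>
  have m: "0 < m" using C[OF e(1)] nonneg[OF e(1)] e(2) unfolding m_def
    by (cases "Q e = 0") auto
  define s where "s = complex_of_real (sqrt m)"
  have s: "s \<noteq> 0" "(cmod s)\<^sup>2 = m" using m by (auto simp: s_def)
  show ?thesis
  proof (intro bexI[of _ "\<lambda>x. 1 / s * e x"] conjI ballI)
    show "Q (\<lambda>x. 1 / s * e x) \<le> 1"
      using scale[OF e(1), of "1 / s"] s m by (simp add: m_def norm_divide power_divide)
    fix f assume f: "f \<in> E"
    define g where "g = (\<lambda>x. f x - f p * e x)"
    have g: "g \<in> E" "g p = 0" using diff_mem[OF f scale_mem[OF e(1)]] e(2) by (auto simp: g_def)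
    have "(cmod (f p))\<^sup>2 * m + Q g = Q f"
    proof (cases "f p = 0")
      case True
      then show ?thesis by (simp add: g_def)
    next
      case False
      \<comment> \<open>Orthogonality is available for e with coefficient 1, so f is first divided
        by f p and the identity is scaled back.\<close>
      let ?g = "\<lambda>x. 1 / f p * g x"
      have "Q (\<lambda>x. e x + ?g x) = m + Q ?g"
        unfolding m_def
        by (rule minimizer_orthogonal[OF e]) (use g scale_mem[OF g(1), of "1 / f p"] in auto)
      moreover have "Q (\<lambda>x. f p * (e x + ?g x)) = (cmod (f p))\<^sup>2 * Q (\<lambda>x. e x + ?g x)"
        by (intro scale add_mem e scale_mem g)
      moreover have "(\<lambda>x. f p * (e x + ?g x)) = f" using False by (auto simp: g_def field_simps)
      moreover have "Q ?g = Q g / (cmod (f p))\<^sup>2"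
        using scale[OF g(1), of "1 / f p"] by (simp add: norm_divide power_divide)
      ultimately show ?thesis using False by (simp add: field_simps)
    qed
    then show "\<exists>a. (cmod a)\<^sup>2 + Q (\<lambda>x. f x - a * (1 / s * e x)) \<le> Q f \<and> f p - a * (1 / s * e p) = 0"
      using s e(2) by (intro exI[of _ "f p * s"]) (auto simp: g_def norm_mult power_mult_distrib)
  qed (intro scale_mem e)
qed

end

text \<open>Gram-Schmidt for reproducing kernels, by induction with the space generalized: once q is
  split off, the remaining points are treated inside the subspace of functions vanishing at
  q.\<close>

lemma split_at_finite_set:
  assumes "finite S" "quadratic_space E Q"
    and "\<And>p. p \<in> S \<Longrightarrow> \<exists>C. \<forall>f\<in>E. (cmod (f p))\<^sup>2 \<le> C * Q f"
  shows "\<exists>e. (\<forall>p\<in>S. e p \<in> E \<and> Q (e p) \<le> 1) \<and>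
    (\<forall>f\<in>E. \<exists>a. (\<Sum>p\<in>S. (cmod (a p))\<^sup>2) + Q (\<lambda>x. f x - (\<Sum>p\<in>S. a p * e p x)) \<le> Q f \<and>
       (\<forall>q\<in>S. f q - (\<Sum>p\<in>S. a p * e p q) = 0))"
  using assms
proof (induction S arbitrary: E rule: finite_induct)
  case empty
  then show ?case by auto
next
  case (insert q S)
  interpret quadratic_space E Q by fact
  obtain C where "\<And>f. f \<in> E \<Longrightarrow> (cmod (f q))\<^sup>2 \<le> C * Q f" using insert.prems(2)[of q] by auto
  then obtain eq where eq: "eq \<in> E" "Q eq \<le> 1"
    and spl: "\<And>f. f \<in> E \<Longrightarrow> \<exists>a. (cmod a)\<^sup>2 + Q (\<lambda>x. f x - a * eq x) \<le> Q f \<and> f q - a * eq q = 0"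
    using split_at_point[of q C] by blast
  define E' where "E' = {f\<in>E. \<forall>p\<in>{q}. f p = 0}"
  have qs: "quadratic_space E' Q" unfolding E'_def by (rule vanishing_subspace) (use insert.prems(2) in auto)
  obtain e where e: "\<And>p. p \<in> S \<Longrightarrow> e p \<in> E' \<and> Q (e p) \<le> 1"
    and spl': "\<And>f. f \<in> E' \<Longrightarrow> \<exists>a. (\<Sum>p\<in>S. (cmod (a p))\<^sup>2) + Q (\<lambda>x. f x - (\<Sum>p\<in>S. a p * e p x)) \<le> Q f \<and>
       (\<forall>q\<in>S. f q - (\<Sum>p\<in>S. a p * e p q) = 0)"
  proof -
    have "\<exists>C. \<forall>f\<in>E'. (cmod (f p))\<^sup>2 \<le> C * Q f" if "p \<in> S" for p
      using insert.prems(2)[of p] that unfolding E'_def by blast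
    from insert.IH[OF qs this] show ?thesis using that by blast
  qed
  show ?case
  proof (intro exI[of _ "e(q := eq)"] conjI ballI)
    fix p assume "p \<in> insert q S"
    then show "(e(q := eq)) p \<in> E" "Q ((e(q := eq)) p) \<le> 1" using e eq by (auto simp: E'_def)
  next
    fix f assume f: "f \<in> E"
    obtain b where b: "(cmod b)\<^sup>2 + Q (\<lambda>x. f x - b * eq x) \<le> Q f" "f q - b * eq q = 0" using spl[OF f] by blast
    let ?g = "\<lambda>x. f x - b * eq x"
    have "?g \<in> E'" using b(2) diff_mem[OF f scale_mem[OF eq(1)]] by (auto simp: E'_def)
    from spl'[OF this] obtain a where a: "(\<Sum>p\<in>S. (cmod (a p))\<^sup>2) + Q (\<lambda>x. ?g x - (\<Sum>p\<in>S. a p * e p x)) \<le> Q ?g"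
       "\<And>q. q \<in> S \<Longrightarrow> ?g q - (\<Sum>p\<in>S. a p * e p q) = 0" by blast
    have sum: "(\<Sum>p\<in>insert q S. (a(q := b)) p * (e(q := eq)) p x) = b * eq x + (\<Sum>p\<in>S. a p * e p x)" for x
      using insert.hyps by (subst sum.insert) (auto intro!: sum.cong)
    have sum': "(\<Sum>p\<in>insert q S. (cmod ((a(q := b)) p))\<^sup>2) = (cmod b)\<^sup>2 + (\<Sum>p\<in>S. (cmod (a p))\<^sup>2)"
      using insert.hyps by (subst sum.insert) (auto intro!: sum.cong)
    \<comment> \<open>The vectors found for S lie in \<open>E'\<close>, so subtracting them
      preserves the zero already achieved at q.\<close>
    have "(\<Sum>p\<in>S. a p * e p q) = 0" using e by (intro sum.neutral) (auto simp: E'_def)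
    then show "\<exists>a. (\<Sum>p\<in>insert q S. (cmod (a p))\<^sup>2) + Q (\<lambda>x. f x - (\<Sum>p\<in>insert q S. a p * (e(q := eq)) p x)) \<le> Q f \<and>
       (\<forall>r\<in>insert q S. f r - (\<Sum>p\<in>insert q S. a p * (e(q := eq)) p r) = 0)"
      using a b by (intro exI[of _ "a(q := b)"], unfold sum sum') (auto simp: algebra_simps)
  qed
qed

text \<open>Stage N works in the space of functions vanishing on all earlier sets, so its vectors
  vanish there too. Only Bessel's inequality and a bounded remainder vanishing on the first N sets
  are recorded. Convergence is left to the application, where functions vanishing on fine grids are
  small.\<close>

lemma adapted_expansion:
  fixes S :: "nat \<Rightarrow> 'x set"
  assumes "quadratic_space E Q" and fin: "\<And>N. finite (S N)"
    and ev: "\<And>N p. p \<in> S N \<Longrightarrow> \<exists>C. \<forall>f\<in>E. (cmod (f p))\<^sup>2 \<le> C * Q f"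
  obtains e where "\<And>N p. p \<in> S N \<Longrightarrow> e N p \<in> E" "\<And>N p. p \<in> S N \<Longrightarrow> Q (e N p) \<le> 1"
    "\<And>N p M q. p \<in> S N \<Longrightarrow> M < N \<Longrightarrow> q \<in> S M \<Longrightarrow> e N p q = 0"
    "\<And>f. f \<in> E \<Longrightarrow> \<exists>a r. \<forall>N. (\<Sum>M<N. \<Sum>p\<in>S M. (cmod (a M p))\<^sup>2) \<le> Q f \<and> r N \<in> E \<and> Q (r N) \<le> Q f \<and>
        (\<forall>M<N. \<forall>q\<in>S M. r N q = 0) \<and> (\<forall>x. f x = (\<Sum>M<N. \<Sum>p\<in>S M. a M p * e M p x) + r N x)"
proof -
  interpret quadratic_space E Q by fact
  define F where "F N = {f\<in>E. \<forall>p\<in>(\<Union>M<N. S M). f p = 0}" for N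
  have qF: "quadratic_space (F N) Q" for N unfolding F_def by (rule vanishing_subspace) (use ev in auto)
  have "\<forall>N. \<exists>e. (\<forall>p\<in>S N. e p \<in> F N \<and> Q (e p) \<le> 1) \<and>
    (\<forall>f\<in>F N. \<exists>a. (\<Sum>p\<in>S N. (cmod (a p))\<^sup>2) + Q (\<lambda>x. f x - (\<Sum>p\<in>S N. a p * e p x)) \<le> Q f \<and>
       (\<forall>q\<in>S N. f q - (\<Sum>p\<in>S N. a p * e p q) = 0))"
  proof
    fix N
    have "\<exists>C. \<forall>f\<in>F N. (cmod (f p))\<^sup>2 \<le> C * Q f" if "p \<in> S N" for p
      using ev[OF that] unfolding F_def by blast
    from split_at_finite_set[OF fin qF this]
    show "\<exists>e. (\<forall>p\<in>S N. e p \<in> F N \<and> Q (e p) \<le> 1) \<and>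
    (\<forall>f\<in>F N. \<exists>a. (\<Sum>p\<in>S N. (cmod (a p))\<^sup>2) + Q (\<lambda>x. f x - (\<Sum>p\<in>S N. a p * e p x)) \<le> Q f \<and>
       (\<forall>q\<in>S N. f q - (\<Sum>p\<in>S N. a p * e p q) = 0))" by blast
  qed
  from choice[OF this] obtain e where ee: "\<forall>N. (\<forall>p\<in>S N. e N p \<in> F N \<and> Q (e N p) \<le> 1) \<and>
    (\<forall>f\<in>F N. \<exists>a. (\<Sum>p\<in>S N. (cmod (a p))\<^sup>2) + Q (\<lambda>x. f x - (\<Sum>p\<in>S N. a p * e N p x)) \<le> Q f \<and>
       (\<forall>q\<in>S N. f q - (\<Sum>p\<in>S N. a p * e N p q) = 0))" by blast
  then have e: "\<And>N p. p \<in> S N \<Longrightarrow> e N p \<in> F N \<and> Q (e N p) \<le> 1" by blast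
  \<comment> \<open>The coefficients are made a function of the element because each remainder is
    defined recursively from its predecessor.\<close>
  define \<alpha> where "\<alpha> N f = (SOME a. (\<Sum>p\<in>S N. (cmod (a p))\<^sup>2) + Q (\<lambda>x. f x - (\<Sum>p\<in>S N. a p * e N p x)) \<le> Q f \<and>
       (\<forall>q\<in>S N. f q - (\<Sum>p\<in>S N. a p * e N p q) = 0))" for N f
  have \<alpha>': "(\<Sum>p\<in>S N. (cmod (\<alpha> N f p))\<^sup>2) + Q (\<lambda>x. f x - (\<Sum>p\<in>S N. \<alpha> N f p * e N p x)) \<le> Q f \<and>
       (\<forall>q\<in>S N. f q - (\<Sum>p\<in>S N. \<alpha> N f p * e N p q) = 0)" if "f \<in> F N" for N f
  proof -
    have "\<exists>a. (\<Sum>p\<in>S N. (cmod (a p))\<^sup>2) + Q (\<lambda>x. f x - (\<Sum>p\<in>S N. a p * e N p x)) \<le> Q f \<and>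
       (\<forall>q\<in>S N. f q - (\<Sum>p\<in>S N. a p * e N p q) = 0)"
      using ee that by blast
    from someI_ex[OF this] show ?thesis unfolding \<alpha>_def .
  qed
  have \<alpha>: "\<And>N f. f \<in> F N \<Longrightarrow>
      (\<Sum>p\<in>S N. (cmod (\<alpha> N f p))\<^sup>2) + Q (\<lambda>x. f x - (\<Sum>p\<in>S N. \<alpha> N f p * e N p x)) \<le> Q f"
      "\<And>N f q. f \<in> F N \<Longrightarrow> q \<in> S N \<Longrightarrow> f q - (\<Sum>p\<in>S N. \<alpha> N f p * e N p q) = 0"
    using \<alpha>' by blast+
  have main: "\<exists>a r. \<forall>N. (\<Sum>M<N. \<Sum>p\<in>S M. (cmod (a M p))\<^sup>2) \<le> Q f \<and> r N \<in> E \<and> Q (r N) \<le> Q f \<and>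
        (\<forall>M<N. \<forall>q\<in>S M. r N q = 0) \<and> (\<forall>x. f x = (\<Sum>M<N. \<Sum>p\<in>S M. a M p * e M p x) + r N x)"
    if f: "f \<in> E" for f
  proof -
    define r where "r = rec_nat f (\<lambda>N g x. g x - (\<Sum>p\<in>S N. \<alpha> N g p * e N p x))"
    have r0: "r 0 = f" and rS: "\<And>N. r (Suc N) = (\<lambda>x. r N x - (\<Sum>p\<in>S N. \<alpha> N (r N) p * e N p x))"
      by (auto simp: r_def)
    have rF: "r N \<in> F N" for N
    proof (induction N)
      case 0
      then show ?case using f by (auto simp: F_def r0)
    next
      case (Suc N)
      interpret FN: quadratic_space "F N" Q by (rule qF)
      have "r (Suc N) \<in> F N" unfolding rS
        by (intro FN.diff_mem Suc FN.sum_mem fin) (use e in auto)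
      moreover have "\<forall>q\<in>S N. r (Suc N) q = 0" using \<alpha>(2)[OF Suc] by (auto simp: rS)
      ultimately show ?case by (auto simp: F_def less_Suc_eq)
    qed
    have bnd: "(\<Sum>M<N. \<Sum>p\<in>S M. (cmod (\<alpha> M (r M) p))\<^sup>2) + Q (r N) \<le> Q f" for N
    proof (induction N)
      case (Suc N)
      then show ?case using \<alpha>(1)[OF rF, of N] by (simp add: rS)
    qed (simp add: r0)
    have ex: "f x = (\<Sum>M<N. \<Sum>p\<in>S M. \<alpha> M (r M) p * e M p x) + r N x" for N x
      by (induction N) (auto simp: r0 rS)
    show ?thesis
    proof (intro exI allI conjI)
      fix N
      have "0 \<le> Q (r N)" using rF by (intro nonneg) (auto simp: F_def)
      then show "(\<Sum>M<N. \<Sum>p\<in>S M. (cmod (\<alpha> M (r M) p))\<^sup>2) \<le> Q f" using bnd[of N] by linarith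
      have "0 \<le> (\<Sum>M<N. \<Sum>p\<in>S M. (cmod (\<alpha> M (r M) p))\<^sup>2)" by (intro sum_nonneg) auto
      then show "Q (r N) \<le> Q f" using bnd[of N] by linarith
    next
      fix N x show "f x = (\<Sum>M<N. \<Sum>p\<in>S M. \<alpha> M (r M) p * e M p x) + r N x" by (rule ex)
    qed (use rF in \<open>auto simp: F_def\<close>)
  qed
  show ?thesis by (rule that[of e]) (use e main in \<open>auto simp: F_def\<close>)
qed

text \<open>The gliding-hump proof of the uniform boundedness principle by A. Sokal: of \<open>g + u\<close> and
  \<open>g - u\<close>, one is at least as large as \<open>u\<close> for \<open>T\<close>.\<close>

lemma (in quadratic_space) uniform_boundedness:
  fixes T :: "nat \<Rightarrow> ('x \<Rightarrow> complex) \<Rightarrow> real"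
  assumes Tnn: "\<And>k f. f \<in> E \<Longrightarrow> 0 \<le> T k f"
    and Tscale: "\<And>k f a. f \<in> E \<Longrightarrow> T k (\<lambda>x. a * f x) = (cmod a)\<^sup>2 * T k f"
    and Tpar: "\<And>k f g. f \<in> E \<Longrightarrow> g \<in> E \<Longrightarrow>
      T k (\<lambda>x. f x + g x) + T k (\<lambda>x. f x - g x) = 2 * T k f + 2 * T k g"
    and Tbd: "\<And>k. \<exists>C. \<forall>f\<in>E. T k f \<le> C * Q f"
    and pw: "\<And>f. f \<in> E \<Longrightarrow> \<exists>B. \<forall>k. T k f \<le> B"
  shows "\<exists>C\<ge>0. \<forall>k. \<forall>f\<in>E. T k f \<le> C * Q f"
proof (rule ccontr)
  assume contra: "\<not> ?thesis"
  define nT where "nT k = Sup (T k ` {f\<in>E. Q f \<le> 1})" for k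
  have bdd: "bdd_above (T k ` {f\<in>E. Q f \<le> 1})" for k
  proof -
    obtain C where C: "\<And>f. f \<in> E \<Longrightarrow> T k f \<le> C * Q f" using Tbd by blast
    have "T k f \<le> \<bar>C\<bar>" if "f \<in> E" "Q f \<le> 1" for f
    proof -
      have "T k f \<le> \<bar>C\<bar> * Q f" using C[OF that(1)] nonneg[OF that(1)]
        by (meson abs_ge_self mult_right_mono order_trans)
      also have "\<dots> \<le> \<bar>C\<bar> * 1" using that by (intro mult_left_mono) auto
      finally show ?thesis by simp
    qed
    then show ?thesis by (auto intro!: bdd_aboveI)
  qed
  have ne: "T k ` {f\<in>E. Q f \<le> 1} \<noteq> {}" for k
    using zero_mem scale[OF zero_mem, of 0] by auto
  have T_le1: "T k f \<le> nT k" if "f \<in> E" "Q f \<le> 1" for k f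
    unfolding nT_def using that bdd by (intro cSup_upper) auto
  have nT0: "0 \<le> nT k" for k
    using T_le1[OF zero_mem, of k] Tnn[OF zero_mem, of k] scale[OF zero_mem, of 0] by auto
  have T_le: "T k f \<le> nT k * c" if f: "f \<in> E" "Q f \<le> c" and c: "0 < c" for k f c
  proof -
    define s where "s = complex_of_real (1 / sqrt c)"
    have s: "(cmod s)\<^sup>2 = 1 / c" using c by (auto simp: s_def norm_divide power_divide)
    have "Q (\<lambda>x. s * f x) = Q f / c" "T k (\<lambda>x. s * f x) = T k f / c"
      using scale[OF f(1), of s] Tscale[OF f(1), of k s] f c unfolding s by (auto simp: field_simps)
    moreover have "Q f / c \<le> 1" using f(2) c by simp
    ultimately have "T k f / c \<le> nT k" using T_le1[OF scale_mem[OF f(1)], of s k] by metis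
    then show ?thesis using c by (simp add: pos_divide_le_eq)
  qed
  have unb: "\<exists>k. c < nT k" for c
  proof (rule ccontr)
    assume "\<nexists>k. c < nT k"
    then have le: "nT k \<le> \<bar>c\<bar>" for k by (meson abs_ge_self not_le order_trans)
    have "T k f \<le> \<bar>c\<bar> * Q f" if f: "f \<in> E" for k f
    proof (rule field_le_epsilon)
      fix d :: real assume d: "0 < d"
      have pos: "0 < Q f + d / (\<bar>c\<bar> + 1)" using d nonneg[OF f] by (auto intro!: add_nonneg_pos)
      have "T k f \<le> nT k * (Q f + d / (\<bar>c\<bar> + 1))" using d by (intro T_le f pos) auto
      also have "\<dots> \<le> \<bar>c\<bar> * (Q f + d / (\<bar>c\<bar> + 1))" using pos le by (intro mult_right_mono) auto
      also have "\<dots> = \<bar>c\<bar> * Q f + d * (\<bar>c\<bar> / (\<bar>c\<bar> + 1))" by (simp add: algebra_simps)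
      also have "\<dots> \<le> \<bar>c\<bar> * Q f + d * 1" using d by (intro add_mono mult_left_mono) (auto simp: field_simps)
      finally show "T k f \<le> \<bar>c\<bar> * Q f + d" by simp
    qed
    with contra show False by (meson abs_ge_zero)
  qed
  \<comment> \<open>The factor 16^j offsets the step sizes (1/16)^j, and the additional factor j
    makes the values of T at the limit unbounded.\<close>
  have "\<forall>j::nat. \<exists>k. 16 ^ j * real j < nT k" using unb by blast
  from choice[OF this] obtain \<kappa> where \<kappa>: "\<And>j::nat. 16 ^ j * real j < nT (\<kappa> j)" by blast
  \<comment> \<open>A near-maximizer of T on the unit ball, within the factor 3/4, scaled by
    (1/4)^j.\<close>
  have "\<exists>u\<in>E. Q u \<le> (1/16)^j \<and> 3/4 * (1/16)^j * nT (\<kappa> j) \<le> T (\<kappa> j) u" for j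
  proof -
    have pos: "0 < nT (\<kappa> j)" using \<kappa>[of j] by (meson mult_nonneg_nonneg of_nat_0_le_iff order_le_less_trans zero_le_numeral zero_le_power)
    then have "3/4 * nT (\<kappa> j) < nT (\<kappa> j)" by simp
    then obtain f where f: "f \<in> E" "Q f \<le> 1" "3/4 * nT (\<kappa> j) < T (\<kappa> j) f"
      unfolding nT_def using less_cSup_iff[OF ne bdd] by (auto simp del: less_cSup_iff)
    let ?s = "complex_of_real ((1/4)^j)"
    have s: "(cmod ?s)\<^sup>2 = (1/16)^j"
      by (simp add: norm_power norm_divide power_mult[symmetric] mult.commute[of j] power_mult power_divide)
    show ?thesis
      by (rule bexI[OF _ scale_mem[OF f(1), of ?s]])
        (use f scale[OF f(1), of ?s] Tscale[OF f(1), of "\<kappa> j" ?s] s in \<open>auto simp: mult_left_le field_simps\<close>)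
  qed
  then obtain u where u: "\<And>j. u j \<in> E" "\<And>j. Q (u j) \<le> (1/16)^j"
    "\<And>j. 3/4 * (1/16)^j * nT (\<kappa> j) \<le> T (\<kappa> j) (u j)" by metis
  have step: "\<exists>g'\<in>E. Q (\<lambda>x. g' x - g x) \<le> (1/16)^j \<and> T (\<kappa> j) (u j) \<le> T (\<kappa> j) g'" if g: "g \<in> E" for g j
  proof -
    have "T (\<kappa> j) (\<lambda>x. g x + u j x) + T (\<kappa> j) (\<lambda>x. g x - u j x) = 2 * T (\<kappa> j) g + 2 * T (\<kappa> j) (u j)"
      by (rule Tpar[OF g u(1)])
    then consider "T (\<kappa> j) (u j) \<le> T (\<kappa> j) (\<lambda>x. g x + u j x)" | "T (\<kappa> j) (u j) \<le> T (\<kappa> j) (\<lambda>x. g x - u j x)"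
      using Tnn[OF g, of "\<kappa> j"] by fastforce
    then show ?thesis
    proof cases
      case 1
      then show ?thesis by (intro bexI[OF _ add_mem[OF g u(1)]]) (use u(2) in auto)
    next
      case 2
      then show ?thesis by (intro bexI[OF _ diff_mem[OF g u(1)]])
          (use u(2) scale[OF u(1), of "-1" j] in auto)
    qed
  qed
  define nx where "nx j g = (SOME g'. g' \<in> E \<and> Q (\<lambda>x. g' x - g x) \<le> (1/16)^j \<and> T (\<kappa> j) (u j) \<le> T (\<kappa> j) g')"
    for j g
  have "nx j g \<in> E \<and> Q (\<lambda>x. nx j g x - g x) \<le> (1/16)^j \<and> T (\<kappa> j) (u j) \<le> T (\<kappa> j) (nx j g)"
    if "g \<in> E" for g j
  proof -
    have "\<exists>g'. g' \<in> E \<and> Q (\<lambda>x. g' x - g x) \<le> (1/16)^j \<and> T (\<kappa> j) (u j) \<le> T (\<kappa> j) g'"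
      using step[OF that, of j] by blast
    from someI_ex[OF this] show ?thesis unfolding nx_def .
  qed
  then have nx: "\<And>g j. g \<in> E \<Longrightarrow> nx j g \<in> E" "\<And>g j. g \<in> E \<Longrightarrow> Q (\<lambda>x. nx j g x - g x) \<le> (1/16)^j"
    "\<And>g j. g \<in> E \<Longrightarrow> T (\<kappa> j) (u j) \<le> T (\<kappa> j) (nx j g)" by blast+
  define g where "g = rec_nat (\<lambda>_. 0) nx"
  have gS: "g (Suc j) = nx j (g j)" for j by (simp add: g_def)
  have gE: "g j \<in> E" for j by (induction j) (auto simp: gS nx zero_mem, simp add: g_def zero_mem)
  have "\<forall>k. Q (\<lambda>x. g (Suc k) x - g k x) \<le> (1/16) ^ k" using nx(2)[OF gE] by (simp add: gS)
  then obtain f where f: "f \<in> E" "\<And>k. Q (\<lambda>x. f x - g k x) \<le> 4 * (1/16) ^ k" using complete[of g] gE by auto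
  have low: "real j / 8 \<le> T (\<kappa> j) f" for j
  proof -
    have mem: "(\<lambda>x. f x - g (Suc j) x) \<in> E" by (intro diff_mem f gE)
    have "(\<lambda>x. f x - (f x - g (Suc j) x)) = g (Suc j)" by auto
    \<comment> \<open>Write X for (1/16)^j * nT (\<kappa> j). The left side is at least 3/4 X and
      the tail contributes at most 2 * X/4, so T at the limit f is at least X/8.\<close>
    then have "T (\<kappa> j) (g (Suc j)) \<le> 2 * T (\<kappa> j) f + 2 * T (\<kappa> j) (\<lambda>x. f x - g (Suc j) x)"
      using Tpar[OF f(1) mem, of "\<kappa> j"] Tnn[OF add_mem[OF f(1) mem], of "\<kappa> j"] by auto
    moreover have "T (\<kappa> j) (\<lambda>x. f x - g (Suc j) x) \<le> nT (\<kappa> j) * (4 * (1/16) ^ Suc j)"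
      by (intro T_le mem f) auto
    moreover have "3/4 * (1/16)^j * nT (\<kappa> j) \<le> T (\<kappa> j) (g (Suc j))"
      using u(3)[of j] nx(3)[OF gE, of j j] by (simp add: gS)
    moreover define X where "X = (1/16)^j * nT (\<kappa> j)"
    moreover have "nT (\<kappa> j) * (4 * (1/16) ^ Suc j) = X / 4" "3/4 * (1/16)^j * nT (\<kappa> j) = 3/4 * X"
      "1/8 * (1/16)^j * nT (\<kappa> j) = X / 8"
      by (simp_all add: X_def)
    ultimately have "1/8 * (1/16)^j * nT (\<kappa> j) \<le> T (\<kappa> j) f" by linarith
    moreover have "1/8 * (1/16)^j * (16 ^ j * real j) \<le> 1/8 * (1/16)^j * nT (\<kappa> j)"
      using \<kappa>[of j] by (intro mult_left_mono) auto
    ultimately show ?thesis by (simp add: power_one_over)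
  qed
  obtain B where B: "\<And>k. T k f \<le> B" using pw[OF f(1)] by blast
  obtain j :: nat where "8 * B < real j" using reals_Archimedean2 by blast
  with low[of j] B[of "\<kappa> j"] show False by simp
qed

section \<open>One complex variable\<close>

lemma lborel_complex_eq_distr:
  "(lborel :: complex measure) = distr (lborel \<Otimes>\<^sub>M lborel) borel (\<lambda>(x, y). Complex x y)"
proof (rule lborel_eqI)
  have [measurable]: "(\<lambda>(x, y). Complex x y) \<in> borel_measurable (borel \<Otimes>\<^sub>M borel)"
    by (simp add: Complex_eq split_beta)
  fix l u :: complex assume le: "\<And>b. b \<in> Basis \<Longrightarrow> l \<bullet> b \<le> u \<bullet> b"
  have vim: "(\<lambda>(x, y). Complex x y) -` box l u \<inter> space (lborel \<Otimes>\<^sub>M lborel) = {Re l<..<Re u} \<times> {Im l<..<Im u}"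
    by (auto simp: in_box_complex_iff space_pair_measure)
  have "emeasure (distr (lborel \<Otimes>\<^sub>M lborel) borel (\<lambda>(x, y). Complex x y)) (box l u)
      = emeasure (lborel \<Otimes>\<^sub>M lborel) ({Re l<..<Re u} \<times> {Im l<..<Im u})"
    by (subst emeasure_distr) (auto simp: vim)
  also have "\<dots> = emeasure lborel {Re l<..<Re u} * emeasure lborel {Im l<..<Im u}"
    by (rule lborel.emeasure_pair_measure_Times) auto
  also have "\<dots> = (\<Prod>b\<in>Basis. (u - l) \<bullet> b)"
    using le[of 1] le[of \<i>] by (simp add: Basis_complex_def ennreal_mult'[symmetric])
  finally show "emeasure (distr (lborel \<Otimes>\<^sub>M lborel) borel (\<lambda>(x, y). Complex x y)) (box l u)
      = (\<Prod>b\<in>Basis. (u - l) \<bullet> b)" .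
qed simp

lemma nn_integral_complex:
  assumes [measurable]: "F \<in> borel_measurable borel"
  shows "(\<integral>\<^sup>+w. F w \<partial>lborel) = (\<integral>\<^sup>+x. (\<integral>\<^sup>+y. F (Complex x y) \<partial>lborel) \<partial>lborel)"
    and "(\<integral>\<^sup>+w. F w \<partial>lborel) = (\<integral>\<^sup>+y. (\<integral>\<^sup>+x. F (Complex x y) \<partial>lborel) \<partial>lborel)"
proof -
  have [measurable]: "(\<lambda>(x, y). Complex x y) \<in> borel_measurable (borel \<Otimes>\<^sub>M borel)"
    by (simp add: Complex_eq split_beta)
  have "(\<integral>\<^sup>+w. F w \<partial>lborel) = (\<integral>\<^sup>+z. F (case z of (x, y) \<Rightarrow> Complex x y) \<partial>(lborel \<Otimes>\<^sub>M lborel))"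
    by (subst lborel_complex_eq_distr) (simp add: nn_integral_distr)
  then show 1: "(\<integral>\<^sup>+w. F w \<partial>lborel) = (\<integral>\<^sup>+x. (\<integral>\<^sup>+y. F (Complex x y) \<partial>lborel) \<partial>lborel)"
    by (subst (asm) lborel.nn_integral_fst[symmetric]) auto
  have "(\<integral>\<^sup>+x. (\<integral>\<^sup>+y. F (Complex x y) \<partial>lborel) \<partial>lborel) = (\<integral>\<^sup>+y. (\<integral>\<^sup>+x. F (Complex x y) \<partial>lborel) \<partial>lborel)"
    by (rule lborel_pair.Fubini'[symmetric]) measurable
  with 1 show "(\<integral>\<^sup>+w. F w \<partial>lborel) = (\<integral>\<^sup>+y. (\<integral>\<^sup>+x. F (Complex x y) \<partial>lborel) \<partial>lborel)" by simp
qed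

lemma nn_integral_translate:
  fixes F :: "'a::euclidean_space \<Rightarrow> ennreal"
  assumes [measurable]: "F \<in> borel_measurable borel"
  shows "(\<integral>\<^sup>+x. F (x + c) \<partial>lborel) = (\<integral>\<^sup>+x. F x \<partial>lborel)"
proof -
  have "(\<integral>\<^sup>+x. F x \<partial>lborel) = (\<integral>\<^sup>+x. F x \<partial>distr lborel borel ((+) c))" by (simp add: lborel_distr_plus)
  also have "\<dots> = (\<integral>\<^sup>+x. F (x + c) \<partial>lborel)" by (subst nn_integral_distr) (auto simp: add.commute)
  finally show ?thesis by simp
qed

text \<open>A rotation is a product of three shears.\<close>

lemma nn_integral_rotate:
  assumes F [measurable]: "F \<in> borel_measurable borel" and t: "cos t \<noteq> -1"
  shows "(\<integral>\<^sup>+w. F (cis t * w) \<partial>lborel) = (\<integral>\<^sup>+w. F w \<partial>lborel)"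
proof -
  define X where "X a w = Complex (Re w + a * Im w) (Im w)" for a w
  define Y where "Y b w = Complex (Re w) (Im w + b * Re w)" for b w
  have [measurable]: "X a \<in> borel_measurable borel" "Y a \<in> borel_measurable borel" for a
    unfolding X_def Y_def by (simp_all add: Complex_eq)
  have shX: "(\<integral>\<^sup>+w. G (X a w) \<partial>lborel) = (\<integral>\<^sup>+w. G w \<partial>lborel)"
    if [measurable]: "G \<in> borel_measurable borel" for a and G :: "complex \<Rightarrow> ennreal"
  proof -
    have m: "(\<lambda>x. G (Complex x y)) \<in> borel_measurable borel" for y by (simp add: Complex_eq)
    have "(\<integral>\<^sup>+w. G (X a w) \<partial>lborel) = (\<integral>\<^sup>+y. (\<integral>\<^sup>+x. G (X a (Complex x y)) \<partial>lborel) \<partial>lborel)"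
      by (rule nn_integral_complex(2)) measurable
    also have "\<dots> = (\<integral>\<^sup>+y. (\<integral>\<^sup>+x. G (Complex (x + a * y) y) \<partial>lborel) \<partial>lborel)" by (simp add: X_def)
    also have "\<dots> = (\<integral>\<^sup>+y. (\<integral>\<^sup>+x. G (Complex x y) \<partial>lborel) \<partial>lborel)" by (simp add: nn_integral_translate[OF m])
    also have "\<dots> = (\<integral>\<^sup>+w. G w \<partial>lborel)" by (rule nn_integral_complex(2)[symmetric]) measurable
    finally show ?thesis .
  qed
  have shY: "(\<integral>\<^sup>+w. G (Y a w) \<partial>lborel) = (\<integral>\<^sup>+w. G w \<partial>lborel)"
    if [measurable]: "G \<in> borel_measurable borel" for a and G :: "complex \<Rightarrow> ennreal"
  proof -
    have m: "(\<lambda>y. G (Complex x y)) \<in> borel_measurable borel" for x by (simp add: Complex_eq)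
    have "(\<integral>\<^sup>+w. G (Y a w) \<partial>lborel) = (\<integral>\<^sup>+x. (\<integral>\<^sup>+y. G (Y a (Complex x y)) \<partial>lborel) \<partial>lborel)"
      by (rule nn_integral_complex(1)) measurable
    also have "\<dots> = (\<integral>\<^sup>+x. (\<integral>\<^sup>+y. G (Complex x (y + a * x)) \<partial>lborel) \<partial>lborel)" by (simp add: Y_def)
    also have "\<dots> = (\<integral>\<^sup>+x. (\<integral>\<^sup>+y. G (Complex x y) \<partial>lborel) \<partial>lborel)" by (simp add: nn_integral_translate[OF m])
    also have "\<dots> = (\<integral>\<^sup>+w. G w \<partial>lborel)" by (rule nn_integral_complex(1)[symmetric]) measurable
    finally show ?thesis .
  qed
  \<comment> \<open>This is - tan (t / 2), the factor of the two horizontal shears. It has no value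
    for the half turn, whence the exclusion of cos t = -1.\<close>
  define a where "a = - sin t / (1 + cos t)"
  have nz: "1 + cos t \<noteq> 0" using t by linarith
  have s2: "sin t * sin t = (1 - cos t) * (1 + cos t)"
    using sin_cos_squared_add[of t] by (simp add: power2_eq_square algebra_simps)
  have 1: "1 + a * sin t = cos t"
  proof -
    have "a * sin t = - (sin t * sin t) / (1 + cos t)" by (simp add: a_def)
    also have "\<dots> = - (1 - cos t)" using nz by (simp only: s2) (simp add: field_simps)
    finally show ?thesis by simp
  qed
  have 2: "a + a * (1 + sin t * a) = - sin t"
  proof -
    have "a + a * (1 + sin t * a) = a * (1 + cos t)" using 1 by (simp add: algebra_simps)
    then show ?thesis using nz by (simp add: a_def)
  qed
  have rot: "cis t * w = X a (Y (sin t) (X a w))" for w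
  proof (rule complex_eqI)
    have "Re (X a (Y (sin t) (X a w))) = (1 + a * sin t) * Re w + (a + a * (1 + sin t * a)) * Im w"
      by (simp add: X_def Y_def algebra_simps)
    then show "Re (cis t * w) = Re (X a (Y (sin t) (X a w)))" by (simp add: 1 2)
    have "Im (X a (Y (sin t) (X a w))) = sin t * Re w + (1 + a * sin t) * Im w"
      by (simp add: X_def Y_def algebra_simps)
    then show "Im (cis t * w) = Im (X a (Y (sin t) (X a w)))" by (simp add: 1 algebra_simps)
  qed
  show ?thesis unfolding rot
    using shX[of "\<lambda>w. F (X a (Y (sin t) w))" a] shY[of "\<lambda>w. F (X a w)" "sin t"] shX[of F a] by simp
qed

text \<open>Cauchy's integral formula at the centre: in the parametrization over the unit interval
  the factor 2 pi i cancels against the derivative of the path.\<close>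

lemma circle_mean_bound:
  assumes g: "g holomorphic_on cball 0 1"
  shows "ennreal (cmod (g 0)) \<le> (\<integral>\<^sup>+\<theta>. indicator {0..1} \<theta> * ennreal (cmod (g (cis (2 * pi * \<theta>)))) \<partial>lborel)"
proof -
  have int0: "((\<lambda>u. g u / (u - 0)) has_contour_integral (2 * of_real pi * \<i> * g 0)) (circlepath 0 1)"
    by (rule Cauchy_integral_circlepath_simple[OF g]) auto
  have vd: "vector_derivative (circlepath 0 1) (at x within {0..1}) = 2 * pi * \<i> * 1 * exp (2 * of_real pi * \<i> * x)"
    if "x \<in> {0..1}" for x
    using that by (subst vector_derivative_circlepath01) auto
  with int0 have I0: "((\<lambda>x. g (circlepath 0 1 x) / circlepath 0 1 x * vector_derivative (circlepath 0 1) (at x within {0..1}))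
      has_integral (2 * of_real pi * \<i> * g 0)) {0..1}"
    by (simp add: has_contour_integral_def)
  have eq: "g (circlepath 0 1 x) / circlepath 0 1 x * vector_derivative (circlepath 0 1) (at x within {0..1})
      = (2 * of_real pi * \<i>) * g (cis (2 * pi * x))" if "x \<in> {0..1}" for x
    unfolding vd[OF that] by (simp add: circlepath cis_conv_exp mult_ac)
  have "((\<lambda>x. (2 * of_real pi * \<i>) * g (cis (2 * pi * x))) has_integral (2 * of_real pi * \<i> * g 0)) {0..1}"
    by (rule has_integral_eq[OF eq I0])
  from has_integral_mult_right[OF this, of "1 / (2 * of_real pi * \<i>)"]
  have int: "((\<lambda>x. g (cis (2 * pi * x))) has_integral g 0) {0..1}" by (simp add: field_simps)
  have cont: "continuous_on {0..1} (\<lambda>x. g (cis (2 * pi * x)))"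
    by (rule continuous_on_compose2[OF holomorphic_on_imp_continuous_on[OF g]]) (auto intro!: continuous_intros)
  then have int': "(\<lambda>x. cmod (g (cis (2 * pi * x)))) integrable_on {0..1}"
    by (intro integrable_continuous_interval continuous_intros)
  have "cmod (g 0) = cmod (integral {0..1} (\<lambda>x. g (cis (2 * pi * x))))" using int by (simp add: integral_unique)
  also have "\<dots> \<le> integral {0..1} (\<lambda>x. cmod (g (cis (2 * pi * x))))"
    using int int' by (intro integral_norm_bound_integral) (auto simp: integrable_on_def)
  finally have "ennreal (cmod (g 0)) \<le> ennreal (integral {0..1} (\<lambda>x. cmod (g (cis (2 * pi * x)))))"
    by (rule ennreal_leI)
  also have "\<dots> = (\<integral>\<^sup>+\<theta>. ennreal (indicator {0..1} \<theta> * cmod (g (cis (2 * pi * \<theta>)))) \<partial>lborel)"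
    using nn_integral_has_integral_lebesgue[OF _ integrable_integral[OF int']] by simp
  also have "\<dots> = (\<integral>\<^sup>+\<theta>. indicator {0..1} \<theta> * ennreal (cmod (g (cis (2 * pi * \<theta>)))) \<partial>lborel)"
    by (intro nn_integral_cong) (auto simp: indicator_def)
  finally show ?thesis .
qed

text \<open>Averaging over rotations replaces polar coordinates. For each w of the centred disc,
  \<open>circle_mean_bound\<close> for u \<mapsto> h (c + u w)^2 bounds the value at c by an average
  over the angle. Tonelli's theorem moves the angle outside, and every rotation preserves the
  integral over w.\<close>

lemma area_mean_bound:
  assumes h: "h holomorphic_on ball c r"
  shows "emeasure lborel (ball c r) * ennreal ((cmod (h c))\<^sup>2)
    \<le> (\<integral>\<^sup>+w. indicator (ball c r) w * ennreal ((cmod (h w))\<^sup>2) \<partial>lborel)"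
proof -
  define H where "H w = ennreal ((cmod (indicator (ball c r) (w + c) *\<^sub>R h (w + c)))\<^sup>2)" for w
  have hm: "(\<lambda>w. indicator (ball c r) w *\<^sub>R h w) \<in> borel_measurable borel"
    by (intro borel_measurable_continuous_on_indicator holomorphic_on_imp_continuous_on[OF h]) auto
  have [measurable]: "(\<lambda>w. indicator (ball c r) (w + c) *\<^sub>R h (w + c)) \<in> borel_measurable borel"
    by (rule measurable_compose[OF _ hm]) auto
  have [measurable]: "H \<in> borel_measurable borel" unfolding H_def by measurable
  have [measurable]: "cis \<in> borel_measurable borel" by (intro borel_measurable_continuous_onI continuous_intros)
  \<comment> \<open>The half turn, where the decomposition into shears fails, is a single angle and
    hence negligible.\<close>
  have ae: "AE \<theta> in lborel. indicator {0..1} \<theta> * (\<integral>\<^sup>+w. H (cis (2 * pi * \<theta>) * w) \<partial>lborel)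
      = indicator {0..1::real} \<theta> * (\<integral>\<^sup>+w. H w \<partial>lborel)"
    using AE_lborel_singleton[of "1/2"]
  proof eventually_elim
    case (elim \<theta>)
    show ?case
    proof (cases "\<theta> \<in> {0..1}")
      case True
      have "cos (2 * pi * \<theta>) \<noteq> -1"
      proof
        assume "cos (2 * pi * \<theta>) = -1"
        then have "cos (2 * pi * \<theta> - pi) = 1" by (simp add: cos_diff)
        then obtain n :: int where n: "2 * pi * \<theta> - pi = of_int n * 2 * pi"
          unfolding cos_one_2pi_int by blast
        then have "pi * (2 * \<theta>) = pi * (2 * of_int n + 1)" by (simp add: algebra_simps)
        then have "2 * \<theta> = 2 * of_int n + 1" using pi_neq_zero mult_left_cancel by blast
        moreover from this True have "n = 0" by auto
        ultimately show False using elim by simp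
      qed
      then show ?thesis by (subst nn_integral_rotate) auto
    qed auto
  qed
  have pt: "indicator (ball 0 r) w * ennreal ((cmod (h c))\<^sup>2)
      \<le> (\<integral>\<^sup>+\<theta>. indicator {0..1} \<theta> * H (cis (2 * pi * \<theta>) * w) \<partial>lborel)" for w
  proof (cases "w \<in> ball 0 r")
    case True
    have sub: "c + u * w \<in> ball c r" if "u \<in> cball 0 1" for u
    proof -
      have "cmod (u * w) \<le> 1 * cmod w" unfolding norm_mult using that by (intro mult_right_mono) auto
      then show ?thesis using True by (simp add: dist_norm)
    qed
    have "(h \<circ> (\<lambda>u. c + u * w)) holomorphic_on cball 0 1"
      by (rule holomorphic_on_compose_gen[OF _ h]) (use sub in \<open>auto intro!: holomorphic_intros\<close>)
    then have "(\<lambda>u. (h (c + u * w))\<^sup>2) holomorphic_on cball 0 1"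
      unfolding o_def by (rule holomorphic_on_power)
    from circle_mean_bound[OF this] have "ennreal ((cmod (h c))\<^sup>2)
      \<le> (\<integral>\<^sup>+\<theta>. indicator {0..1} \<theta> * ennreal ((cmod (h (c + cis (2 * pi * \<theta>) * w)))\<^sup>2) \<partial>lborel)"
      by (simp add: norm_power)
    also have "\<dots> = (\<integral>\<^sup>+\<theta>. indicator {0..1} \<theta> * H (cis (2 * pi * \<theta>) * w) \<partial>lborel)"
      using sub by (intro nn_integral_cong) (auto simp: H_def add.commute)
    finally show ?thesis using True by simp
  qed auto
  have "emeasure lborel (ball c r) = emeasure lborel (ball (0::complex) r)"
  proof -
    have "(\<integral>\<^sup>+w. indicator (ball c r) (w + c) \<partial>lborel) = (\<integral>\<^sup>+w. indicator (ball c r) w \<partial>lborel)"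
      by (intro nn_integral_translate borel_measurable_indicator) auto
    also have "(\<lambda>w. indicator (ball c r) (w + c)) = (indicator (ball 0 r) :: complex \<Rightarrow> ennreal)"
      by (auto simp: indicator_def dist_norm)
    finally have "emeasure lborel (ball (0::complex) r) = emeasure lborel (ball c r)"
      by (simp only: nn_integral_indicator sets_lborel borel_open open_ball)
    then show ?thesis by (rule sym)
  qed
  then have "emeasure lborel (ball c r) * ennreal ((cmod (h c))\<^sup>2)
      = (\<integral>\<^sup>+w. indicator (ball (0::complex) r) w * ennreal ((cmod (h c))\<^sup>2) \<partial>lborel)"
    by (subst nn_integral_multc) (auto intro: borel_measurable_indicator)
  also have "\<dots> \<le> (\<integral>\<^sup>+w. (\<integral>\<^sup>+\<theta>. indicator {0..1::real} \<theta> * H (cis (2 * pi * \<theta>) * w) \<partial>lborel) \<partial>lborel)"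
    by (intro nn_integral_mono pt)
  also have "\<dots> = (\<integral>\<^sup>+\<theta>. (\<integral>\<^sup>+w. indicator {0..1::real} \<theta> * H (cis (2 * pi * \<theta>) * w) \<partial>lborel) \<partial>lborel)"
    by (rule lborel_pair.Fubini') measurable
  also have "\<dots> = (\<integral>\<^sup>+\<theta>. indicator {0..1::real} \<theta> * (\<integral>\<^sup>+w. H (cis (2 * pi * \<theta>) * w) \<partial>lborel) \<partial>lborel)"
    by (intro nn_integral_cong nn_integral_cmult) measurable
  also have "\<dots> = (\<integral>\<^sup>+\<theta>. indicator {0..1::real} \<theta> * (\<integral>\<^sup>+w. H w \<partial>lborel) \<partial>lborel)"
    by (rule nn_integral_cong_AE[OF ae])
  also have "\<dots> = (\<integral>\<^sup>+w. H w \<partial>lborel)" by (simp add: nn_integral_multc)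
  also have "\<dots> = (\<integral>\<^sup>+w. ennreal ((cmod (indicator (ball c r) w *\<^sub>R h w))\<^sup>2) \<partial>lborel)"
    unfolding H_def by (rule nn_integral_translate) (rule measurable_compose[OF hm], measurable)
  also have "\<dots> = (\<integral>\<^sup>+w. indicator (ball c r) w * ennreal ((cmod (h w))\<^sup>2) \<partial>lborel)"
    by (intro nn_integral_cong) (auto simp: indicator_def)
  finally show ?thesis .
qed

section \<open>Interpolation at roots of unity\<close>

definition root_of_unity :: "nat \<Rightarrow> nat \<Rightarrow> complex" where
  "root_of_unity N k = exp (2 * of_real pi * \<i> * of_nat k / of_nat N)"

lemma norm_root_of_unity [simp]: "cmod (root_of_unity N k) = 1"
proof -
  have "root_of_unity N k = exp (\<i> * of_real (2 * pi * k / N))" by (simp add: root_of_unity_def mult_ac)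
  then show ?thesis by simp
qed

lemma root_of_unity_power: "N \<noteq> 0 \<Longrightarrow> root_of_unity N k ^ j = root_of_unity N 1 ^ (k * (j mod N))"
proof -
  assume N: "N \<noteq> 0"
  have pw: "root_of_unity N k = root_of_unity N 1 ^ k" for k
    by (simp add: root_of_unity_def exp_of_nat_mult[symmetric] mult_ac)
  have one: "root_of_unity N k ^ N = 1" for k
    using N complex_root_unity[of N k] by (simp add: root_of_unity_def)
  have "root_of_unity N k ^ j = root_of_unity N k ^ (N * (j div N) + j mod N)" by simp
  also have "\<dots> = root_of_unity N k ^ (j mod N)" by (simp only: power_add power_mult one power_one mult_1)
  also have "\<dots> = root_of_unity N 1 ^ (k * (j mod N))" by (simp only: pw[of k] power_mult)
  finally show ?thesis .
qed

text \<open>Each summand is the k-th power of x = \<omega>^(m mod N) / \<omega>^j, an N-th root of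
  unity that is 1 only for m mod N = j. The sum is therefore geometric; this is the orthogonality of
  the characters of a cyclic group.\<close>

lemma sum_roots_of_unity:
  assumes N: "N \<noteq> 0" and j: "j < N"
  shows "(\<Sum>k<N. root_of_unity N k ^ m / root_of_unity N k ^ j) = (if m mod N = j then of_nat N else 0)"
proof -
  define \<omega> where "\<omega> = root_of_unity N (Suc 0)"
  have nz: "\<omega> \<noteq> 0" by (simp add: \<omega>_def root_of_unity_def)
  define x where "x = \<omega> ^ (m mod N) / \<omega> ^ j"
  have pw: "root_of_unity N k = \<omega> ^ k" for k
    by (simp add: \<omega>_def root_of_unity_def exp_of_nat_mult[symmetric] mult_ac)
  have one: "\<omega> ^ N = 1"
    using N complex_root_unity[of N 1] by (simp add: \<omega>_def root_of_unity_def)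
  have "root_of_unity N k ^ m / root_of_unity N k ^ j = x ^ k" for k
    using root_of_unity_power[OF N, of k m] root_of_unity_power[OF N, of k j] j
    by (simp add: x_def \<omega>_def[symmetric] power_divide power_mult[symmetric] mult.commute)
  then have *: "(\<Sum>k<N. root_of_unity N k ^ m / root_of_unity N k ^ j) = (\<Sum>k<N. x ^ k)" by simp
  show ?thesis
  proof (cases "m mod N = j")
    case True
    then have "x = 1" using nz by (simp add: x_def)
    then show ?thesis using True by (simp add: *)
  next
    case False
    have "x \<noteq> 1"
    proof
      assume "x = 1"
      then have "\<omega> ^ (m mod N) = \<omega> ^ j" using nz by (simp add: x_def)
      then have "root_of_unity N (m mod N) = root_of_unity N j" by (simp add: pw)
      then show False using complex_root_unity_eq[of N "m mod N" j] N False j by (simp add: root_of_unity_def)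
    qed
    moreover have "x ^ N = 1"
    proof -
      have "(\<omega> ^ i) ^ N = 1" for i by (metis one mult.commute power_mult power_one)
      then show ?thesis by (simp add: x_def power_divide del: power_eq_1_iff)
    qed
    ultimately show ?thesis using False by (simp add: * sum_gp_strict)
  qed
qed

text \<open>Interpolation by a polynomial of degree less than N at the N points \<open>a + \<rho> * root_of_unity N k\<close>
  replaces \<open>(w - a) ^ m\<close> by \<open>\<rho> ^ (m - m mod N) * (w - a) ^ (m mod N)\<close>, and the fundamental
  polynomials are bounded by 1.\<close>

lemma interpolation_bound:
  assumes h: "h holomorphic_on ball a R" and R: "2 * \<rho> < R" and \<rho>: "0 < \<rho>"
    and M: "\<And>w. w \<in> cball a (2 * \<rho>) \<Longrightarrow> cmod (h w) \<le> M"
    and w: "w \<in> cball a \<rho>" and N: "N \<noteq> 0"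
  shows "cmod (h w) \<le> 4 * M * (1/2) ^ N + (\<Sum>k<N. cmod (h (a + \<rho> * root_of_unity N k)))"
proof -
  define c where "c m = (deriv ^^ m) h a / fact m" for m
  have c: "cmod (c m) \<le> M / (2 * \<rho>) ^ m" for m
  proof -
    have "cmod ((deriv ^^ m) h a) \<le> fact m * M / (2 * \<rho>) ^ m"
    proof (rule Cauchy_inequality)
      show "h holomorphic_on ball a (2 * \<rho>)" using R by (intro holomorphic_on_subset[OF h]) auto
      show "continuous_on (cball a (2 * \<rho>)) h"
        using R by (intro continuous_on_subset[OF holomorphic_on_imp_continuous_on[OF h]]) auto
      show "cmod (h x) \<le> M" if "cmod (a - x) = 2 * \<rho>" for x using M[of x] that by (simp add: dist_norm)
    qed (use \<rho> in auto)
    then show ?thesis by (simp add: c_def norm_divide field_simps)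
  qed
  have M0: "0 \<le> M" using c[of 0] by (simp) (use norm_ge_zero order_trans in blast)
  define v where "v = (w - a) / \<rho>"
  have v: "cmod v \<le> 1" using w \<rho> by (simp add: v_def norm_divide dist_norm norm_minus_commute)
  have wv: "w = a + \<rho> * v" using \<rho> by (simp add: v_def)
  have ser: "(\<lambda>m. c m * (\<rho> * u) ^ m) sums h (a + \<rho> * u)" if "cmod u \<le> 1" for u :: complex
  proof -
    have "cmod (\<rho> * u) \<le> \<rho> * 1" unfolding norm_mult using \<rho> that by (intro mult_mono) auto
    then have "a + \<rho> * u \<in> ball a R" using R \<rho> by (simp add: dist_norm)
    from holomorphic_power_series[OF h this] show ?thesis by (simp add: c_def)
  qed
  \<comment> \<open>The value at v of the fundamental polynomial belonging to the k-th root of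
    unity, written as a mean of N powers of modulus at most 1.\<close>
  define l where "l k = (\<Sum>j<N. (v / root_of_unity N k) ^ j) / of_nat N" for k
  have l1: "cmod (l k) \<le> 1" for k
  proof -
    have "cmod (\<Sum>j<N. (v / root_of_unity N k) ^ j) \<le> (\<Sum>j<N. 1)"
      by (rule sum_norm_le) (simp add: norm_power norm_divide power_le_one v)
    then show ?thesis using N by (simp add: l_def norm_divide field_simps)
  qed
  have lsum: "(\<Sum>k<N. l k * root_of_unity N k ^ m) = v ^ (m mod N)" for m
  proof -
    have "(\<Sum>k<N. l k * root_of_unity N k ^ m)
        = (\<Sum>k<N. \<Sum>j<N. v ^ j * (root_of_unity N k ^ m / root_of_unity N k ^ j)) / of_nat N"
    proof -
      have "l k * root_of_unity N k ^ m = (\<Sum>j<N. v ^ j * (root_of_unity N k ^ m / root_of_unity N k ^ j)) / of_nat N" for k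
        unfolding l_def times_divide_eq_left sum_distrib_right by (simp add: power_divide)
      then show ?thesis by (simp add: sum_divide_distrib[of _ "{..<N}"])
    qed
    also have "(\<Sum>k<N. \<Sum>j<N. v ^ j * (root_of_unity N k ^ m / root_of_unity N k ^ j))
        = (\<Sum>j<N. v ^ j * (\<Sum>k<N. root_of_unity N k ^ m / root_of_unity N k ^ j))"
      by (subst sum.swap) (simp add: sum_distrib_left)
    also have "\<dots> = (\<Sum>j<N. if m mod N = j then v ^ j * of_nat N else 0)"
      using N by (intro sum.cong) (auto simp: sum_roots_of_unity)
    also have "\<dots> = v ^ (m mod N) * of_nat N" using N by (subst sum.delta') auto
    finally show ?thesis using N by simp
  qed
  have "(\<lambda>m. \<Sum>k<N. l k * (c m * (\<rho> * root_of_unity N k) ^ m)) sums (\<Sum>k<N. l k * h (a + \<rho> * root_of_unity N k))"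
    by (intro sums_sum sums_mult ser) simp
  moreover have "(\<Sum>k<N. l k * (c m * (\<rho> * root_of_unity N k) ^ m)) = c m * \<rho> ^ m * v ^ (m mod N)" for m
    unfolding lsum[symmetric] by (simp add: sum_distrib_left power_mult_distrib mult_ac)
  ultimately have "(\<lambda>m. c m * \<rho> ^ m * v ^ (m mod N)) sums (\<Sum>k<N. l k * h (a + \<rho> * root_of_unity N k))" by simp
  with ser[OF v] have diff: "(\<lambda>m. c m * (\<rho> * v) ^ m - c m * \<rho> ^ m * v ^ (m mod N)) sums
      (h w - (\<Sum>k<N. l k * h (a + \<rho> * root_of_unity N k)))"
    unfolding wv by (intro sums_diff)
  \<comment> \<open>Below N the two powers agree and the term is 0. From N on, Cauchy's estimate on
    radius 2 \<rho> against evaluation on radius \<rho> leaves (1/2)^m, and the geometric tail adds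
    up to 4 M (1/2)^N.\<close>
  have bnd: "cmod (c m * (\<rho> * v) ^ m - c m * \<rho> ^ m * v ^ (m mod N)) \<le> (if m < N then 0 else 2 * M * (1/2) ^ m)" for m
  proof (cases "m < N")
    case False
    have "cmod (c m * (\<rho> * v) ^ m - c m * \<rho> ^ m * v ^ (m mod N)) = cmod (c m) * \<rho> ^ m * cmod (v ^ m - v ^ (m mod N))"
    proof -
      have "c m * (\<rho> * v) ^ m - c m * \<rho> ^ m * v ^ (m mod N) = c m * complex_of_real \<rho> ^ m * (v ^ m - v ^ (m mod N))"
        by (simp add: power_mult_distrib algebra_simps)
      then show ?thesis using \<rho> by (simp add: norm_mult norm_power)
    qed
    also have "\<dots> \<le> (M / (2 * \<rho>) ^ m * \<rho> ^ m) * 2"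
    proof (intro mult_mono c)
      have "cmod (v ^ m - v ^ (m mod N)) \<le> cmod (v ^ m) + cmod (v ^ (m mod N))" by (rule norm_triangle_ineq4)
      also have "\<dots> \<le> 1 + 1" unfolding norm_power by (intro add_mono power_le_one v) auto
      finally show "cmod (v ^ m - v ^ (m mod N)) \<le> 2" by simp
    qed (use \<rho> M0 in auto)
    also have "\<dots> = 2 * M * (1/2) ^ m" using \<rho> by (simp add: power_mult_distrib power_one_over field_simps)
    finally show ?thesis using False by simp
  qed (simp add: power_mult_distrib)
  have geo: "(\<lambda>m. if m < N then 0 else 2 * M * (1/2) ^ m) sums (4 * M * (1/2) ^ N)"
  proof -
    have "(\<lambda>m. 2 * M * (1/2) ^ N * (1/2) ^ m) sums (2 * M * (1/2) ^ N * (1 / (1 - 1/2)))"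
      by (intro sums_mult geometric_sums) simp
    then have "(\<lambda>m. (if m + N < N then 0 else 2 * M * (1/2) ^ (m + N))) sums (4 * M * (1/2) ^ N)"
      by (simp add: power_add mult_ac)
    then show ?thesis by (subst (asm) sums_iff_shift) simp
  qed
  have "cmod (h w - (\<Sum>k<N. l k * h (a + \<rho> * root_of_unity N k))) \<le> 4 * M * (1/2) ^ N"
    unfolding sums_unique[OF diff] sums_unique[OF geo]
    by (rule norm_suminf_le) (use bnd geo in \<open>auto simp: sums_iff\<close>)
  moreover have "cmod (\<Sum>k<N. l k * h (a + \<rho> * root_of_unity N k)) \<le> (\<Sum>k<N. cmod (h (a + \<rho> * root_of_unity N k)))"
    by (intro sum_norm_le) (simp add: norm_mult mult_left_le_one_le l1)
  ultimately show ?thesis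
    using norm_triangle_ineq[of "h w - (\<Sum>k<N. l k * h (a + \<rho> * root_of_unity N k))"
        "\<Sum>k<N. l k * h (a + \<rho> * root_of_unity N k)"] by simp
qed

section \<open>Integrability of negative powers in the plane\<close>

lemma nn_integral_pow_ext_interval:
  assumes p: "0 < p" "p < 1"
  shows "(\<integral>\<^sup>+x. indicator {-1..1} x * pow_ext \<bar>x\<bar> (- p) \<partial>lborel) < \<infinity>"
proof -
  have "((\<lambda>x. x powr (- p)) has_integral (1 powr (- p + 1) / (- p + 1))) {0..1::real}"
    using p by (intro has_integral_powr_from_0) auto
  from nn_integral_has_integral_lebesgue[OF _ this]
  have I: "(\<integral>\<^sup>+x. ennreal (indicator {0..1} x * x powr (- p)) \<partial>lborel) < \<infinity>" by simp
  have refl: "(\<integral>\<^sup>+x. ennreal (indicator {0..1} (- x) * (- x) powr (- p)) \<partial>lborel)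
      = (\<integral>\<^sup>+x. ennreal (indicator {0..1} x * x powr (- p)) \<partial>lborel)"
  proof -
    have "(\<integral>\<^sup>+x. ennreal (indicator {0..1} x * x powr (- p)) \<partial>lborel)
      = (\<integral>\<^sup>+x. ennreal (indicator {0..1} x * x powr (- p)) \<partial>distr lborel borel uminus)"
      by (simp add: lborel_distr_uminus)
    also have "\<dots> = (\<integral>\<^sup>+x. ennreal (indicator {0..1} (- x) * (- x) powr (- p)) \<partial>lborel)"
      by (subst nn_integral_distr) auto
    finally show ?thesis by simp
  qed
  have "AE x in lborel. indicator {-1..1} x * pow_ext \<bar>x\<bar> (- p)
     \<le> ennreal (indicator {0..1} x * x powr (- p)) + ennreal (indicator {0..1} (- x) * (- x) powr (- p))"
    using AE_lborel_singleton[of 0] by eventually_elim (auto simp: pow_ext_def indicator_def)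
  then have "(\<integral>\<^sup>+x. indicator {-1..1} x * pow_ext \<bar>x\<bar> (- p) \<partial>lborel)
     \<le> (\<integral>\<^sup>+x. ennreal (indicator {0..1} x * x powr (- p)) + ennreal (indicator {0..1} (- x) * (- x) powr (- p)) \<partial>lborel)"
    by (rule nn_integral_mono_AE)
  also have "\<dots> = (\<integral>\<^sup>+x. ennreal (indicator {0..1} x * x powr (- p)) \<partial>lborel) +
      (\<integral>\<^sup>+x. ennreal (indicator {0..1} (- x) * (- x) powr (- p)) \<partial>lborel)"
    by (rule nn_integral_add) auto
  also have "\<dots> < \<infinity>" using I refl by (simp add: less_top[symmetric])
  finally show ?thesis .
qed

lemma measurable_pow_ext [measurable (raw)]:
  "f \<in> borel_measurable M \<Longrightarrow> (\<lambda>x. pow_ext (f x) a) \<in> borel_measurable M"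
proof -
  assume f: "f \<in> borel_measurable M"
  have "(\<lambda>t. pow_ext t a) \<in> borel_measurable borel" unfolding pow_ext_def by measurable
  from measurable_compose[OF f this] show ?thesis .
qed

lemma pow_ext_mono_neg: "0 \<le> a \<Longrightarrow> 0 \<le> s \<Longrightarrow> s \<le> t \<Longrightarrow> pow_ext t (- a) \<le> pow_ext s (- a)"
  by (cases "a = 0") (auto simp: pow_ext_def intro!: ennreal_leI powr_mono2')

lemma pow_ext_mult: "0 < c \<Longrightarrow> 0 \<le> t \<Longrightarrow> pow_ext (c * t) a = ennreal (c powr a) * pow_ext t a"
  by (auto simp: pow_ext_def powr_mult ennreal_mult' ennreal_mult_top)

text \<open>With w = x + i y one has |x| |y| <= |w|^2, so |w|^(-2p) is dominated by the product of
  |x|^(-p) and |y|^(-p), each integrable near 0. Uniformity in b follows by splitting: where |w + b|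
  < 1 the integral is at most that of the translated singularity, elsewhere the integrand is at most
  1.\<close>

lemma nn_integral_pow_ext_disc:
  assumes p: "0 < p" "p < 1"
  shows "\<exists>C<\<infinity>. \<forall>b. (\<integral>\<^sup>+w. indicator (ball (0::complex) R) w * pow_ext (cmod (w + b)) (- 2 * p) \<partial>lborel) \<le> (C::ennreal)"
proof -
  define J where "J = (\<integral>\<^sup>+x. indicator {-1..1::real} x * pow_ext \<bar>x\<bar> (- p) \<partial>lborel)"
  define F where "F w = indicator (ball 0 1) w * pow_ext (cmod w) (- 2 * p)" for w
  have [measurable]: "ball 0 1 \<in> sets (borel :: complex measure)" by simp
  have [measurable]: "F \<in> borel_measurable borel" unfolding F_def by measurable
  have J: "J < \<infinity>" unfolding J_def by (rule nn_integral_pow_ext_interval[OF p])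
  have le: "F (Complex x y) \<le> (indicator {-1..1} x * pow_ext \<bar>x\<bar> (- p)) * (indicator {-1..1} y * pow_ext \<bar>y\<bar> (- p))" for x y
  proof (cases "Complex x y \<in> ball 0 1")
    case True
    have xy: "\<bar>x\<bar> \<le> 1" "\<bar>y\<bar> \<le> 1"
      using True abs_Re_le_cmod[of "Complex x y"] abs_Im_le_cmod[of "Complex x y"] by auto
    have "pow_ext (cmod (Complex x y)) (- 2 * p) \<le> pow_ext \<bar>x\<bar> (- p) * pow_ext \<bar>y\<bar> (- p)"
    proof (cases "x = 0 \<or> y = 0")
      case True
      then have "pow_ext \<bar>x\<bar> (- p) * pow_ext \<bar>y\<bar> (- p) = \<infinity>"
        using p by (auto simp: pow_ext_def ennreal_mult_top ennreal_top_mult)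
      then show ?thesis by simp
    next
      case False
      then have pos: "0 < \<bar>x\<bar> * \<bar>y\<bar>" by simp
      have "2 * (\<bar>x\<bar> * \<bar>y\<bar>) \<le> x\<^sup>2 + y\<^sup>2" using sum_squares_bound[of "\<bar>x\<bar>" "\<bar>y\<bar>"] by simp
      then have "\<bar>x\<bar> * \<bar>y\<bar> \<le> (cmod (Complex x y))\<^sup>2" using pos by (simp add: cmod_power2)
      then have "((cmod (Complex x y))\<^sup>2) powr (- p) \<le> (\<bar>x\<bar> * \<bar>y\<bar>) powr (- p)"
        using p pos by (intro powr_mono2') auto
      moreover have "((cmod (Complex x y))\<^sup>2) powr (- p) = cmod (Complex x y) powr (- 2 * p)"
      proof -
        have "0 < cmod (Complex x y)" using False by (simp add: Complex_eq_0)
        then have "(cmod (Complex x y))\<^sup>2 = cmod (Complex x y) powr 2" by (simp add: powr_numeral)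
        then show ?thesis by (simp only: powr_powr) simp
      qed
      ultimately show ?thesis using False
        by (auto simp: pow_ext_def ennreal_mult'[symmetric] powr_mult[symmetric] Complex_eq_0 intro!: ennreal_leI)
    qed
    moreover have "x \<in> {-1..1}" "y \<in> {-1..1}" using xy by auto
    ultimately show ?thesis using True by (simp add: F_def)
  qed (simp add: F_def)
  have "(\<integral>\<^sup>+w. F w \<partial>lborel) = (\<integral>\<^sup>+x. (\<integral>\<^sup>+y. F (Complex x y) \<partial>lborel) \<partial>lborel)"
    by (rule nn_integral_complex) measurable
  also have "\<dots> \<le> (\<integral>\<^sup>+x. (\<integral>\<^sup>+y. (indicator {-1..1} x * pow_ext \<bar>x\<bar> (- p)) * (indicator {-1..1} y * pow_ext \<bar>y\<bar> (- p)) \<partial>lborel) \<partial>lborel)"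
    by (intro nn_integral_mono le)
  also have "\<dots> = J * J"
    by (simp add: nn_integral_cmult nn_integral_multc J_def)
  also have "\<dots> < \<infinity>" using J by (simp add: ennreal_mult_less_top)
  finally have F: "(\<integral>\<^sup>+w. F w \<partial>lborel) < \<infinity>" .
  show ?thesis
  proof (intro exI[of _ "(\<integral>\<^sup>+w. F w \<partial>lborel) + emeasure lborel (ball (0::complex) R)"] conjI allI)
    show "(\<integral>\<^sup>+w. F w \<partial>lborel) + emeasure lborel (ball (0::complex) R) < \<infinity>"
      using F emeasure_lborel_ball_finite[of "0::complex" R] by (simp add: less_top[symmetric])
    fix b
    have "indicator (ball (0::complex) R) w * pow_ext (cmod (w + b)) (- 2 * p) \<le> F (w + b) + indicator (ball (0::complex) R) w" for w
    proof (cases "cmod (w + b) < 1")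
      case False
      then have "pow_ext (cmod (w + b)) (- (2 * p)) \<le> pow_ext 1 (- (2 * p))"
        using p by (intro pow_ext_mono_neg) auto
      then have "indicator (ball (0::complex) R) w * pow_ext (cmod (w + b)) (- 2 * p) \<le> indicator (ball (0::complex) R) w * 1"
        by (intro mult_left_mono) (auto simp: pow_ext_def)
      then show ?thesis by (simp add: add_increasing)
    qed (auto simp: F_def indicator_def)
    then have "(\<integral>\<^sup>+w. indicator (ball (0::complex) R) w * pow_ext (cmod (w + b)) (- 2 * p) \<partial>lborel)
      \<le> (\<integral>\<^sup>+w. F (w + b) + indicator (ball (0::complex) R) w \<partial>lborel)" by (intro nn_integral_mono)
    also have "\<dots> = (\<integral>\<^sup>+w. F (w + b) \<partial>lborel) + (\<integral>\<^sup>+w. indicator (ball (0::complex) R) w \<partial>lborel)"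
      by (subst nn_integral_add) (auto intro: borel_measurable_indicator)
    also have "\<dots> = (\<integral>\<^sup>+w. F w \<partial>lborel) + emeasure lborel (ball (0::complex) R)"
      by (subst nn_integral_translate) auto
    finally show "(\<integral>\<^sup>+w. indicator (ball (0::complex) R) w * pow_ext (cmod (w + b)) (- 2 * p) \<partial>lborel)
      \<le> (\<integral>\<^sup>+w. F w \<partial>lborel) + emeasure lborel (ball (0::complex) R)" .
  qed
qed

section \<open>Several complex variables\<close>

text \<open>The index set is a parameter because induction over the coordinates, and singling out
  one of them for integration, lead to sets that are not initial segments.\<close>

definition polydisc :: "nat set \<Rightarrow> cvec \<Rightarrow> real \<Rightarrow> cvec set" where
  "polydisc I a r = (\<Pi>\<^sub>E i\<in>I. ball (a i) r)"

definition cpolydisc :: "nat set \<Rightarrow> cvec \<Rightarrow> real \<Rightarrow> cvec set" where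
  "cpolydisc I a r = (\<Pi>\<^sub>E i\<in>I. cball (a i) r)"

section \<open>Polydiscs: topology, measurability, mean values and interpolation\<close>

lemma cpolydisc_mono: "r \<le> s \<Longrightarrow> cpolydisc I a r \<subseteq> cpolydisc I a s"
  unfolding cpolydisc_def by (intro PiE_mono) auto

lemma polydisc_subset_cpolydisc: "polydisc I a r \<subseteq> cpolydisc I a r"
  unfolding polydisc_def cpolydisc_def by (intro PiE_mono) auto

lemma cpolydisc_subset_polydisc: "r < s \<Longrightarrow> cpolydisc I a r \<subseteq> polydisc I a s"
  unfolding polydisc_def cpolydisc_def by (intro PiE_mono) auto

lemma cpolydisc_subset_Cn: "cpolydisc {..<n} a r \<subseteq> Cn n"
  unfolding cpolydisc_def Cn_def by (intro PiE_mono) auto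

lemma center_mem_polydisc: "a \<in> Cn n \<Longrightarrow> 0 < r \<Longrightarrow> a \<in> polydisc {..<n} a r"
  by (auto simp: polydisc_def Cn_def PiE_def)

text \<open>Coordinates outside I are constantly \<open>undefined\<close> on the space of the
  product measure. This lets Borel measurability for the product topology on all functions be used
  for the product measure over I.\<close>

lemma id_measurable_PiM:
  "(\<lambda>x. x) \<in> measurable (\<Pi>\<^sub>M i\<in>I. (lborel :: complex measure)) (borel :: (nat \<Rightarrow> complex) measure)"
proof (rule measurable_coordinatewise_then_product)
  fix i
  show "(\<lambda>x. x i) \<in> borel_measurable (\<Pi>\<^sub>M i\<in>I. (lborel :: complex measure))"
  proof (cases "i \<in> I")
    case True
    then have "(\<lambda>x. x i) \<in> measurable (\<Pi>\<^sub>M i\<in>I. (lborel :: complex measure)) lborel"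
      by (rule measurable_component_singleton)
    then show ?thesis by simp
  next
    case False
    then have "x i = undefined" if "x \<in> space (\<Pi>\<^sub>M i\<in>I. (lborel :: complex measure))" for x
      using that by (auto simp: space_PiM PiE_def extensional_def)
    then show ?thesis by (subst measurable_cong[where g = "\<lambda>_. undefined"]) auto
  qed
qed

lemma measurable_PiM_of_borel:
  "F \<in> measurable borel N \<Longrightarrow> F \<in> measurable (\<Pi>\<^sub>M i\<in>I. (lborel :: complex measure)) N"
  for F :: "(nat \<Rightarrow> complex) \<Rightarrow> _"
  using measurable_compose[OF id_measurable_PiM] by blast

lemma closed_PiE_UNIV: "closed (\<Pi>\<^sub>E i\<in>I. (UNIV :: complex set))" for I :: "nat set"
proof -
  have "(\<Pi>\<^sub>E i\<in>I. (UNIV :: complex set)) = (\<Inter>i\<in>-I. {x. x i = undefined})"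
    by (auto simp: PiE_def extensional_def)
  moreover have "closed {x :: nat \<Rightarrow> complex. x i = undefined}" for i
    by (intro closed_Collect_eq continuous_on_product_coordinates continuous_on_const)
  ultimately show ?thesis by auto
qed

lemma openin_PiE_borel:
  fixes D :: "(nat \<Rightarrow> complex) set"
  assumes "openin (top_of_set (\<Pi>\<^sub>E i\<in>I. UNIV)) D"
  shows "D \<in> sets borel"
proof -
  obtain T where "open T" "D = (\<Pi>\<^sub>E i\<in>I. UNIV) \<inter> T" using assms by (auto simp: openin_open)
  then show ?thesis using closed_PiE_UNIV[of I] by auto
qed

lemma openin_polydisc:
  assumes I: "finite I"
  shows "openin (top_of_set (\<Pi>\<^sub>E i\<in>I. UNIV)) (polydisc I a r)"
proof -
  have "open (\<Inter>i\<in>I. (\<lambda>x :: cvec. x i) -` ball (a i) r)"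
    by (intro open_INT I ballI open_vimage continuous_on_product_coordinates) auto
  moreover have "polydisc I a r = (\<Pi>\<^sub>E i\<in>I. UNIV) \<inter> (\<Inter>i\<in>I. (\<lambda>x. x i) -` ball (a i) r)"
    by (auto simp: polydisc_def)
  ultimately show ?thesis by (auto simp: openin_open)
qed

lemma open_in_Cn_polydisc: "open_in_Cn n (polydisc {..<n} a r)"
  using openin_polydisc[of "{..<n}"] by (simp add: open_in_Cn_def Cn_def)

lemma open_in_Cn_borel: "open_in_Cn n D \<Longrightarrow> D \<in> sets borel"
  unfolding open_in_Cn_def Cn_def by (rule openin_PiE_borel)

lemma borel_sets_Leb: "D \<in> sets borel \<Longrightarrow> D \<subseteq> Cn n \<Longrightarrow> D \<in> sets (Leb n)"
proof -
  assume D: "D \<in> sets borel" "D \<subseteq> Cn n"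
  have "(\<lambda>x. x) -` D \<inter> space (Leb n) \<in> sets (Leb n)" by (rule measurable_sets[OF id_measurable_PiM D(1)])
  moreover have "(\<lambda>x. x) -` D \<inter> space (Leb n) = D" using D(2) by (auto simp: space_PiM Cn_def)
  ultimately show ?thesis by simp
qed

text \<open>Tychonoff's theorem, with the one-point factor {undefined} in the coordinates from n
  on.\<close>

lemma compact_cpolydisc: "compact (cpolydisc {..<n} a r)"
proof -
  let ?S = "\<lambda>i. if i < n then cball (a i) r else {undefined}"
  have "x \<in> cpolydisc {..<n} a r \<longleftrightarrow> (\<forall>i. x i \<in> ?S i)" for x
  proof -
    have "x \<in> cpolydisc {..<n} a r \<longleftrightarrow> (\<forall>i. i < n \<longrightarrow> x i \<in> cball (a i) r) \<and> (\<forall>i. \<not> i < n \<longrightarrow> x i = undefined)"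
      unfolding cpolydisc_def PiE_iff extensional_def by (simp add: Ball_def del: mem_cball)
    also have "\<dots> \<longleftrightarrow> (\<forall>i. x i \<in> ?S i)" by (metis singleton_iff)
    finally show ?thesis .
  qed
  then have "cpolydisc {..<n} a r = PiE UNIV ?S" by (auto simp: PiE_UNIV_domain simp del: mem_cball)
  moreover have "compactin (product_topology (\<lambda>_. euclidean) UNIV) (PiE UNIV ?S)"
    unfolding compactin_PiE by auto
  ultimately show ?thesis by (simp add: euclidean_product_topology)
qed

lemma open_in_Cn_contains_cpolydisc:
  assumes D: "open_in_Cn n D" and a: "a \<in> D"
  obtains r where "0 < r" "cpolydisc {..<n} a r \<subseteq> D"
proof -
  obtain T where T: "open T" "D = Cn n \<inter> T" using D by (auto simp: open_in_Cn_def openin_open)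
  have "openin (product_topology (\<lambda>_. euclidean) UNIV) T" using T by (simp add: euclidean_product_topology)
  from product_topology_open_contains_basis[OF this, of a] a T obtain X where
    X: "a \<in> PiE UNIV X" "\<And>i. open (X i)" "PiE UNIV X \<subseteq> T" by auto
  have "\<forall>i\<in>{..<n}. eventually (\<lambda>r. cball (a i) r \<subseteq> X i) (at_right 0)"
  proof
    fix i
    have "a i \<in> X i" using X(1) by auto
    then obtain e where e: "0 < e" "cball (a i) e \<subseteq> X i" using X(2) open_contains_cball by blast
    then show "eventually (\<lambda>r. cball (a i) r \<subseteq> X i) (at_right 0)"
      unfolding eventually_at_right_field by (intro exI[of _ e]) (auto simp: subset_iff)
  qed
  then have "eventually (\<lambda>r. \<forall>i\<in>{..<n}. cball (a i) r \<subseteq> X i) (at_right 0)"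
    by (intro eventually_ball_finite) auto
  then obtain b :: real where b: "0 < b" "\<forall>r>0. r < b \<longrightarrow> (\<forall>i\<in>{..<n}. cball (a i) r \<subseteq> X i)"
    unfolding eventually_at_right_field by blast
  define r where "r = b / 2"
  have r: "0 < r" "\<forall>i\<in>{..<n}. cball (a i) r \<subseteq> X i" using b by (auto simp: r_def)
  have "x \<in> D" if x: "x \<in> cpolydisc {..<n} a r" for x
  proof -
    have "x i \<in> X i" for i
    proof (cases "i < n")
      case True
      then show ?thesis using x r(2) by (auto simp: cpolydisc_def)
    next
      case False
      then have "x i = a i" using x a T by (auto simp: cpolydisc_def Cn_def PiE_def extensional_def)
      then show ?thesis using X(1) by auto
    qed
    then have "x \<in> T" using X(3) by auto
    then show ?thesis using T x cpolydisc_subset_Cn by auto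
  qed
  with r show ?thesis using that by blast
qed

text \<open>The coordinates are integrated out one at a time: \<open>area_mean_bound\<close> applies
  to the slices in coordinate i, and the induction hypothesis to the restriction of g to the slice
  through the i-th coordinate of the centre.\<close>

lemma polydisc_mean_bound:
  assumes "finite I" "0 < r" "a \<in> (\<Pi>\<^sub>E i\<in>I. UNIV)"
    and "continuous_on (polydisc I a r) g"
    and "\<forall>z\<in>polydisc I a r. \<forall>i\<in>I. (\<lambda>w. g (z(i := w))) field_differentiable at (z i)"
  shows "ennreal ((pi * r\<^sup>2) ^ card I * (cmod (g a))\<^sup>2)
    \<le> (\<integral>\<^sup>+z. indicator (polydisc I a r) z * ennreal ((cmod (g z))\<^sup>2) \<partial>(\<Pi>\<^sub>M i\<in>I. lborel))"
  using assms
proof (induction I arbitrary: g a rule: finite_induct)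
  case empty
  interpret product_sigma_finite "\<lambda>_. lborel :: complex measure" by standard
  have "a = (\<lambda>_. undefined)" using empty by auto
  then show ?case by (simp add: nn_integral_empty polydisc_def)
next
  case (insert i I)
  interpret product_sigma_finite "\<lambda>_. lborel :: complex measure" by standard
  let ?P = "polydisc (insert i I) a r"
  define v where "v = pi * r\<^sup>2"
  have v: "emeasure lborel (ball c r) = ennreal v" for c :: complex
    using insert.prems(1) by (simp add: emeasure_ball unit_ball_vol_2 v_def)
  have v0: "0 \<le> v" by (simp add: v_def)
  \<comment> \<open>A point of the extensional product over I has to be \<open>undefined\<close> at
    i.\<close>
  define a' where "a' = a(i := undefined)"
  have "polydisc I a' r = polydisc I a r"
    unfolding polydisc_def by (rule PiE_cong) (use insert.hyps in \<open>auto simp: a'_def\<close>)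
  moreover have "a' \<in> (\<Pi>\<^sub>E i\<in>I. UNIV)" "a'(i := a i) = a"
    using insert.prems(2) by (auto simp: a'_def PiE_def extensional_def)
  ultimately have a': "a' \<in> (\<Pi>\<^sub>E i\<in>I. UNIV)" "a'(i := a i) = a" "polydisc I a' r = polydisc I a r"
    by auto
  have mem: "x(i := y) \<in> ?P" if "x \<in> polydisc I a r" "y \<in> ball (a i) r" for x y
    using that insert.hyps by (auto simp: polydisc_def PiE_iff extensional_def)
  define g' where "g' x = g (x(i := a i))" for x
  have cont_upd: "continuous_on S (\<lambda>x. x(i := c))" for S and c :: complex
  proof (rule continuous_on_coordinatewise_then_product)
    fix j show "continuous_on S (\<lambda>x. (x(i := c)) j)"
      using continuous_on_subset[OF continuous_on_product_coordinates[of j], of S] by (cases "j = i") auto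
  qed
  have IH: "ennreal (v ^ card I * (cmod (g' a'))\<^sup>2)
      \<le> (\<integral>\<^sup>+z. indicator (polydisc I a' r) z * ennreal ((cmod (g' z))\<^sup>2) \<partial>(\<Pi>\<^sub>M i\<in>I. lborel))"
    unfolding v_def
  proof (rule insert.IH[OF insert.prems(1) a'(1)])
    show "continuous_on (polydisc I a' r) g'"
      unfolding g'_def a'(3) by (rule continuous_on_compose2[OF insert.prems(3) cont_upd])
        (use mem insert.prems(1) in auto)
    show "\<forall>z\<in>polydisc I a' r. \<forall>j\<in>I. (\<lambda>w. g' (z(j := w))) field_differentiable at (z j)"
    proof (intro ballI)
      fix z j assume zj: "z \<in> polydisc I a' r" "j \<in> I"
      then have "j \<noteq> i" using insert.hyps by auto
      have "z(i := a i) \<in> ?P" using zj mem insert.prems(1) a'(3) by auto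
      then have "(\<lambda>w. g ((z(i := a i))(j := w))) field_differentiable at ((z(i := a i)) j)"
        using insert.prems(4) zj by blast
      with \<open>j \<noteq> i\<close> show "(\<lambda>w. g' (z(j := w))) field_differentiable at (z j)"
        by (simp add: g'_def fun_upd_twist)
    qed
  qed
  let ?F = "\<lambda>z. indicator ?P z * ennreal ((cmod (g z))\<^sup>2)"
  have P: "?P \<in> sets borel" by (rule openin_PiE_borel[OF openin_polydisc]) (use insert in auto)
  have "(\<lambda>z. ennreal ((cmod (indicator ?P z *\<^sub>R g z))\<^sup>2)) \<in> borel_measurable borel"
    by (rule measurable_compose[OF borel_measurable_continuous_on_indicator[OF P insert.prems(3)]]) measurable
  moreover have "(\<lambda>z. ennreal ((cmod (indicator ?P z *\<^sub>R g z))\<^sup>2)) = ?F" by (auto simp: indicator_def)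
  ultimately have F: "?F \<in> borel_measurable borel" by (simp only:)
  have inner: "indicator (polydisc I a' r) x * ennreal ((cmod (g' x))\<^sup>2) * ennreal v
      \<le> (\<integral>\<^sup>+y. ?F (x(i := y)) \<partial>lborel)" for x
  proof (cases "x \<in> polydisc I a r")
    case True
    have "(\<lambda>w. g (x(i := w))) holomorphic_on ball (a i) r"
    proof (rule holomorphic_onI)
      fix w assume w: "w \<in> ball (a i) r"
      have "(\<lambda>u. g ((x(i := w))(i := u))) field_differentiable at ((x(i := w)) i)"
        using insert.prems(4) mem[OF True w] by blast
      then show "(\<lambda>w. g (x(i := w))) field_differentiable at w within ball (a i) r"
        by (simp add: field_differentiable_at_within)
    qed
    from area_mean_bound[OF this]
    have "ennreal ((cmod (g' x))\<^sup>2) * ennreal v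
        \<le> (\<integral>\<^sup>+w. indicator (ball (a i) r) w * ennreal ((cmod (g (x(i := w))))\<^sup>2) \<partial>lborel)"
      by (simp add: v g'_def mult.commute)
    also have "\<dots> \<le> (\<integral>\<^sup>+y. ?F (x(i := y)) \<partial>lborel)"
      by (intro nn_integral_mono) (use mem[OF True] in \<open>auto simp: indicator_def\<close>)
    finally show ?thesis using True a'(3) by simp
  qed (use a'(3) in auto)
  have m: "(\<lambda>x. indicator (polydisc I a' r) x * ennreal ((cmod (g' x))\<^sup>2)) \<in> borel_measurable (\<Pi>\<^sub>M i\<in>I. lborel)"
  proof -
    have P': "polydisc I a r \<in> sets borel" by (rule openin_PiE_borel[OF openin_polydisc]) (use insert in auto)
    have "continuous_on (polydisc I a r) g'"
      unfolding g'_def by (rule continuous_on_compose2[OF insert.prems(3) cont_upd])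
        (use mem insert.prems(1) in auto)
    from borel_measurable_continuous_on_indicator[OF P' this]
    have "(\<lambda>z. ennreal ((cmod (indicator (polydisc I a r) z *\<^sub>R g' z))\<^sup>2)) \<in> borel_measurable borel"
      by (rule measurable_compose) measurable
    moreover have "(\<lambda>z. ennreal ((cmod (indicator (polydisc I a r) z *\<^sub>R g' z))\<^sup>2))
        = (\<lambda>x. indicator (polydisc I a' r) x * ennreal ((cmod (g' x))\<^sup>2))"
      unfolding a'(3) by (auto simp: indicator_def)
    ultimately show ?thesis by (intro measurable_PiM_of_borel) (simp only:)
  qed
  have "ennreal (v ^ card (insert i I) * (cmod (g a))\<^sup>2) = ennreal (v ^ card I * (cmod (g' a'))\<^sup>2) * ennreal v"
    using insert.hyps v0 a'(2) by (simp add: g'_def ennreal_mult'[symmetric] mult_ac)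
  also have "\<dots> \<le> (\<integral>\<^sup>+z. indicator (polydisc I a' r) z * ennreal ((cmod (g' z))\<^sup>2) \<partial>(\<Pi>\<^sub>M i\<in>I. lborel)) * ennreal v"
    by (intro mult_right_mono IH) auto
  also have "\<dots> = (\<integral>\<^sup>+z. indicator (polydisc I a' r) z * ennreal ((cmod (g' z))\<^sup>2) * ennreal v \<partial>(\<Pi>\<^sub>M i\<in>I. lborel))"
    by (rule nn_integral_multc[symmetric]) (rule m)
  also have "\<dots> \<le> (\<integral>\<^sup>+x. (\<integral>\<^sup>+y. ?F (x(i := y)) \<partial>lborel) \<partial>(\<Pi>\<^sub>M i\<in>I. lborel))"
    by (intro nn_integral_mono inner)
  also have "\<dots> = (\<integral>\<^sup>+z. ?F z \<partial>(\<Pi>\<^sub>M i\<in>insert i I. lborel))"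
    by (rule product_nn_integral_insert[symmetric]) (use insert.hyps measurable_PiM_of_borel[OF F] in auto)
  finally show ?case by (simp add: v_def)
qed

lemma holomorphic_Cn_slice:
  assumes g: "holomorphic_Cn n (polydisc {..<n} a R) g" and j: "j < n"
    and z: "\<And>i. i < n \<Longrightarrow> i \<noteq> j \<Longrightarrow> z i \<in> ball (a i) R" "z \<in> Cn n"
  shows "(\<lambda>w. g (z(j := w))) holomorphic_on ball (a j) R"
proof (rule holomorphic_onI)
  fix w assume w: "w \<in> ball (a j) R"
  have "z(j := w) \<in> polydisc {..<n} a R"
    using w z j by (auto simp: polydisc_def Cn_def PiE_iff extensional_def)
  then have "(\<lambda>u. g ((z(j := w))(j := u))) field_differentiable at ((z(j := w)) j)"
    using g j unfolding holomorphic_Cn_def by blast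
  then show "(\<lambda>w. g (z(j := w))) field_differentiable at w within ball (a j) R"
    by (simp add: field_differentiable_at_within)
qed

text \<open>A finite subset of the distinguished boundary of the polydisc of radius \<rho>.\<close>

definition grid :: "nat \<Rightarrow> cvec \<Rightarrow> real \<Rightarrow> nat \<Rightarrow> cvec set" where
  "grid n a \<rho> N = (\<Pi>\<^sub>E i\<in>{..<n}. (\<lambda>k. a i + \<rho> * root_of_unity N k) ` {..<N})"

lemma finite_grid: "finite (grid n a \<rho> N)"
  unfolding grid_def by (intro finite_PiE) auto

lemma card_grid: "card (grid n a \<rho> N) \<le> N ^ n"
proof -
  have "card (grid n a \<rho> N) = (\<Prod>i<n. card ((\<lambda>k. a i + \<rho> * root_of_unity N k) ` {..<N}))"
    unfolding grid_def by (simp add: card_PiE)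
  also have "\<dots> \<le> (\<Prod>i<n. N)" by (intro prod_mono) (use card_image_le[of "{..<N}"] in auto)
  finally show ?thesis by simp
qed

lemma grid_subset: "0 \<le> \<rho> \<Longrightarrow> grid n a \<rho> N \<subseteq> cpolydisc {..<n} a \<rho>"
  unfolding grid_def cpolydisc_def by (intro PiE_mono) (auto simp: dist_norm norm_mult)

text \<open>The coordinates are released from the grid one at a time. Interpolation in the next
  coordinate bounds g by 4 M (1/2)^N plus N values at points with one free coordinate less, so the
  bounds satisfy B (j + 1) = 4 M (1/2)^N + N * B j with B 0 = 0. This is a geometric sum, estimated
  crudely by n * N^n.\<close>

lemma vanishing_on_grid_bound:
  assumes g: "holomorphic_Cn n (polydisc {..<n} a R) g" and R: "2 * \<rho> < R" and \<rho>: "0 < \<rho>"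
    and M: "\<And>z. z \<in> cpolydisc {..<n} a (2 * \<rho>) \<Longrightarrow> cmod (g z) \<le> M"
    and N: "N \<noteq> 0" and vanish: "\<And>z. z \<in> grid n a \<rho> N \<Longrightarrow> g z = 0"
    and z: "z \<in> cpolydisc {..<n} a \<rho>"
  shows "cmod (g z) \<le> 4 * n * M * real N ^ n * (1/2) ^ N"
proof -
  let ?G = "\<lambda>i. (\<lambda>k. a i + \<rho> * root_of_unity N k) ` {..<N}"
  have Gsub: "u \<in> cball (a i) \<rho>" if "u \<in> ?G i" for u i using that \<rho> by (auto simp: dist_norm norm_mult)
  have M0: "0 \<le> M"
  proof (rule order_trans[OF norm_ge_zero M])
    show "z \<in> cpolydisc {..<n} a (2 * \<rho>)" using cpolydisc_mono[of \<rho> "2 * \<rho>" "{..<n}" a] z \<rho> by auto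
  qed
  have "cmod (g z) \<le> 4 * M * (1/2) ^ N * (\<Sum>i<j. real N ^ i)"
    if "j \<le> n" "z \<in> Cn n" "\<And>i. i < j \<Longrightarrow> z i \<in> cball (a i) \<rho>" "\<And>i. j \<le> i \<Longrightarrow> i < n \<Longrightarrow> z i \<in> ?G i" for j z
    using that
  proof (induction j arbitrary: z)
    case 0
    then have "z \<in> grid n a \<rho> N" by (auto simp: grid_def Cn_def PiE_iff)
    then show ?case using vanish by simp
  next
    case (Suc j)
    have j: "j < n" using Suc.prems by simp
    have zc: "z i \<in> cball (a i) \<rho>" if "i < n" for i
      using Suc.prems(3)[of i] Suc.prems(4)[of i] Gsub that by (cases "i < Suc j") auto
    have cb: "cball (a i) \<rho> \<subseteq> ball (a i) R" for i using R \<rho> by auto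
    have hol: "(\<lambda>w. g (z(j := w))) holomorphic_on ball (a j) R"
      by (rule holomorphic_Cn_slice[OF g j _ Suc.prems(2)]) (use zc cb in blast)
    have upd: "z(j := w) \<in> cpolydisc {..<n} a (2 * \<rho>)" if "w \<in> cball (a j) (2 * \<rho>)" for w
    proof -
      have "z i \<in> cball (a i) (2 * \<rho>)" if "i < n" for i using zc[OF that] \<rho> by auto
      then show ?thesis using that Suc.prems(2) j by (auto simp: cpolydisc_def Cn_def PiE_iff extensional_def)
    qed
    have "cmod (g (z(j := z j))) \<le> 4 * M * (1/2) ^ N + (\<Sum>k<N. cmod (g (z(j := a j + \<rho> * root_of_unity N k))))"
      by (rule interpolation_bound[OF hol R \<rho> M[OF upd] zc[OF j] N])
    also have "(\<Sum>k<N. cmod (g (z(j := a j + \<rho> * root_of_unity N k)))) \<le> (\<Sum>k<N. 4 * M * (1/2) ^ N * (\<Sum>i<j. real N ^ i))"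
    proof (intro sum_mono Suc.IH)
      fix k assume k: "k \<in> {..<N}"
      let ?z = "z(j := a j + \<rho> * root_of_unity N k)"
      show "j \<le> n" using j by simp
      show "?z \<in> Cn n" using Suc.prems(2) j by (auto simp: Cn_def PiE_iff extensional_def)
      show "?z i \<in> cball (a i) \<rho>" if "i < j" for i using Suc.prems(3) that by auto
      show "?z i \<in> ?G i" if "j \<le> i" "i < n" for i
        using Suc.prems(4)[of i] that k by (cases "i = j") auto
    qed
    also have "4 * M * (1/2) ^ N + (\<Sum>k<N. 4 * M * (1/2) ^ N * (\<Sum>i<j. real N ^ i))
        = 4 * M * (1/2) ^ N * (\<Sum>i<Suc j. real N ^ i)"
    proof -
      have "(\<Sum>i<Suc j. real N ^ i) = 1 + real N * (\<Sum>i<j. real N ^ i)"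
        by (simp add: sum.lessThan_Suc_shift sum_distrib_left del: sum.lessThan_Suc)
      then show ?thesis by (simp add: algebra_simps del: sum.lessThan_Suc)
    qed
    finally show ?case by simp
  qed
  from this[of n z] have "cmod (g z) \<le> 4 * M * (1/2) ^ N * (\<Sum>i<n. real N ^ i)"
    using z subsetD[OF cpolydisc_subset_Cn z] by (auto simp: cpolydisc_def PiE_iff)
  also have "\<dots> \<le> 4 * M * (1/2) ^ N * (\<Sum>i<n. real N ^ n)"
    using M0 N by (intro mult_left_mono sum_mono power_increasing) auto
  finally show ?thesis by (simp add: mult_ac)
qed

section \<open>Charts, holomorphic functions and smooth volumes\<close>

lemma holomorphic_Cn_subset: "holomorphic_Cn n D f \<Longrightarrow> D' \<subseteq> D \<Longrightarrow> holomorphic_Cn n D' f"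
  unfolding holomorphic_Cn_def using continuous_on_subset by blast

lemma open_in_Cn_subset: "open_in_Cn n D \<Longrightarrow> D \<subseteq> Cn n"
  by (auto simp: open_in_Cn_def openin_open)

lemma open_in_Cn_slice:
  assumes D: "open_in_Cn n D" and z: "z \<in> D"
  obtains r where "0 < r" "\<forall>i<n. \<forall>w\<in>cball (z i) r. z(i := w) \<in> D"
proof -
  obtain r where r: "0 < r" "cpolydisc {..<n} z r \<subseteq> D" using open_in_Cn_contains_cpolydisc[OF D z] .
  have "z \<in> Cn n" using D z by (auto simp: open_in_Cn_def openin_open)
  then have "z(i := w) \<in> cpolydisc {..<n} z r" if "i < n" "w \<in> cball (z i) r" for i w
    using that r(1) by (auto simp: cpolydisc_def Cn_def PiE_iff extensional_def)
  with r show ?thesis using that by blast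
qed

lemma polydisc_dist: "z \<in> polydisc I a r \<Longrightarrow> i \<in> I \<Longrightarrow> dist (a i) (z i) < r"
  by (auto simp: polydisc_def)

lemma at_within_open_in_Cn:
  assumes "open_in_Cn n U" "z \<in> U" "U \<subseteq> D" "D \<subseteq> Cn n"
  shows "at z within D = at z within U"
proof -
  obtain T where T: "open T" "U = Cn n \<inter> T" using assms(1) by (auto simp: open_in_Cn_def openin_open)
  show ?thesis by (rule at_within_nhd[OF _ T(1)]) (use T assms in auto)
qed

lemma holomorphic_Cn_cong:
  assumes f: "holomorphic_Cn n D f" and D: "open_in_Cn n D" and eq: "\<And>z. z \<in> D \<Longrightarrow> f z = g z"
  shows "holomorphic_Cn n D g"
  unfolding holomorphic_Cn_def
proof (intro conjI ballI allI impI)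
  show "continuous_on D g" using f eq unfolding holomorphic_Cn_def by (metis continuous_on_cong)
  fix z i assume z: "z \<in> D" and i: "i < n"
  obtain r where r: "0 < r" "\<forall>i<n. \<forall>w\<in>cball (z i) r. z(i := w) \<in> D"
    using open_in_Cn_slice[OF D z] .
  have "(\<lambda>w. f (z(i := w))) field_differentiable at (z i)" using f z i by (auto simp: holomorphic_Cn_def)
  then show "(\<lambda>w. g (z(i := w))) field_differentiable at (z i)"
    by (rule field_differentiable_transform_within[OF r(1) UNIV_I, rotated])
      (use r(2) i eq in \<open>auto simp: dist_commute\<close>)
qed

lemma holomorphic_Cn_slice_open:
  assumes "holomorphic_Cn n D f" "i < n" "\<And>w. w \<in> S \<Longrightarrow> z(i := w) \<in> D"
  shows "(\<lambda>w. f (z(i := w))) holomorphic_on S"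
proof (rule holomorphic_onI)
  fix w assume "w \<in> S"
  then have "(\<lambda>u. f ((z(i := w))(i := u))) field_differentiable at ((z(i := w)) i)"
    using assms unfolding holomorphic_Cn_def by blast
  then show "(\<lambda>w. f (z(i := w))) field_differentiable at w within S"
    by (simp add: field_differentiable_at_within)
qed

text \<open>Holomorphy means continuity and separate holomorphy, so the uniform limit theorem and
  the one-variable theorem of Weierstrass on each slice suffice.\<close>

lemma holomorphic_Cn_locally_uniform_limit:
  fixes f :: "nat \<Rightarrow> cvec \<Rightarrow> complex"
  assumes f: "\<And>k. holomorphic_Cn n D (f k)" and D: "open_in_Cn n D"
    and lim: "\<And>z. z \<in> D \<Longrightarrow> \<exists>U. open_in_Cn n U \<and> z \<in> U \<and> U \<subseteq> D \<and> uniform_limit U f g sequentially"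
  shows "holomorphic_Cn n D g"
  unfolding holomorphic_Cn_def
proof (intro conjI ballI allI impI)
  show "continuous_on D g"
    unfolding continuous_on_eq_continuous_within
  proof
    fix z assume z: "z \<in> D"
    obtain U where U: "open_in_Cn n U" "z \<in> U" "U \<subseteq> D" "uniform_limit U f g sequentially"
      using lim[OF z] by blast
    have "continuous_on U g"
      by (rule uniform_limit_theorem[OF _ U(4)])
        (use holomorphic_Cn_subset[OF f U(3)] in \<open>auto simp: holomorphic_Cn_def\<close>)
    then show "continuous (at z within D) g"
      using U(2) at_within_open_in_Cn[OF U(1-3) open_in_Cn_subset[OF D]]
      by (auto simp: continuous_on_eq_continuous_within)
  qed
  fix z i assume z: "z \<in> D" and i: "i < n"
  obtain U where U: "open_in_Cn n U" "z \<in> U" "U \<subseteq> D" "uniform_limit U f g sequentially"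
    using lim[OF z] by blast
  obtain r where r: "0 < r" "\<forall>i<n. \<forall>w\<in>cball (z i) r. z(i := w) \<in> U"
    using open_in_Cn_slice[OF U(1,2)] .
  have ul: "uniform_limit (cball (z i) r) (\<lambda>k w. f k (z(i := w))) (\<lambda>w. g (z(i := w))) sequentially"
    using uniform_limit_compose'[OF U(4), of "\<lambda>w. z(i := w)" "cball (z i) r"] r(2) i by (auto simp: Pi_def)
  have hc: "\<forall>\<^sub>F k in sequentially. continuous_on (cball (z i) r) (\<lambda>w. f k (z(i := w))) \<and>
      (\<lambda>w. f k (z(i := w))) holomorphic_on ball (z i) r"
  proof (intro always_eventually allI)
    fix k
    have "(\<lambda>w. f k (z(i := w))) holomorphic_on cball (z i) r"
      using r(2) i U(3) by (intro holomorphic_Cn_slice_open[OF f i]) auto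
    then show "continuous_on (cball (z i) r) (\<lambda>w. f k (z(i := w))) \<and> (\<lambda>w. f k (z(i := w))) holomorphic_on ball (z i) r"
      by (meson ball_subset_cball holomorphic_on_imp_continuous_on holomorphic_on_subset)
  qed
  have "(\<lambda>w. g (z(i := w))) holomorphic_on ball (z i) r"
    by (rule holomorphic_uniform_limit[OF hc ul trivial_limit_sequentially])
  then show "(\<lambda>w. g (z(i := w))) field_differentiable at (z i)"
    using r(1) by (simp add: holomorphic_on_imp_differentiable_at)
qed

text \<open>One volume form is fixed as reference measure for all integrals; any other one is
  locally comparable to it and is brought in by \<open>section_ideal_volume_subset\<close>.\<close>

locale volume_manifold =
  fixes n :: nat and A :: "('a::{t2_space, second_countable_topology}) chart set" and dV :: "'a measure"
  assumes manifold: "complex_manifold n A" and volume: "smooth_volume n A dV"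
begin

lemma sets_dV [measurable_cong, simp]: "sets dV = sets borel"
  using volume by (simp add: smooth_volume_def)

lemma chart_at: obtains V \<kappa> where "(V, \<kappa>) \<in> A" "x \<in> V"
proof -
  have "x \<in> (\<Union>(V, \<kappa>)\<in>A. V)" using manifold by (simp add: complex_manifold_def)
  then show ?thesis using that by blast
qed

lemma
  assumes "(V, \<kappa>) \<in> A"
  shows chart_open: "open V" and chart_image_open: "open_in_Cn n (\<kappa> ` V)"
    and chart_continuous: "continuous_on V \<kappa>"
    and chart_inv_continuous: "continuous_on (\<kappa> ` V) (inv_into V \<kappa>)"
    and chart_inv: "y \<in> V \<Longrightarrow> inv_into V \<kappa> (\<kappa> y) = y"
    and chart_inv_mem: "z \<in> \<kappa> ` V \<Longrightarrow> inv_into V \<kappa> z \<in> V"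
    and inv_chart: "z \<in> \<kappa> ` V \<Longrightarrow> \<kappa> (inv_into V \<kappa> z) = z"
  using manifold assms by (auto simp: complex_manifold_def is_chart_def homeomorphism_def intro: f_inv_into_f inv_into_into)

lemma chart_image_open_subset:
  assumes c: "(V, \<kappa>) \<in> A" and U: "open U" "U \<subseteq> V"
  shows "open_in_Cn n (\<kappa> ` U)"
proof -
  have "\<kappa> ` U = \<kappa> ` V \<inter> inv_into V \<kappa> -` U"
    using U(2) chart_inv[OF c] by (auto simp: image_iff)
  moreover have "openin (top_of_set (\<kappa> ` V)) (\<kappa> ` V \<inter> inv_into V \<kappa> -` U)"
    by (rule continuous_openin_preimage_gen[OF chart_inv_continuous[OF c] U(1)])
  ultimately show ?thesis using chart_image_open[OF c] unfolding open_in_Cn_def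
    using openin_trans by fastforce
qed

lemma chart_preimage_open:
  assumes c: "(V, \<kappa>) \<in> A" and D: "open_in_Cn n D"
  shows "open (V \<inter> \<kappa> -` D)"
proof -
  obtain T where T: "open T" "D = Cn n \<inter> T" using D by (auto simp: open_in_Cn_def openin_open)
  have "V \<inter> \<kappa> -` D = V \<inter> \<kappa> -` T" using T open_in_Cn_subset[OF chart_image_open[OF c]] by auto
  then show ?thesis using continuous_open_preimage[OF chart_continuous[OF c] chart_open[OF c] T(1)] by simp
qed

lemma chart_mem_image_iff:
  assumes "(V, \<kappa>) \<in> A" "B \<subseteq> V" "y \<in> V"
  shows "\<kappa> y \<in> \<kappa> ` B \<longleftrightarrow> y \<in> B"
  using chart_inv[OF assms(1)] assms by (metis (no_types, lifting) image_iff subsetD)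

lemma holomorphic_fun_subset: "holomorphic_fun n A U f \<Longrightarrow> U' \<subseteq> U \<Longrightarrow> holomorphic_fun n A U' f"
  unfolding holomorphic_fun_def by (fastforce intro: holomorphic_Cn_subset)

lemma holomorphic_fun_chart:
  assumes "holomorphic_fun n A U f" "(V, \<kappa>) \<in> A" "B \<subseteq> U" "B \<subseteq> V"
  shows "holomorphic_Cn n (\<kappa> ` B) (\<lambda>z. f (inv_into V \<kappa> z))"
proof -
  have "holomorphic_Cn n (\<kappa> ` (U \<inter> V)) (\<lambda>z. f (inv_into V \<kappa> z))"
    using assms(1,2) by (auto simp: holomorphic_fun_def)
  then show ?thesis by (rule holomorphic_Cn_subset) (use assms in auto)
qed

lemma holomorphic_fun_cong:
  assumes f: "holomorphic_fun n A U f" and U: "open U" and eq: "\<And>y. y \<in> U \<Longrightarrow> f y = g y"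
  shows "holomorphic_fun n A U g"
  unfolding holomorphic_fun_def
proof (clarify)
  fix V \<kappa> assume c: "(V, \<kappa>) \<in> A"
  show "holomorphic_Cn n (\<kappa> ` (U \<inter> V)) (\<lambda>z. g (inv_into V \<kappa> z))"
  proof (rule holomorphic_Cn_cong)
    show "holomorphic_Cn n (\<kappa> ` (U \<inter> V)) (\<lambda>z. f (inv_into V \<kappa> z))"
      by (rule holomorphic_fun_chart[OF f c]) auto
    show "open_in_Cn n (\<kappa> ` (U \<inter> V))"
      using U chart_open[OF c] by (intro chart_image_open_subset[OF c]) auto
    show "f (inv_into V \<kappa> z) = g (inv_into V \<kappa> z)" if "z \<in> \<kappa> ` (U \<inter> V)" for z
      using that eq chart_inv[OF c] by auto
  qed
qed

lemma holomorphic_fun_continuous: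
  assumes f: "holomorphic_fun n A U f" and U: "open U"
  shows "continuous_on U f"
proof -
  have "continuous_on (U \<inter> V) f" if c: "(V, \<kappa>) \<in> A" for V \<kappa>
  proof -
    have "continuous_on (\<kappa> ` (U \<inter> V)) (\<lambda>z. f (inv_into V \<kappa> z))"
      using holomorphic_fun_chart[OF f c, of "U \<inter> V"] by (auto simp: holomorphic_Cn_def)
    then have "continuous_on (U \<inter> V) (\<lambda>y. f (inv_into V \<kappa> (\<kappa> y)))"
      by (rule continuous_on_compose2) (use continuous_on_subset[OF chart_continuous[OF c]] in auto)
    moreover have "continuous_on (U \<inter> V) (\<lambda>y. f (inv_into V \<kappa> (\<kappa> y))) = continuous_on (U \<inter> V) f"
      by (rule continuous_on_cong) (use chart_inv[OF c] in auto)
    ultimately show ?thesis by simp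
  qed
  then have "continuous_on (\<Union>((\<lambda>c. U \<inter> fst c) ` A)) f"
    using U chart_open by (intro continuous_on_open_Union) auto
  moreover have "\<Union>((\<lambda>c. U \<inter> fst c) ` A) = U"
  proof (intro equalityI subsetI)
    fix y assume y: "y \<in> U"
    obtain V \<kappa> where "(V, \<kappa>) \<in> A" "y \<in> V" using chart_at .
    with y show "y \<in> \<Union>((\<lambda>c. U \<inter> fst c) ` A)" by force
  qed auto
  ultimately show ?thesis by simp
qed

lemma holomorphic_fun_lin:
  assumes f: "holomorphic_fun n A U f" and g: "holomorphic_fun n A U g"
  shows "holomorphic_fun n A U (\<lambda>y. a * f y + b * g y)"
  using assms unfolding holomorphic_fun_def holomorphic_Cn_def
  by (auto intro!: continuous_intros field_differentiable_add field_differentiable_mult simp: split_beta)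

lemma holomorphic_fun_locally_uniform_limit:
  fixes f :: "nat \<Rightarrow> 'a \<Rightarrow> complex"
  assumes f: "\<And>k. holomorphic_fun n A D (f k)" and D: "open D"
    and lim: "\<And>x. x \<in> D \<Longrightarrow> \<exists>U. open U \<and> x \<in> U \<and> U \<subseteq> D \<and> uniform_limit U f g sequentially"
  shows "holomorphic_fun n A D g"
  unfolding holomorphic_fun_def
proof (clarify)
  fix V \<kappa> assume c: "(V, \<kappa>) \<in> A"
  show "holomorphic_Cn n (\<kappa> ` (D \<inter> V)) (\<lambda>z. g (inv_into V \<kappa> z))"
  proof (rule holomorphic_Cn_locally_uniform_limit[where f = "\<lambda>k z. f k (inv_into V \<kappa> z)"])
    show "holomorphic_Cn n (\<kappa> ` (D \<inter> V)) (\<lambda>z. f k (inv_into V \<kappa> z))" for k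
      by (rule holomorphic_fun_chart[OF f c]) auto
    show "open_in_Cn n (\<kappa> ` (D \<inter> V))"
      using D chart_open[OF c] by (intro chart_image_open_subset[OF c]) auto
    fix z assume z: "z \<in> \<kappa> ` (D \<inter> V)"
    then obtain x where x: "x \<in> D" "x \<in> V" "z = \<kappa> x" by auto
    obtain U where U: "open U" "x \<in> U" "U \<subseteq> D" "uniform_limit U f g sequentially" using lim[OF x(1)] by blast
    have "uniform_limit (\<kappa> ` (U \<inter> V)) (\<lambda>k z. f k (inv_into V \<kappa> z)) (\<lambda>z. g (inv_into V \<kappa> z)) sequentially"
      by (rule uniform_limit_compose'[OF U(4)]) (use chart_inv[OF c] in auto)
    moreover have "open_in_Cn n (\<kappa> ` (U \<inter> V))"
      using U chart_open[OF c] by (intro chart_image_open_subset[OF c]) auto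
    ultimately show "\<exists>U'. open_in_Cn n U' \<and> z \<in> U' \<and> U' \<subseteq> \<kappa> ` (D \<inter> V) \<and>
        uniform_limit U' (\<lambda>k z. f k (inv_into V \<kappa> z)) (\<lambda>z. g (inv_into V \<kappa> z)) sequentially"
      using U x by (intro exI[of _ "\<kappa> ` (U \<inter> V)"]) auto
  qed
qed

section \<open>The volume and Lebesgue measure in charts\<close>

lemma chart_image_sets:
  assumes "(V, \<kappa>) \<in> A"
  shows "\<kappa> ` V \<in> sets borel" "\<kappa> ` V \<subseteq> Cn n" "\<kappa> ` V \<in> sets (Leb n)"
  using chart_image_open[OF assms] open_in_Cn_borel open_in_Cn_subset borel_sets_Leb by auto

lemma chart_inverse_measurable:
  assumes c: "(V, \<kappa>) \<in> A"
  shows "(\<lambda>z. if z \<in> \<kappa> ` V then inv_into V \<kappa> z else undefined) \<in> measurable (Leb n) borel"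
proof (rule measurable_PiM_of_borel)
  have "inv_into V \<kappa> \<in> measurable (restrict_space borel (\<kappa> ` V)) borel"
    using chart_inv_continuous[OF c] by (rule borel_measurable_continuous_on_restrict)
  then show "(\<lambda>z. if z \<in> \<kappa> ` V then inv_into V \<kappa> z else undefined) \<in> measurable borel borel"
    by (subst (asm) measurable_restrict_space_iff[where c = undefined]) (use chart_image_sets[OF c] in auto)
qed

lemma chart_density_measurable:
  fixes \<rho> :: "cvec \<Rightarrow> real"
  assumes c: "(V, \<kappa>) \<in> A" and \<rho>: "continuous_on (\<kappa> ` V) \<rho>"
  shows "(\<lambda>z. ennreal (\<rho> z) * indicator (\<kappa> ` V) z) \<in> borel_measurable (Leb n)"
proof -
  have "(\<lambda>z. ennreal (indicator (\<kappa> ` V) z *\<^sub>R \<rho> z)) \<in> borel_measurable borel"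
    by (rule measurable_compose[OF borel_measurable_continuous_on_indicator[OF chart_image_sets(1)[OF c] \<rho>]]) simp
  moreover have "(\<lambda>z. ennreal (indicator (\<kappa> ` V) z *\<^sub>R \<rho> z)) = (\<lambda>z. ennreal (\<rho> z) * indicator (\<kappa> ` V) z)"
    by (auto simp: indicator_def)
  ultimately show ?thesis by (intro measurable_PiM_of_borel) (simp only:)
qed

lemma chart_pullback_measurable:
  assumes c: "(V, \<kappa>) \<in> A" and F: "(\<lambda>y. F y * indicator B y :: ennreal) \<in> borel_measurable borel" and B: "B \<subseteq> V"
  shows "(\<lambda>z. F (inv_into V \<kappa> z) * indicator (\<kappa> ` B) z) \<in> borel_measurable (Leb n)"
proof -
  define g where "g z = (if z \<in> \<kappa> ` V then inv_into V \<kappa> z else undefined)" for z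
  have g: "g \<in> measurable (Leb n) borel" unfolding g_def by (rule chart_inverse_measurable[OF c])
  have "F (inv_into V \<kappa> z) * indicator (\<kappa> ` B) z = F (g z) * indicator B (g z) * indicator (\<kappa> ` V) z" for z
  proof (cases "z \<in> \<kappa> ` V")
    case True
    then obtain y where y: "y \<in> V" "z = \<kappa> y" by auto
    have "z \<in> \<kappa> ` B \<longleftrightarrow> y \<in> B" unfolding y(2) by (rule chart_mem_image_iff[OF c B y(1)])
    moreover have "g z = y" "inv_into V \<kappa> z = y" using True y chart_inv[OF c] by (simp_all add: g_def)
    ultimately show ?thesis using True by (auto simp: indicator_def)
  qed (use B in \<open>auto simp: indicator_def\<close>)
  moreover have "(\<lambda>z. F (g z) * indicator B (g z) * indicator (\<kappa> ` V) z) \<in> borel_measurable (Leb n)"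
    by (intro borel_measurable_times_ennreal[OF measurable_compose[OF g F]] borel_measurable_indicator chart_image_sets(3)[OF c])
  ultimately show ?thesis by simp
qed

text \<open>A volume form prescribes only the measures of Borel sets inside a chart. These identify
  the restricted volume with the image, under the inverse chart, of a density measure, and equality
  of measures gives the formula for integrals.\<close>

lemma nn_integral_chart:
  assumes c: "(V, \<kappa>) \<in> A"
  obtains \<rho> where "continuous_on (\<kappa> ` V) \<rho>" "\<forall>z\<in>\<kappa> ` V. 0 < \<rho> z"
    "\<forall>F\<in>borel_measurable borel. \<forall>B\<in>sets borel. B \<subseteq> V \<longrightarrow>
      (\<integral>\<^sup>+y\<in>B. F y \<partial>dV) = (\<integral>\<^sup>+z\<in>\<kappa> ` B. F (inv_into V \<kappa> z) * ennreal (\<rho> z) \<partial>Leb n)"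
proof -
  have "\<exists>\<rho>. smooth_Cn n (\<kappa> ` V) \<rho> \<and> (\<forall>z\<in>\<kappa> ` V. 0 < \<rho> z) \<and>
      (\<forall>B\<in>sets borel. B \<subseteq> V \<longrightarrow> emeasure dV B = (\<integral>\<^sup>+z\<in>\<kappa> ` B. ennreal (\<rho> z) \<partial>Leb n))"
    using volume c unfolding smooth_volume_def by (auto dest!: bspec[of A _ "(V, \<kappa>)"])
  then obtain \<rho> where smooth: "smooth_Cn n (\<kappa> ` V) \<rho>" and pos: "\<forall>z\<in>\<kappa> ` V. 0 < \<rho> z"
    and em: "\<forall>B\<in>sets borel. B \<subseteq> V \<longrightarrow> emeasure dV B = (\<integral>\<^sup>+z\<in>\<kappa> ` B. ennreal (\<rho> z) \<partial>Leb n)"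
    by (elim exE conjE) (rule that)
  have cont: "continuous_on (\<kappa> ` V) \<rho>"
    using smooth unfolding smooth_Cn_def by (auto dest: spec[of _ 0])
  define K where "K = \<kappa> ` V"
  have K: "K \<in> sets borel" "K \<subseteq> Cn n" "K \<in> sets (Leb n)"
    unfolding K_def by (rule chart_image_sets[OF c])+
  \<comment> \<open>The inverse chart is made total by a constant off the chart image, so that it is
    measurable on the whole space.\<close>
  define g where "g z = (if z \<in> K then inv_into V \<kappa> z else undefined)" for z
  have g: "g \<in> measurable (Leb n) borel" unfolding g_def K_def by (rule chart_inverse_measurable[OF c])
  have \<rho>m: "(\<lambda>z. ennreal (\<rho> z) * indicator K z) \<in> borel_measurable (Leb n)"
    unfolding K_def by (rule chart_density_measurable[OF c cont])
  have V: "V \<in> sets borel" using chart_open[OF c] by auto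
  have eq: "density dV (indicator V) = distr (density (Leb n) (\<lambda>z. ennreal (\<rho> z) * indicator K z)) borel g"
  proof (rule measure_eqI)
    fix B assume "B \<in> sets (density dV (indicator V))"
    then have B: "B \<in> sets borel" by simp
    have pt: "indicator (\<kappa> ` (B \<inter> V)) z = (indicator K z * indicator (g -` B \<inter> space (Leb n)) z :: ennreal)" for z
    proof (cases "z \<in> K")
      case True
      then obtain y where y: "y \<in> V" "z = \<kappa> y" by (auto simp: K_def)
      have "z \<in> \<kappa> ` (B \<inter> V) \<longleftrightarrow> y \<in> B \<inter> V" unfolding y(2) by (rule chart_mem_image_iff[OF c]) (use y in auto)
      moreover have "g z = y" using True y chart_inv[OF c] by (simp add: g_def)
      moreover have "z \<in> space (Leb n)" using True K by (auto simp: space_PiM Cn_def)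
      ultimately show ?thesis using True y by (auto simp: indicator_def)
    qed (auto simp: K_def indicator_def)
    have "emeasure (density dV (indicator V)) B = emeasure dV (B \<inter> V)"
      using B V by (subst emeasure_density) (auto simp: indicator_inter_arith[symmetric] Int_commute
          nn_integral_indicator[symmetric] simp del: nn_integral_indicator)
    also have "\<dots> = (\<integral>\<^sup>+z. ennreal (\<rho> z) * indicator (\<kappa> ` (B \<inter> V)) z \<partial>Leb n)"
      by (rule em[rule_format]) (use B V in auto)
    also have "\<dots> = (\<integral>\<^sup>+z. ennreal (\<rho> z) * indicator K z * indicator (g -` B \<inter> space (Leb n)) z \<partial>Leb n)"
      by (simp only: pt mult.assoc)
    also have "\<dots> = emeasure (density (Leb n) (\<lambda>z. ennreal (\<rho> z) * indicator K z)) (g -` B \<inter> space (Leb n))"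
      by (rule emeasure_density[symmetric]) (use \<rho>m measurable_sets[OF g B] in auto)
    also have "\<dots> = emeasure (distr (density (Leb n) (\<lambda>z. ennreal (\<rho> z) * indicator K z)) borel g) B"
      by (subst emeasure_distr) (use g B in auto)
    finally show "emeasure (density dV (indicator V)) B
      = emeasure (distr (density (Leb n) (\<lambda>z. ennreal (\<rho> z) * indicator K z)) borel g) B" .
  qed simp
  show ?thesis
  proof (rule that[OF cont pos], intro ballI impI)
    fix F :: "'a \<Rightarrow> ennreal" and B assume [measurable]: "F \<in> borel_measurable borel" and B: "B \<in> sets borel" "B \<subseteq> V"
    have [measurable]: "(\<lambda>y. F y * indicator B y) \<in> borel_measurable borel" using B(1) by measurable
    have "(\<integral>\<^sup>+y\<in>B. F y \<partial>dV) = (\<integral>\<^sup>+y. indicator V y * (F y * indicator B y) \<partial>dV)"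
      using B(2) by (intro nn_integral_cong) (auto simp: indicator_def)
    also have "\<dots> = (\<integral>\<^sup>+y. F y * indicator B y \<partial>density dV (indicator V))"
      using V by (subst nn_integral_density) auto
    also have "\<dots> = (\<integral>\<^sup>+z. F (g z) * indicator B (g z) \<partial>density (Leb n) (\<lambda>z. ennreal (\<rho> z) * indicator K z))"
      unfolding eq using g by (subst nn_integral_distr) auto
    also have "\<dots> = (\<integral>\<^sup>+z. ennreal (\<rho> z) * indicator K z * (F (g z) * indicator B (g z)) \<partial>Leb n)"
      by (subst nn_integral_density[OF \<rho>m]) (use measurable_compose[OF g, of "\<lambda>y. F y * indicator B y" borel] in auto)
    also have "\<dots> = (\<integral>\<^sup>+z\<in>\<kappa> ` B. F (inv_into V \<kappa> z) * ennreal (\<rho> z) \<partial>Leb n)"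
    proof (intro nn_integral_cong)
      fix z
      show "ennreal (\<rho> z) * indicator K z * (F (g z) * indicator B (g z))
        = F (inv_into V \<kappa> z) * ennreal (\<rho> z) * indicator (\<kappa> ` B) z"
      proof (cases "z \<in> K")
        case True
        then obtain y where y: "y \<in> V" "z = \<kappa> y" by (auto simp: K_def)
        have "z \<in> \<kappa> ` B \<longleftrightarrow> y \<in> B" unfolding y(2) by (rule chart_mem_image_iff[OF c B(2) y(1)])
        moreover have "g z = y" "inv_into V \<kappa> z = y" using True y chart_inv[OF c] by (simp_all add: g_def)
        ultimately show ?thesis using True by (auto simp: indicator_def mult_ac)
      qed (use B(2) in \<open>auto simp: K_def indicator_def\<close>)
    qed
    finally show "(\<integral>\<^sup>+y\<in>B. F y \<partial>dV) = (\<integral>\<^sup>+z\<in>\<kappa> ` B. F (inv_into V \<kappa> z) * ennreal (\<rho> z) \<partial>Leb n)" .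
  qed
qed

text \<open>F is only measurable on B, as it will be of the form \<open>|f|\<^sup>2 w\<close> with f arbitrary outside B.\<close>

lemma volume_comparable:
  assumes c: "(V, \<kappa>) \<in> A" and x: "x \<in> V"
  obtains U C where "open U" "x \<in> U" "U \<subseteq> V" "0 < C"
    "\<forall>F B. (\<lambda>y. F y * indicator B y) \<in> borel_measurable borel \<longrightarrow> B \<in> sets borel \<longrightarrow> B \<subseteq> U \<longrightarrow>
      (\<integral>\<^sup>+y\<in>B. F y \<partial>dV) \<le> ennreal C * (\<integral>\<^sup>+z\<in>\<kappa> ` B. F (inv_into V \<kappa> z) \<partial>Leb n)"
    "\<forall>F B. (\<lambda>y. F y * indicator B y) \<in> borel_measurable borel \<longrightarrow> B \<in> sets borel \<longrightarrow> B \<subseteq> U \<longrightarrow>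
      (\<integral>\<^sup>+z\<in>\<kappa> ` B. F (inv_into V \<kappa> z) \<partial>Leb n) \<le> ennreal C * (\<integral>\<^sup>+y\<in>B. F y \<partial>dV)"
proof -
  obtain \<rho> where \<rho>: "continuous_on (\<kappa> ` V) \<rho>" "\<forall>z\<in>\<kappa> ` V. 0 < \<rho> z"
    and int: "\<forall>F\<in>borel_measurable borel. \<forall>B\<in>sets borel. B \<subseteq> V \<longrightarrow>
      (\<integral>\<^sup>+y\<in>B. F y \<partial>dV) = (\<integral>\<^sup>+z\<in>\<kappa> ` B. F (inv_into V \<kappa> z) * ennreal (\<rho> z) \<partial>Leb n)"
    using nn_integral_chart[OF c] .
  define R where "R = \<rho> (\<kappa> x)"
  have R: "0 < R" using \<rho>(2) x by (simp add: R_def)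
  \<comment> \<open>On the neighbourhood \<open>U\<close> the density stays between R/2 and 2 R, so
    C bounds both the density and its reciprocal.\<close>
  define C where "C = max (2 * R) (2 / R)"
  have C: "0 < C" using R by (auto simp: C_def)
  have cont: "continuous_on V (\<lambda>y. \<rho> (\<kappa> y))"
    by (rule continuous_on_compose2[OF \<rho>(1) chart_continuous[OF c]]) auto
  define U where "U = V \<inter> (\<lambda>y. \<rho> (\<kappa> y)) -` {R/2<..<2*R}"
  have oU: "open U" unfolding U_def by (rule continuous_open_preimage[OF cont chart_open[OF c]]) auto
  have b: "\<rho> z \<le> C" "1 \<le> C * \<rho> z" if "z \<in> \<kappa> ` U" for z
  proof -
    have z: "R / 2 < \<rho> z" "\<rho> z < 2 * R" using that by (auto simp: U_def)
    then show "\<rho> z \<le> C" by (auto simp: C_def)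
    have "1 = 2 / R * (R / 2)" using R by simp
    also have "\<dots> \<le> C * \<rho> z" using z R by (intro mult_mono) (auto simp: C_def)
    finally show "1 \<le> C * \<rho> z" .
  qed
  have key: "(\<integral>\<^sup>+y\<in>B. F y \<partial>dV) = (\<integral>\<^sup>+z\<in>\<kappa> ` B. F (inv_into V \<kappa> z) * ennreal (\<rho> z) \<partial>Leb n)"
    "(\<lambda>z. F (inv_into V \<kappa> z) * indicator (\<kappa> ` B) z) \<in> borel_measurable (Leb n)"
    "(\<lambda>z. F (inv_into V \<kappa> z) * ennreal (\<rho> z) * indicator (\<kappa> ` B) z) \<in> borel_measurable (Leb n)"
    if F: "(\<lambda>y. F y * indicator B y) \<in> borel_measurable borel" and B: "B \<in> sets borel" "B \<subseteq> U" for F B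
  proof -
    have BV: "B \<subseteq> V" using B by (auto simp: U_def)
    have inB: "inv_into V \<kappa> z \<in> B" if "z \<in> \<kappa> ` B" for z using that BV chart_inv[OF c] by auto
    have "(\<integral>\<^sup>+y\<in>B. F y \<partial>dV) = (\<integral>\<^sup>+y\<in>B. F y * indicator B y \<partial>dV)"
      by (intro nn_integral_cong) (auto simp: indicator_def)
    also have "\<dots> = (\<integral>\<^sup>+z\<in>\<kappa> ` B. F (inv_into V \<kappa> z) * indicator B (inv_into V \<kappa> z) * ennreal (\<rho> z) \<partial>Leb n)"
      by (rule int[rule_format, OF F B(1) BV])
    also have "\<dots> = (\<integral>\<^sup>+z\<in>\<kappa> ` B. F (inv_into V \<kappa> z) * ennreal (\<rho> z) \<partial>Leb n)"
      using inB by (intro nn_integral_cong) (auto simp: indicator_def)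
    finally show "(\<integral>\<^sup>+y\<in>B. F y \<partial>dV) = (\<integral>\<^sup>+z\<in>\<kappa> ` B. F (inv_into V \<kappa> z) * ennreal (\<rho> z) \<partial>Leb n)" .
    show m1: "(\<lambda>z. F (inv_into V \<kappa> z) * indicator (\<kappa> ` B) z) \<in> borel_measurable (Leb n)"
      by (rule chart_pullback_measurable[OF c F BV])
    have "(\<lambda>z. F (inv_into V \<kappa> z) * ennreal (\<rho> z) * indicator (\<kappa> ` B) z) =
      (\<lambda>z. F (inv_into V \<kappa> z) * indicator (\<kappa> ` B) z * (ennreal (\<rho> z) * indicator (\<kappa> ` V) z))"
      using BV by (intro ext) (auto simp: indicator_def)
    then show "(\<lambda>z. F (inv_into V \<kappa> z) * ennreal (\<rho> z) * indicator (\<kappa> ` B) z) \<in> borel_measurable (Leb n)"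
      by (simp only:) (rule borel_measurable_times_ennreal[OF m1 chart_density_measurable[OF c \<rho>(1)]])
  qed
  show ?thesis
  proof (rule that[OF oU _ _ C])
    show "x \<in> U" using x R by (auto simp: U_def R_def)
    show "U \<subseteq> V" by (auto simp: U_def)
  next
    show "\<forall>F B. (\<lambda>y. F y * indicator B y) \<in> borel_measurable borel \<longrightarrow> B \<in> sets borel \<longrightarrow> B \<subseteq> U \<longrightarrow>
      (\<integral>\<^sup>+y\<in>B. F y \<partial>dV) \<le> ennreal C * (\<integral>\<^sup>+z\<in>\<kappa> ` B. F (inv_into V \<kappa> z) \<partial>Leb n)"
    proof (intro allI impI)
      fix F :: "'a \<Rightarrow> ennreal" and B
      assume h: "(\<lambda>y. F y * indicator B y) \<in> borel_measurable borel" "B \<in> sets borel" "B \<subseteq> U"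
      have "(\<integral>\<^sup>+y\<in>B. F y \<partial>dV) \<le> (\<integral>\<^sup>+z. ennreal C * (F (inv_into V \<kappa> z) * indicator (\<kappa> ` B) z) \<partial>Leb n)"
        unfolding key(1)[OF h]
      proof (intro nn_integral_mono)
        fix z
        show "F (inv_into V \<kappa> z) * ennreal (\<rho> z) * indicator (\<kappa> ` B) z
            \<le> ennreal C * (F (inv_into V \<kappa> z) * indicator (\<kappa> ` B) z)"
        proof (cases "z \<in> \<kappa> ` B")
          case True
          then have "ennreal (\<rho> z) \<le> ennreal C" using b(1)[of z] h(3) by (intro ennreal_leI) blast
          then show ?thesis using True by (simp add: mult.commute[of _ "ennreal (\<rho> z)"] mult_right_mono)
        qed auto
    qed
    also have "\<dots> = ennreal C * (\<integral>\<^sup>+z\<in>\<kappa> ` B. F (inv_into V \<kappa> z) \<partial>Leb n)"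
      by (rule nn_integral_cmult[OF key(2)[OF h]])
    finally show "(\<integral>\<^sup>+y\<in>B. F y \<partial>dV) \<le> ennreal C * (\<integral>\<^sup>+z\<in>\<kappa> ` B. F (inv_into V \<kappa> z) \<partial>Leb n)" .
    qed
  next
    show "\<forall>F B. (\<lambda>y. F y * indicator B y) \<in> borel_measurable borel \<longrightarrow> B \<in> sets borel \<longrightarrow> B \<subseteq> U \<longrightarrow>
      (\<integral>\<^sup>+z\<in>\<kappa> ` B. F (inv_into V \<kappa> z) \<partial>Leb n) \<le> ennreal C * (\<integral>\<^sup>+y\<in>B. F y \<partial>dV)"
    proof (intro allI impI)
      fix F :: "'a \<Rightarrow> ennreal" and B
      assume h: "(\<lambda>y. F y * indicator B y) \<in> borel_measurable borel" "B \<in> sets borel" "B \<subseteq> U"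
      have "(\<integral>\<^sup>+z\<in>\<kappa> ` B. F (inv_into V \<kappa> z) \<partial>Leb n)
          \<le> (\<integral>\<^sup>+z. ennreal C * (F (inv_into V \<kappa> z) * ennreal (\<rho> z) * indicator (\<kappa> ` B) z) \<partial>Leb n)"
      proof (intro nn_integral_mono)
        fix z
        show "F (inv_into V \<kappa> z) * indicator (\<kappa> ` B) z
            \<le> ennreal C * (F (inv_into V \<kappa> z) * ennreal (\<rho> z) * indicator (\<kappa> ` B) z)"
        proof (cases "z \<in> \<kappa> ` B")
          case True
          then have zU: "z \<in> \<kappa> ` U" using h(3) by blast
          have "1 \<le> ennreal (C * \<rho> z)" using b(2)[OF zU] ennreal_leI by fastforce
          then have "F (inv_into V \<kappa> z) * 1 \<le> F (inv_into V \<kappa> z) * ennreal (C * \<rho> z)" by (rule mult_left_mono) simp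
          then show ?thesis using True C by (simp add: ennreal_mult' mult_ac)
        qed auto
    qed
    also have "\<dots> = ennreal C * (\<integral>\<^sup>+z. F (inv_into V \<kappa> z) * ennreal (\<rho> z) * indicator (\<kappa> ` B) z \<partial>Leb n)"
      by (rule nn_integral_cmult[OF key(3)[OF h]])
    finally show "(\<integral>\<^sup>+z\<in>\<kappa> ` B. F (inv_into V \<kappa> z) \<partial>Leb n) \<le> ennreal C * (\<integral>\<^sup>+y\<in>B. F y \<partial>dV)"
      unfolding key(1)[OF h] .
    qed
  qed
qed

lemma holomorphic_weight_measurable:
  assumes f: "holomorphic_fun n A U f" and U: "open U" and w: "w \<in> borel_measurable borel"
    and B: "B \<in> sets borel" "B \<subseteq> U"
  shows "(\<lambda>y. ennreal ((cmod (f y))\<^sup>2) * w y * indicator B y) \<in> borel_measurable borel"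
proof -
  have [measurable]: "(\<lambda>y. indicator U y *\<^sub>R f y) \<in> borel_measurable borel"
    using holomorphic_fun_continuous[OF f U] U by (intro borel_measurable_continuous_on_indicator) auto
  have [measurable]: "w \<in> borel_measurable borel" "B \<in> sets borel" by fact+
  have "(\<lambda>y. ennreal ((cmod (f y))\<^sup>2) * w y * indicator B y)
      = (\<lambda>y. ennreal ((cmod (indicator U y *\<^sub>R f y))\<^sup>2) * w y * indicator B y)"
    using B(2) by (intro ext) (auto simp: indicator_def)
  also have "\<dots> \<in> borel_measurable borel" by measurable
  finally show ?thesis .
qed

text \<open>Volume and Lebesgue measure dominate each other near x, so charts disappear from the
  description of the ideal. The weight must be Borel for the comparison to apply.\<close>

lemma multiplier_ideal_volume:
  assumes w: "(\<lambda>y. exp_ext (- 2 * \<psi> y)) \<in> borel_measurable borel"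
  shows "multiplier_ideal n A \<psi> x = {germ x f | f. \<exists>U. open U \<and> x \<in> U \<and> holomorphic_fun n A U f \<and>
      (\<integral>\<^sup>+y\<in>U. ennreal ((cmod (f y))\<^sup>2) * exp_ext (- 2 * \<psi> y) \<partial>dV) < \<infinity>}"
proof (intro equalityI subsetI)
  fix G assume "G \<in> multiplier_ideal n A \<psi> x"
  then obtain f V \<kappa> U where G: "G = germ x f" and c: "(V, \<kappa>) \<in> A" and U: "open U" "x \<in> U" "U \<subseteq> V"
    and f: "holomorphic_fun n A U f"
    and fin: "(\<integral>\<^sup>+z\<in>\<kappa> ` U. ennreal ((cmod (f (inv_into V \<kappa> z)))\<^sup>2) * exp_ext (- 2 * \<psi> (inv_into V \<kappa> z)) \<partial>Leb n) < \<infinity>"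
    unfolding multiplier_ideal_def by blast
  have x: "x \<in> V" using U by auto
  obtain U' C where U': "open U'" "x \<in> U'" "U' \<subseteq> V" and C: "0 < C"
    and le1: "\<forall>F B. (\<lambda>y. F y * indicator B y) \<in> borel_measurable borel \<longrightarrow> B \<in> sets borel \<longrightarrow> B \<subseteq> U' \<longrightarrow>
      (\<integral>\<^sup>+y\<in>B. F y \<partial>dV) \<le> ennreal C * (\<integral>\<^sup>+z\<in>\<kappa> ` B. F (inv_into V \<kappa> z) \<partial>Leb n)"
    and le2: "\<forall>F B. (\<lambda>y. F y * indicator B y) \<in> borel_measurable borel \<longrightarrow> B \<in> sets borel \<longrightarrow> B \<subseteq> U' \<longrightarrow>
      (\<integral>\<^sup>+z\<in>\<kappa> ` B. F (inv_into V \<kappa> z) \<partial>Leb n) \<le> ennreal C * (\<integral>\<^sup>+y\<in>B. F y \<partial>dV)"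
    using volume_comparable[OF c x] .
  let ?F = "\<lambda>y. ennreal ((cmod (f y))\<^sup>2) * exp_ext (- 2 * \<psi> y)"
  have "(\<integral>\<^sup>+y\<in>U \<inter> U'. ?F y \<partial>dV) \<le> ennreal C * (\<integral>\<^sup>+z\<in>\<kappa> ` (U \<inter> U'). ?F (inv_into V \<kappa> z) \<partial>Leb n)"
    by (rule le1[rule_format]) (use U U' holomorphic_weight_measurable[OF f U(1) w] in auto)
  also have "\<dots> \<le> ennreal C * (\<integral>\<^sup>+z\<in>\<kappa> ` U. ?F (inv_into V \<kappa> z) \<partial>Leb n)"
    by (intro mult_left_mono nn_integral_mono) (auto simp: indicator_def)
  also have "\<dots> < \<infinity>" using fin by (simp add: ennreal_mult_less_top)
  finally have "(\<integral>\<^sup>+y\<in>U \<inter> U'. ?F y \<partial>dV) < \<infinity>" .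
  moreover have "holomorphic_fun n A (U \<inter> U') f" by (rule holomorphic_fun_subset[OF f]) auto
  ultimately show "G \<in> {germ x f | f. \<exists>U. open U \<and> x \<in> U \<and> holomorphic_fun n A U f \<and>
      (\<integral>\<^sup>+y\<in>U. ennreal ((cmod (f y))\<^sup>2) * exp_ext (- 2 * \<psi> y) \<partial>dV) < \<infinity>}"
    using G U U' open_Int by blast
next
  fix G assume "G \<in> {germ x f | f. \<exists>U. open U \<and> x \<in> U \<and> holomorphic_fun n A U f \<and>
      (\<integral>\<^sup>+y\<in>U. ennreal ((cmod (f y))\<^sup>2) * exp_ext (- 2 * \<psi> y) \<partial>dV) < \<infinity>}"
  then obtain f U where G: "G = germ x f" and U: "open U" "x \<in> U" and f: "holomorphic_fun n A U f"
    and fin: "(\<integral>\<^sup>+y\<in>U. ennreal ((cmod (f y))\<^sup>2) * exp_ext (- 2 * \<psi> y) \<partial>dV) < \<infinity>" by blast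
  obtain V \<kappa> where c: "(V, \<kappa>) \<in> A" "x \<in> V" using chart_at .
  obtain U' C where U': "open U'" "x \<in> U'" "U' \<subseteq> V" and C: "0 < C"
    and le1: "\<forall>F B. (\<lambda>y. F y * indicator B y) \<in> borel_measurable borel \<longrightarrow> B \<in> sets borel \<longrightarrow> B \<subseteq> U' \<longrightarrow>
      (\<integral>\<^sup>+y\<in>B. F y \<partial>dV) \<le> ennreal C * (\<integral>\<^sup>+z\<in>\<kappa> ` B. F (inv_into V \<kappa> z) \<partial>Leb n)"
    and le2: "\<forall>F B. (\<lambda>y. F y * indicator B y) \<in> borel_measurable borel \<longrightarrow> B \<in> sets borel \<longrightarrow> B \<subseteq> U' \<longrightarrow>
      (\<integral>\<^sup>+z\<in>\<kappa> ` B. F (inv_into V \<kappa> z) \<partial>Leb n) \<le> ennreal C * (\<integral>\<^sup>+y\<in>B. F y \<partial>dV)"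
    using volume_comparable[OF c] .
  let ?F = "\<lambda>y. ennreal ((cmod (f y))\<^sup>2) * exp_ext (- 2 * \<psi> y)"
  have "(\<integral>\<^sup>+z\<in>\<kappa> ` (U \<inter> U'). ?F (inv_into V \<kappa> z) \<partial>Leb n) \<le> ennreal C * (\<integral>\<^sup>+y\<in>U \<inter> U'. ?F y \<partial>dV)"
    by (rule le2[rule_format]) (use U U' holomorphic_weight_measurable[OF f U(1) w] in auto)
  also have "\<dots> \<le> ennreal C * (\<integral>\<^sup>+y\<in>U. ?F y \<partial>dV)"
    by (intro mult_left_mono nn_integral_mono) (auto simp: indicator_def)
  also have "\<dots> < \<infinity>" using fin by (simp add: ennreal_mult_less_top)
  finally have "(\<integral>\<^sup>+z\<in>\<kappa> ` (U \<inter> U'). ?F (inv_into V \<kappa> z) \<partial>Leb n) < \<infinity>" .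
  moreover have "holomorphic_fun n A (U \<inter> U') f" by (rule holomorphic_fun_subset[OF f]) auto
  ultimately show "G \<in> multiplier_ideal n A \<psi> x"
    unfolding multiplier_ideal_def G using U U' c
    by (intro CollectI exI[of _ f] conjI refl bexI[OF _ c(1)]) (auto intro!: exI[of _ "U \<inter> U'"])
qed

text \<open>The mean value inequality is applied to polydiscs of one common radius about all points
  near x.\<close>

lemma local_sup_bound:
  assumes D: "open D" and x: "x \<in> D"
  obtains U C where "open U" "x \<in> U" "U \<subseteq> D" "0 < C"
    "\<forall>f. holomorphic_fun n A D f \<longrightarrow> (\<forall>y\<in>U.
      ennreal ((cmod (f y))\<^sup>2) \<le> ennreal C * (\<integral>\<^sup>+y\<in>D. ennreal ((cmod (f y))\<^sup>2) \<partial>dV))"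
proof -
  obtain V \<kappa> where c: "(V, \<kappa>) \<in> A" "x \<in> V" using chart_at .
  obtain U' C where U': "open U'" "x \<in> U'" "U' \<subseteq> V" and C: "0 < C"
    and le1: "\<forall>F B. (\<lambda>y. F y * indicator B y) \<in> borel_measurable borel \<longrightarrow> B \<in> sets borel \<longrightarrow> B \<subseteq> U' \<longrightarrow>
      (\<integral>\<^sup>+y\<in>B. F y \<partial>dV) \<le> ennreal C * (\<integral>\<^sup>+z\<in>\<kappa> ` B. F (inv_into V \<kappa> z) \<partial>Leb n)"
    and le2: "\<forall>F B. (\<lambda>y. F y * indicator B y) \<in> borel_measurable borel \<longrightarrow> B \<in> sets borel \<longrightarrow> B \<subseteq> U' \<longrightarrow>
      (\<integral>\<^sup>+z\<in>\<kappa> ` B. F (inv_into V \<kappa> z) \<partial>Leb n) \<le> ennreal C * (\<integral>\<^sup>+y\<in>B. F y \<partial>dV)"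
    using volume_comparable[OF c] .
  have "open_in_Cn n (\<kappa> ` (D \<inter> U'))" using D U' by (intro chart_image_open_subset[OF c(1)]) auto
  then obtain r0 where r0: "0 < r0" "cpolydisc {..<n} (\<kappa> x) r0 \<subseteq> \<kappa> ` (D \<inter> U')"
    using open_in_Cn_contains_cpolydisc[of n "\<kappa> ` (D \<inter> U')" "\<kappa> x"] x U' by blast
  \<comment> \<open>Half the available radius: polydiscs of radius r about points of
    \<open>U\<close> stay inside the closed polydisc of radius r0 about the image of x.\<close>
  define r where "r = r0 / 2"
  have r: "0 < r" "2 * r = r0" using r0 by (auto simp: r_def)
  define U where "U = V \<inter> \<kappa> -` polydisc {..<n} (\<kappa> x) r"
  have oU: "open U" unfolding U_def by (rule chart_preimage_open[OF c(1) open_in_Cn_polydisc])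
  have \<kappa>Cn: "\<kappa> y \<in> Cn n" if "y \<in> V" for y using open_in_Cn_subset[OF chart_image_open[OF c(1)]] that by auto
  have xU: "x \<in> U" using c(2) \<kappa>Cn r by (auto simp: U_def intro: center_mem_polydisc)
  have sub: "polydisc {..<n} (\<kappa> y) r \<subseteq> \<kappa> ` (D \<inter> U')" if y: "y \<in> U" for y
  proof -
    have "polydisc {..<n} (\<kappa> y) r \<subseteq> cpolydisc {..<n} (\<kappa> x) r0"
    proof
      fix z assume z: "z \<in> polydisc {..<n} (\<kappa> y) r"
      have "dist (\<kappa> x i) (z i) \<le> r0" if "i < n" for i
      proof -
        have "dist (\<kappa> x i) (\<kappa> y i) < r" "dist (\<kappa> y i) (z i) < r"
          using y z that polydisc_dist by (auto simp: U_def)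
        then show ?thesis using dist_triangle[of "\<kappa> x i" "z i" "\<kappa> y i"] r(2) by linarith
      qed
      then show "z \<in> cpolydisc {..<n} (\<kappa> x) r0" using z by (auto simp: polydisc_def cpolydisc_def PiE_iff)
    qed
    with r0 show ?thesis by blast
  qed
  have UD: "U \<subseteq> D"
  proof
    fix y assume y: "y \<in> U"
    then have "\<kappa> y \<in> \<kappa> ` (D \<inter> U')" using sub[OF y] \<kappa>Cn r center_mem_polydisc by (auto simp: U_def)
    then show "y \<in> D" using y U' chart_mem_image_iff[OF c(1), of "D \<inter> U'" y] by (auto simp: U_def)
  qed
  define v where "v = (pi * r\<^sup>2) ^ n"
  have v: "0 < v" using r by (simp add: v_def)
  show ?thesis
  proof (rule that[OF oU xU UD, of "C / v"])
    show "0 < C / v" using C v by simp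
  next
    show "\<forall>f. holomorphic_fun n A D f \<longrightarrow> (\<forall>y\<in>U.
      ennreal ((cmod (f y))\<^sup>2) \<le> ennreal (C / v) * (\<integral>\<^sup>+y\<in>D. ennreal ((cmod (f y))\<^sup>2) \<partial>dV))"
    proof (intro allI impI ballI)
      fix f y assume f: "holomorphic_fun n A D f" and y: "y \<in> U"
      let ?P = "polydisc {..<n} (\<kappa> y) r"
      define B where "B = V \<inter> \<kappa> -` ?P"
      have B: "open B" unfolding B_def by (rule chart_preimage_open[OF c(1) open_in_Cn_polydisc])
      have PV: "?P \<subseteq> \<kappa> ` V" using sub[OF y] U' by blast
      have \<kappa>B: "\<kappa> ` B = ?P" using PV by (auto simp: B_def)
      have BD: "B \<subseteq> D \<inter> U'"
      proof
        fix u assume u: "u \<in> B"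
        then have "\<kappa> u \<in> \<kappa> ` (D \<inter> U')" using sub[OF y] by (auto simp: B_def)
        then show "u \<in> D \<inter> U'" using u U' chart_mem_image_iff[OF c(1), of "D \<inter> U'" u] by (auto simp: B_def)
    qed
    have hol: "holomorphic_Cn n ?P (\<lambda>z. f (inv_into V \<kappa> z))"
      using holomorphic_fun_chart[OF f c(1), of B] BD \<kappa>B by (auto simp: B_def)
    have "\<kappa> y \<in> Cn n" "f (inv_into V \<kappa> (\<kappa> y)) = f y"
      using y \<kappa>Cn chart_inv[OF c(1)] by (auto simp: U_def)
    then have "ennreal (v * (cmod (f y))\<^sup>2)
      \<le> (\<integral>\<^sup>+z. indicator ?P z * ennreal ((cmod (f (inv_into V \<kappa> z)))\<^sup>2) \<partial>Leb n)"
      using polydisc_mean_bound[of "{..<n}" r "\<kappa> y" "\<lambda>z. f (inv_into V \<kappa> z)"] hol r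
      by (auto simp: v_def Cn_def holomorphic_Cn_def)
    also have "\<dots> = (\<integral>\<^sup>+z\<in>\<kappa> ` B. ennreal ((cmod (f (inv_into V \<kappa> z)))\<^sup>2) \<partial>Leb n)"
      by (simp add: \<kappa>B mult.commute)
    also have "\<dots> \<le> ennreal C * (\<integral>\<^sup>+y\<in>B. ennreal ((cmod (f y))\<^sup>2) \<partial>dV)"
      by (rule le2[rule_format]) (use holomorphic_weight_measurable[OF f D, of "\<lambda>_. 1" B] B BD in auto)
    also have "\<dots> \<le> ennreal C * (\<integral>\<^sup>+y\<in>D. ennreal ((cmod (f y))\<^sup>2) \<partial>dV)"
      using BD by (intro mult_left_mono nn_integral_mono) (auto simp: indicator_def)
    finally have "ennreal (1 / v) * ennreal (v * (cmod (f y))\<^sup>2)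
      \<le> ennreal (1 / v) * (ennreal C * (\<integral>\<^sup>+y\<in>D. ennreal ((cmod (f y))\<^sup>2) \<partial>dV))"
      by (rule mult_left_mono) simp
    then show "ennreal ((cmod (f y))\<^sup>2) \<le> ennreal (C / v) * (\<integral>\<^sup>+y\<in>D. ennreal ((cmod (f y))\<^sup>2) \<partial>dV)"
      using v C by (simp add: ennreal_mult'[symmetric] mult.assoc[symmetric])
    qed
  qed
qed

lemma compact_sup_bound:
  assumes D: "open D" and K: "compact K" "K \<subseteq> D"
  obtains C where "0 < C" "\<forall>f. holomorphic_fun n A D f \<longrightarrow> (\<forall>y\<in>K.
      ennreal ((cmod (f y))\<^sup>2) \<le> ennreal C * (\<integral>\<^sup>+y\<in>D. ennreal ((cmod (f y))\<^sup>2) \<partial>dV))"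
proof -
  define P where "P U C \<longleftrightarrow> 0 < C \<and> (\<forall>f. holomorphic_fun n A D f \<longrightarrow> (\<forall>y\<in>U.
      ennreal ((cmod (f y))\<^sup>2) \<le> ennreal C * (\<integral>\<^sup>+y\<in>D. ennreal ((cmod (f y))\<^sup>2) \<partial>dV)))" for U C
  have "\<exists>U C. open U \<and> x \<in> U \<and> P U C" if x: "x \<in> K" for x
  proof -
    have "x \<in> D" using x K by auto
    show ?thesis
      by (rule local_sup_bound[OF D \<open>x \<in> D\<close>]) (unfold P_def, blast)
  qed
  then have "\<forall>x\<in>K. \<exists>U. open U \<and> x \<in> U \<and> (\<exists>C. P U C)" by blast
  from bchoice[OF this] obtain U where U: "\<And>x. x \<in> K \<Longrightarrow> open (U x) \<and> x \<in> U x \<and> (\<exists>C. P (U x) C)" by blast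
  from compactE_image[OF K(1), of K U] U obtain S where S: "S \<subseteq> K" "finite S" "K \<subseteq> (\<Union>x\<in>S. U x)"
    by (metis UN_iff subsetI)
  have "\<forall>x\<in>S. \<exists>C. P (U x) C" using U S by blast
  from bchoice[OF this] obtain C where C: "\<And>x. x \<in> S \<Longrightarrow> P (U x) (C x)" by blast
  define M where "M = 1 + (\<Sum>x\<in>S. C x)"
  have C0: "0 < C x" if "x \<in> S" for x using C[OF that] by (auto simp: P_def)
  have M0: "0 < M" unfolding M_def using C0 by (intro add_pos_nonneg sum_nonneg) (auto intro: less_imp_le)
  show ?thesis
  proof (rule that[OF M0], intro allI impI ballI)
    fix f y assume f: "holomorphic_fun n A D f" and y: "y \<in> K"
    then obtain x where x: "x \<in> S" "y \<in> U x" using S by blast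
    have "ennreal ((cmod (f y))\<^sup>2) \<le> ennreal (C x) * (\<integral>\<^sup>+y\<in>D. ennreal ((cmod (f y))\<^sup>2) \<partial>dV)"
      using C[OF x(1)] f x unfolding P_def by blast
    also have "C x \<le> M" unfolding M_def using member_le_sum[of x S C] C0 x S by (force intro: less_imp_le)
    then have "ennreal (C x) * (\<integral>\<^sup>+y\<in>D. ennreal ((cmod (f y))\<^sup>2) \<partial>dV) \<le> ennreal M * (\<integral>\<^sup>+y\<in>D. ennreal ((cmod (f y))\<^sup>2) \<partial>dV)"
      by (intro mult_right_mono ennreal_leI) auto
    finally show "ennreal ((cmod (f y))\<^sup>2) \<le> ennreal M * (\<integral>\<^sup>+y\<in>D. ennreal ((cmod (f y))\<^sup>2) \<partial>dV)" .
  qed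
qed

end

section \<open>Weighted spaces of holomorphic functions\<close>

context volume_manifold
begin

definition sq_int :: "('a \<Rightarrow> ennreal) \<Rightarrow> ('a \<Rightarrow> complex) \<Rightarrow> ennreal" where
  "sq_int u f = (\<integral>\<^sup>+y. ennreal ((cmod (f y))\<^sup>2) * u y \<partial>dV)"

lemma sq_int_scale:
  assumes [measurable]: "f \<in> borel_measurable borel" "u \<in> borel_measurable borel"
  shows "sq_int u (\<lambda>y. a * f y) = ennreal ((cmod a)\<^sup>2) * sq_int u f"
  unfolding sq_int_def
  by (subst nn_integral_cmult[symmetric]) (auto simp: norm_mult power_mult_distrib ennreal_mult' mult.assoc)

lemma sq_int_parallelogram:
  assumes [measurable]: "f \<in> borel_measurable borel" "g \<in> borel_measurable borel" "u \<in> borel_measurable borel"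
  shows "sq_int u (\<lambda>y. f y + g y) + sq_int u (\<lambda>y. f y - g y) = 2 * sq_int u f + 2 * sq_int u g"
proof -
  have eq: "ennreal ((cmod (f y + g y))\<^sup>2) * u y + ennreal ((cmod (f y - g y))\<^sup>2) * u y
      = 2 * (ennreal ((cmod (f y))\<^sup>2) * u y) + 2 * (ennreal ((cmod (g y))\<^sup>2) * u y)" for y
  proof -
    have "(cmod (f y + g y))\<^sup>2 + (cmod (f y - g y))\<^sup>2 = 2 * (cmod (f y))\<^sup>2 + 2 * (cmod (g y))\<^sup>2"
      unfolding cmod_power2 by (simp add: power2_eq_square algebra_simps)
    then have "ennreal ((cmod (f y + g y))\<^sup>2) + ennreal ((cmod (f y - g y))\<^sup>2)
        = 2 * ennreal ((cmod (f y))\<^sup>2) + 2 * ennreal ((cmod (g y))\<^sup>2)"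
      by (simp add: ennreal_plus[symmetric] ennreal_mult'[symmetric] ennreal_numeral[symmetric]
          del: ennreal_plus ennreal_numeral)
    then show ?thesis by (simp add: distrib_right[symmetric] mult.assoc[symmetric])
  qed
  have "sq_int u (\<lambda>y. f y + g y) + sq_int u (\<lambda>y. f y - g y)
      = (\<integral>\<^sup>+y. ennreal ((cmod (f y + g y))\<^sup>2) * u y + ennreal ((cmod (f y - g y))\<^sup>2) * u y \<partial>dV)"
    unfolding sq_int_def by (rule nn_integral_add[symmetric]) measurable
  also have "\<dots> = 2 * sq_int u f + 2 * sq_int u g"
    unfolding sq_int_def eq by (subst nn_integral_add) (auto simp: nn_integral_cmult)
  finally show ?thesis .
qed

lemma sq_int_young:
  assumes [measurable]: "f \<in> borel_measurable borel" "g \<in> borel_measurable borel" "u \<in> borel_measurable borel"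
    and t: "0 < t"
  shows "sq_int u (\<lambda>y. f y + g y) \<le> ennreal (1 + t) * sq_int u f + ennreal (1 + 1 / t) * sq_int u g"
proof -
  have "ennreal ((cmod (f y + g y))\<^sup>2) * u y
      \<le> ennreal (1 + t) * (ennreal ((cmod (f y))\<^sup>2) * u y) + ennreal (1 + 1 / t) * (ennreal ((cmod (g y))\<^sup>2) * u y)" for y
  proof -
    let ?a = "cmod (f y)" and ?b = "cmod (g y)"
    have "0 \<le> (t * ?a - ?b)\<^sup>2 / t" using t by simp
    also have "\<dots> = t * ?a\<^sup>2 - 2 * ?a * ?b + ?b\<^sup>2 / t" using t by (simp add: power2_eq_square field_simps)
    finally have "2 * ?a * ?b \<le> t * ?a\<^sup>2 + ?b\<^sup>2 / t" by simp
    moreover have "(cmod (f y + g y))\<^sup>2 \<le> (?a + ?b)\<^sup>2" by (intro power_mono norm_triangle_ineq) auto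
    ultimately have "(cmod (f y + g y))\<^sup>2 \<le> (1 + t) * ?a\<^sup>2 + (1 + 1 / t) * ?b\<^sup>2"
      by (simp add: power2_sum algebra_simps)
    then have "ennreal ((cmod (f y + g y))\<^sup>2) \<le> ennreal (1 + t) * ennreal (?a\<^sup>2) + ennreal (1 + 1 / t) * ennreal (?b\<^sup>2)"
      using t by (simp add: ennreal_plus[symmetric] ennreal_mult'[symmetric] del: ennreal_plus)
    from mult_right_mono[OF this, of "u y"] show ?thesis by (simp add: distrib_right mult.assoc)
  qed
  then have "sq_int u (\<lambda>y. f y + g y) \<le> (\<integral>\<^sup>+y. ennreal (1 + t) * (ennreal ((cmod (f y))\<^sup>2) * u y)
      + ennreal (1 + 1 / t) * (ennreal ((cmod (g y))\<^sup>2) * u y) \<partial>dV)"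
    unfolding sq_int_def by (intro nn_integral_mono)
  also have "\<dots> = ennreal (1 + t) * sq_int u f + ennreal (1 + 1 / t) * sq_int u g"
    unfolding sq_int_def by (subst nn_integral_add) (auto simp: nn_integral_cmult)
  finally show ?thesis .
qed

lemma sq_int_mono: "(\<And>y. u y \<le> v y) \<Longrightarrow> sq_int u f \<le> sq_int v f"
  unfolding sq_int_def by (intro nn_integral_mono mult_left_mono) auto

text \<open>Cutting off the weight instead of the domain of integration brings every norm into the
  form \<open>sq_int\<close>, whose algebraic laws are then proved only once.\<close>

definition weight_on :: "('a \<Rightarrow> ennreal) \<Rightarrow> 'a set \<Rightarrow> 'a \<Rightarrow> ennreal" where
  "weight_on w D = (\<lambda>y. w y * indicator D y)"

lemma weight_on_measurable [measurable]:
  "w \<in> borel_measurable borel \<Longrightarrow> D \<in> sets borel \<Longrightarrow> weight_on w D \<in> borel_measurable borel"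
  unfolding weight_on_def by (intro borel_measurable_times_ennreal borel_measurable_indicator)

lemma weight_on_mono: "D \<subseteq> D' \<Longrightarrow> weight_on w D y \<le> weight_on w D' y"
  by (auto simp: weight_on_def indicator_def)

lemma sq_int_weight_on: "sq_int (weight_on w D) f = (\<integral>\<^sup>+y\<in>D. ennreal ((cmod (f y))\<^sup>2) * w y \<partial>dV)"
  by (simp add: sq_int_def weight_on_def mult.assoc)

text \<open>Members are total Borel functions with arbitrary values off D, so the resulting norm is
  only a seminorm. This matches \<open>quadratic_space\<close>, whose elements are total
  functions.\<close>

definition hol_space :: "('a \<Rightarrow> ennreal) \<Rightarrow> 'a set \<Rightarrow> ('a \<Rightarrow> complex) set" where
  "hol_space w D = {f \<in> borel_measurable borel. holomorphic_fun n A D f \<and> sq_int (weight_on w D) f < \<infinity>}"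

lemma hol_spaceD:
  assumes "f \<in> hol_space w D"
  shows "f \<in> borel_measurable borel" "holomorphic_fun n A D f" "sq_int (weight_on w D) f < \<infinity>"
  using assms by (auto simp: hol_space_def)

lemma hol_space_subset: "D' \<subseteq> D \<Longrightarrow> hol_space w D \<subseteq> hol_space w D'"
proof
  fix f assume D: "D' \<subseteq> D" and f: "f \<in> hol_space w D"
  have "sq_int (weight_on w D') f \<le> sq_int (weight_on w D) f" by (rule sq_int_mono[OF weight_on_mono[OF D]])
  then show "f \<in> hol_space w D'"
    using f holomorphic_fun_subset[OF _ D] by (auto simp: hol_space_def intro: le_less_trans)
qed

definition wnorm :: "('a \<Rightarrow> ennreal) \<Rightarrow> 'a set \<Rightarrow> ('a \<Rightarrow> complex) \<Rightarrow> real" where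
  "wnorm w D f = enn2real (sq_int (weight_on w D) f)"

lemma wnorm_nonneg [simp]: "0 \<le> wnorm w D f"
  by (simp add: wnorm_def)

lemma ennreal_wnorm: "f \<in> hol_space w D \<Longrightarrow> ennreal (wnorm w D f) = sq_int (weight_on w D) f"
  by (simp add: wnorm_def hol_space_def)

lemma hol_space_lin:
  assumes w: "w \<in> borel_measurable borel" "D \<in> sets borel" and f: "f \<in> hol_space w D" and g: "g \<in> hol_space w D"
  shows "(\<lambda>y. a * f y + b * g y) \<in> hol_space w D"
proof -
  note [measurable] = w hol_spaceD(1)[OF f] hol_spaceD(1)[OF g]
  have "sq_int (weight_on w D) (\<lambda>y. a * f y + b * g y)
      \<le> ennreal (1 + 1) * sq_int (weight_on w D) (\<lambda>y. a * f y) + ennreal (1 + 1 / 1) * sq_int (weight_on w D) (\<lambda>y. b * g y)"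
    by (rule sq_int_young) auto
  also have "\<dots> < \<infinity>"
    using hol_spaceD(3)[OF f] hol_spaceD(3)[OF g]
    by (simp add: sq_int_scale ennreal_mult_less_top less_top[symmetric] ennreal_mult_eq_top_iff)
  finally show ?thesis
    using holomorphic_fun_lin[OF hol_spaceD(2)[OF f] hol_spaceD(2)[OF g], of a b] by (simp add: hol_space_def)
qed

lemma integral_le_sq_int:
  assumes c: "0 < c" "\<And>y. y \<in> D \<Longrightarrow> ennreal c \<le> w y"
    and [measurable]: "w \<in> borel_measurable borel" "D \<in> sets borel" "f \<in> borel_measurable borel"
  shows "(\<integral>\<^sup>+y\<in>D. ennreal ((cmod (f y))\<^sup>2) \<partial>dV) \<le> ennreal (1 / c) * sq_int (weight_on w D) f"
proof -
  have "(\<integral>\<^sup>+y\<in>D. ennreal ((cmod (f y))\<^sup>2) \<partial>dV) \<le> (\<integral>\<^sup>+y. ennreal (1 / c) * (ennreal ((cmod (f y))\<^sup>2) * weight_on w D y) \<partial>dV)"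
  proof (intro nn_integral_mono)
    fix y
    show "ennreal ((cmod (f y))\<^sup>2) * indicator D y \<le> ennreal (1 / c) * (ennreal ((cmod (f y))\<^sup>2) * weight_on w D y)"
    proof (cases "y \<in> D")
      case True
      have "1 = ennreal (1 / c) * ennreal c" using c(1) by (simp add: ennreal_mult'[symmetric])
      also have "\<dots> \<le> ennreal (1 / c) * w y" using c(2)[OF True] by (intro mult_left_mono) auto
      finally have "ennreal ((cmod (f y))\<^sup>2) * 1 \<le> ennreal ((cmod (f y))\<^sup>2) * (ennreal (1 / c) * w y)"
        by (rule mult_left_mono) simp
      then show ?thesis using True by (simp add: weight_on_def mult_ac)
    qed simp
  qed
  also have "\<dots> = ennreal (1 / c) * sq_int (weight_on w D) f"
    unfolding sq_int_def by (rule nn_integral_cmult) measurable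
  finally show ?thesis .
qed

text \<open>A positive lower bound of the weight lets the w-norm control the unweighted norm, and
  this controls values on compact sets. In the application the bound comes from a local upper bound
  of \<phi>. In particular all point evaluations in D are bounded.\<close>

lemma hol_space_sup_bound:
  assumes D: "open D" and K: "compact K" "K \<subseteq> D" and c: "0 < c" "\<And>y. y \<in> D \<Longrightarrow> ennreal c \<le> w y"
    and w: "w \<in> borel_measurable borel"
  obtains C where "0 < C" "\<forall>f\<in>hol_space w D. \<forall>y\<in>K. (cmod (f y))\<^sup>2 \<le> C * wnorm w D f"
proof -
  obtain C where C: "0 < C" "\<forall>f. holomorphic_fun n A D f \<longrightarrow> (\<forall>y\<in>K.
      ennreal ((cmod (f y))\<^sup>2) \<le> ennreal C * (\<integral>\<^sup>+y\<in>D. ennreal ((cmod (f y))\<^sup>2) \<partial>dV))"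
    using compact_sup_bound[OF D K] .
  show ?thesis
  proof (rule that[of "C / c"], use C(1) c(1) in simp, intro ballI)
    fix f y assume f: "f \<in> hol_space w D" and y: "y \<in> K"
    have "(\<integral>\<^sup>+y\<in>D. ennreal ((cmod (f y))\<^sup>2) \<partial>dV) \<le> ennreal (1 / c) * ennreal (wnorm w D f)"
      using integral_le_sq_int[OF c w _ hol_spaceD(1)[OF f]] D by (simp add: ennreal_wnorm[OF f])
    then have "ennreal C * (\<integral>\<^sup>+y\<in>D. ennreal ((cmod (f y))\<^sup>2) \<partial>dV) \<le> ennreal C * (ennreal (1 / c) * ennreal (wnorm w D f))"
      by (rule mult_left_mono) simp
    also have "\<dots> = ennreal (C / c * wnorm w D f)"
      using C(1) c(1) by (simp add: ennreal_mult'[symmetric])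
    finally have "ennreal ((cmod (f y))\<^sup>2) \<le> ennreal (C / c * wnorm w D f)"
      using C(2) hol_spaceD(2)[OF f] y order_trans by blast
    then show "(cmod (f y))\<^sup>2 \<le> C / c * wnorm w D f"
      using C(1) c(1) by (subst (asm) ennreal_le_iff) (auto simp: wnorm_def)
  qed
qed

text \<open>The sup bound makes the sequence locally uniformly Cauchy, so its limit is holomorphic;
  Fatou's lemma carries the norm estimates over to the limit.\<close>

lemma hol_space_complete:
  assumes D: "open D" and c: "0 < c" "\<And>y. y \<in> D \<Longrightarrow> ennreal c \<le> w y" and w: "w \<in> borel_measurable borel"
    and u: "\<And>k. u k \<in> hol_space w D"
    and cauchy: "\<And>k m. k \<le> m \<Longrightarrow> wnorm w D (\<lambda>y. u m y - u k y) \<le> 4 * (1/16) ^ k"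
  shows "\<exists>f\<in>hol_space w D. \<forall>k. wnorm w D (\<lambda>y. f y - u k y) \<le> 4 * (1/16) ^ k"
proof -
  have Db [measurable]: "D \<in> sets borel" using D by simp
  note [measurable] = w hol_spaceD(1)[OF u]
  have mem: "(\<lambda>y. u m y - u k y) \<in> hol_space w D" for m k
    using hol_space_lin[OF w Db u u, of 1 m "-1" k] by simp
  have loc: "\<exists>U. open U \<and> x \<in> U \<and> U \<subseteq> D \<and> uniformly_Cauchy_on U u" if x: "x \<in> D" for x
  proof -
    obtain U C where U: "open U" "x \<in> U" "U \<subseteq> D" and C: "0 < C" "\<forall>f. holomorphic_fun n A D f \<longrightarrow> (\<forall>y\<in>U.
      ennreal ((cmod (f y))\<^sup>2) \<le> ennreal C * (\<integral>\<^sup>+y\<in>D. ennreal ((cmod (f y))\<^sup>2) \<partial>dV))"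
      using local_sup_bound[OF D x] .
    have bd: "cmod (u m y - u k y) \<le> 2 * sqrt (C / c) * (1/4) ^ k" if km: "k \<le> m" and y: "y \<in> U" for k m y
    proof -
      have "ennreal ((cmod (u m y - u k y))\<^sup>2) \<le> ennreal C * (\<integral>\<^sup>+y\<in>D. ennreal ((cmod (u m y - u k y))\<^sup>2) \<partial>dV)"
        using C(2) hol_spaceD(2)[OF mem] y by blast
      also have "\<dots> \<le> ennreal C * (ennreal (1 / c) * sq_int (weight_on w D) (\<lambda>y. u m y - u k y))"
        by (intro mult_left_mono integral_le_sq_int[OF c w Db hol_spaceD(1)[OF mem]]) auto
      also have "\<dots> = ennreal (C / c * wnorm w D (\<lambda>y. u m y - u k y))"
        using C(1) c(1) by (simp add: ennreal_wnorm[OF mem, symmetric] ennreal_mult'[symmetric])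
      finally have "(cmod (u m y - u k y))\<^sup>2 \<le> C / c * wnorm w D (\<lambda>y. u m y - u k y)"
        using C(1) c(1) by (subst (asm) ennreal_le_iff) (auto simp: wnorm_def)
      also have "\<dots> \<le> C / c * (4 * (1/16) ^ k)" using C(1) c(1) cauchy[OF km] by (intro mult_left_mono) auto
      also have "\<dots> = (2 * sqrt (C / c) * (1/4) ^ k)\<^sup>2"
      proof -
        have "((1/4 :: real) ^ k)\<^sup>2 = (1/16) ^ k" by (simp add: power_mult_distrib[symmetric] power2_eq_square)
        then show ?thesis using C(1) c(1) by (simp add: power_mult_distrib)
      qed
      finally show ?thesis by (rule power2_le_imp_le) (use C(1) c(1) in simp)
    qed
    have "uniformly_Cauchy_on U u"
      unfolding uniformly_Cauchy_on_def
    proof (intro allI impI)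
      fix e :: real assume e: "0 < e"
      have "(\<lambda>k. 2 * sqrt (C / c) * (1/4) ^ k) \<longlonglongrightarrow> 2 * sqrt (C / c) * 0"
        by (intro tendsto_intros LIMSEQ_power_zero) simp
      then have "\<forall>\<^sub>F k in sequentially. 2 * sqrt (C / c) * (1/4) ^ k < e / 2"
        using e by (intro order_tendstoD) auto
      then obtain N where N: "2 * sqrt (C / c) * (1/4) ^ N < e / 2" by (auto simp: eventually_sequentially)
      show "\<exists>M. \<forall>x\<in>U. \<forall>m\<ge>M. \<forall>n\<ge>M. dist (u m x) (u n x) < e"
      proof (intro exI[of _ N] ballI allI impI)
        fix y m k assume y: "y \<in> U" and mk: "N \<le> m" "N \<le> k"
        have "dist (u m y) (u k y) \<le> dist (u m y) (u N y) + dist (u k y) (u N y)" by (rule dist_triangle2)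
        also have "\<dots> < e" using bd[OF mk(1) y] bd[OF mk(2) y] N by (simp add: dist_norm)
        finally show "dist (u m y) (u k y) < e" .
      qed
    qed
    with U show ?thesis by blast
  qed
  \<comment> \<open>The value 0 off D keeps the limit Borel on the whole manifold.\<close>
  define f where "f y = (if y \<in> D then lim (\<lambda>k. u k y) else 0)" for y
  have lim: "\<exists>U. open U \<and> x \<in> U \<and> U \<subseteq> D \<and> uniform_limit U u f sequentially" if x: "x \<in> D" for x
  proof -
    obtain U where U: "open U" "x \<in> U" "U \<subseteq> D" "uniformly_Cauchy_on U u" using loc[OF x] by blast
    then obtain l where l: "uniform_limit U u l sequentially"
      using Cauchy_uniformly_convergent uniformly_convergent_on_def by blast
    have "l y = f y" if "y \<in> U" for y
      using tendsto_uniform_limitI[OF l that] U(3) that by (auto simp: f_def limI)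
    with l have "uniform_limit U u f sequentially"
      using uniform_limit_cong'[of U u u l f sequentially] by simp
    with U show ?thesis by blast
  qed
  have hol: "holomorphic_fun n A D f"
    by (rule holomorphic_fun_locally_uniform_limit[OF hol_spaceD(2)[OF u] D lim])
  have pt: "(\<lambda>m. u m y) \<longlonglongrightarrow> f y" if y: "y \<in> D" for y
  proof -
    obtain U where U: "open U" "y \<in> U" "U \<subseteq> D" "uniform_limit U u f sequentially"
      using lim[OF y] by (elim exE conjE)
    show ?thesis by (rule tendsto_uniform_limitI[OF U(4,2)])
  qed
  have fm [measurable]: "f \<in> borel_measurable borel"
  proof -
    have "(\<lambda>y. indicator D y *\<^sub>R f y) \<in> borel_measurable borel"
      by (rule borel_measurable_continuous_on_indicator[OF Db holomorphic_fun_continuous[OF hol D]])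
    moreover have "(\<lambda>y. indicator D y *\<^sub>R f y) = f" by (auto simp: f_def indicator_def)
    ultimately show ?thesis by simp
  qed
  have bnd: "sq_int (weight_on w D) (\<lambda>y. f y - u k y) \<le> ennreal (4 * (1/16) ^ k)" for k
  proof -
    have "ennreal ((cmod (f y - u k y))\<^sup>2) * weight_on w D y
        \<le> liminf (\<lambda>m. ennreal ((cmod (u m y - u k y))\<^sup>2) * weight_on w D y)" for y
    \<comment> \<open>The weight may be infinite, and 0 * infinity = 0 breaks continuity of the
      product. Points with f y = u k y are therefore separated; there the left side is 0.\<close>
    proof (cases "y \<in> D \<and> f y \<noteq> u k y")
      case True
      have "(\<lambda>m. ennreal ((cmod (u m y - u k y))\<^sup>2)) \<longlonglongrightarrow> ennreal ((cmod (f y - u k y))\<^sup>2)"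
        using pt True by (intro tendsto_ennrealI tendsto_intros) auto
      then have "(\<lambda>m. ennreal ((cmod (u m y - u k y))\<^sup>2) * weight_on w D y) \<longlonglongrightarrow> ennreal ((cmod (f y - u k y))\<^sup>2) * weight_on w D y"
        by (rule tendsto_mult_ennreal[OF _ tendsto_const]) (use True in auto)
      then show ?thesis using lim_imp_Liminf[OF sequentially_bot] by (metis order_refl)
    qed (auto simp: weight_on_def)
    then have "sq_int (weight_on w D) (\<lambda>y. f y - u k y) \<le> (\<integral>\<^sup>+y. liminf (\<lambda>m. ennreal ((cmod (u m y - u k y))\<^sup>2) * weight_on w D y) \<partial>dV)"
      unfolding sq_int_def by (intro nn_integral_mono)
    also have "\<dots> \<le> liminf (\<lambda>m. \<integral>\<^sup>+y. ennreal ((cmod (u m y - u k y))\<^sup>2) * weight_on w D y \<partial>dV)"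
      by (intro nn_integral_liminf) measurable
    also have "\<dots> \<le> liminf (\<lambda>m::nat. ennreal (4 * (1/16) ^ k))"
    proof (rule Liminf_mono)
      show "\<forall>\<^sub>F m in sequentially. (\<integral>\<^sup>+y. ennreal ((cmod (u m y - u k y))\<^sup>2) * weight_on w D y \<partial>dV) \<le> ennreal (4 * (1/16) ^ k)"
        using eventually_ge_at_top[of k]
      proof eventually_elim
        case (elim m)
        show ?case using ennreal_leI[OF cauchy[OF elim]] ennreal_wnorm[OF mem, of m k] by (simp add: sq_int_def)
      qed
    qed
    finally show ?thesis by (simp add: Liminf_const)
  qed
  have "sq_int (weight_on w D) (\<lambda>y. f y - u 0 y) < \<infinity>" using bnd[of 0] by (rule le_less_trans) simp
  then have "(\<lambda>y. f y - u 0 y) \<in> hol_space w D"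
    using holomorphic_fun_lin[OF hol hol_spaceD(2)[OF u], of 1 "-1" 0] by (simp add: hol_space_def)
  from hol_space_lin[OF w Db this u, of 1 1 0] have "f \<in> hol_space w D" by simp
  moreover have "wnorm w D (\<lambda>y. f y - u k y) \<le> 4 * (1/16) ^ k" for k
    using enn2real_mono[OF bnd[of k]] by (simp add: wnorm_def)
  ultimately show ?thesis by blast
qed

lemma quadratic_space_hol_space:
  assumes D: "open D" and c: "0 < c" "\<And>y. y \<in> D \<Longrightarrow> ennreal c \<le> w y" and w: "w \<in> borel_measurable borel"
  shows "quadratic_space (hol_space w D) (wnorm w D)"
proof
  have Db: "D \<in> sets borel" using D by simp
  note [measurable] = w Db hol_spaceD(1)
  have zero: "(\<lambda>_. 0) \<in> hol_space w D"
    unfolding hol_space_def holomorphic_fun_def holomorphic_Cn_def by (auto simp: sq_int_def)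
  show "(\<lambda>_. 0) \<in> hol_space w D" by (rule zero)
  show lin: "(\<lambda>x. a * f x + b * g x) \<in> hol_space w D" if "f \<in> hol_space w D" "g \<in> hol_space w D" for f g a b
    by (rule hol_space_lin[OF w Db that])
  show "0 \<le> wnorm w D f" for f by (simp add: wnorm_def)
  show "wnorm w D (\<lambda>x. a * f x) = (cmod a)\<^sup>2 * wnorm w D f" if "f \<in> hol_space w D" for f a
    using sq_int_scale[OF hol_spaceD(1)[OF that], of "weight_on w D" a] w Db
    by (simp add: wnorm_def enn2real_mult)
  have add: "(\<lambda>x. f x + g x) \<in> hol_space w D" and diff: "(\<lambda>x. f x - g x) \<in> hol_space w D"
    if "f \<in> hol_space w D" "g \<in> hol_space w D" for f g
    using lin[OF that, of 1 1] lin[OF that, of 1 "-1"] by simp_all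
  show par: "wnorm w D (\<lambda>x. f x + g x) + wnorm w D (\<lambda>x. f x - g x) = 2 * wnorm w D f + 2 * wnorm w D g"
    if f: "f \<in> hol_space w D" and g: "g \<in> hol_space w D" for f g
  proof -
    have "ennreal (wnorm w D (\<lambda>x. f x + g x) + wnorm w D (\<lambda>x. f x - g x)) = ennreal (2 * wnorm w D f + 2 * wnorm w D g)"
      using sq_int_parallelogram[OF hol_spaceD(1)[OF f] hol_spaceD(1)[OF g], of "weight_on w D"] w Db
      by (simp add: ennreal_wnorm[OF add[OF f g], symmetric] ennreal_wnorm[OF diff[OF f g], symmetric]
          ennreal_wnorm[OF f, symmetric] ennreal_wnorm[OF g, symmetric] ennreal_mult')
    then show ?thesis by (subst (asm) ennreal_inj) (auto simp: wnorm_def)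
  qed
  show young: "wnorm w D (\<lambda>x. f x + g x) \<le> (1 + t) * wnorm w D f + (1 + 1 / t) * wnorm w D g"
    if f: "f \<in> hol_space w D" and g: "g \<in> hol_space w D" and t: "0 < t" for f g t
  proof -
    have "ennreal (wnorm w D (\<lambda>x. f x + g x)) \<le> ennreal ((1 + t) * wnorm w D f + (1 + 1 / t) * wnorm w D g)"
      using sq_int_young[OF hol_spaceD(1)[OF f] hol_spaceD(1)[OF g] _ t, of "weight_on w D"] w Db t
      by (simp add: ennreal_wnorm[OF add[OF f g], symmetric]
          ennreal_wnorm[OF f, symmetric] ennreal_wnorm[OF g, symmetric] ennreal_mult')
    then show ?thesis using t by (subst (asm) ennreal_le_iff) (auto simp: wnorm_def)
  qed
  fix u :: "nat \<Rightarrow> 'a \<Rightarrow> complex"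
  assume u: "\<forall>k. u k \<in> hol_space w D" and fast: "\<forall>k. wnorm w D (\<lambda>x. u (Suc k) x - u k x) \<le> (1/16) ^ k"
  have "wnorm w D (\<lambda>y. u (k + j) y - u k y) \<le> 4 * (1/16) ^ k" for k j
  proof (induction j arbitrary: k)
    case 0
    then show ?case by (simp add: wnorm_def sq_int_def)
  next
    case (Suc j)
    have "wnorm w D (\<lambda>y. (u (Suc k) y - u k y) + (u (Suc k + j) y - u (Suc k) y))
        \<le> (1 + 1) * wnorm w D (\<lambda>y. u (Suc k) y - u k y) + (1 + 1 / 1) * wnorm w D (\<lambda>y. u (Suc k + j) y - u (Suc k) y)"
      by (rule young) (use u diff in auto)
    \<comment> \<open>Origin of the constants: 2 + 2 * 4/16 = 5/2 is at most 4, so the ratio 1/16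
      leaves room for the doubling in Young's inequality with t = 1.\<close>
    also have "\<dots> \<le> 2 * (1/16) ^ k + 2 * (4 * (1/16) ^ Suc k)"
      using Suc.IH[of "Suc k"] fast by (intro add_mono) auto
    also have "\<dots> \<le> 4 * (1/16) ^ k" by simp
    finally show ?case by simp
  qed
  then have "wnorm w D (\<lambda>y. u m y - u k y) \<le> 4 * (1/16) ^ k" if "k \<le> m" for k m
    using that by (metis le_add_diff_inverse)
  then show "\<exists>f\<in>hol_space w D. \<forall>k. wnorm w D (\<lambda>x. f x - u k x) \<le> 4 * (1/16) ^ k"
    using hol_space_complete[OF D c w] u by blast
qed

text \<open>Here local integrability of each single function becomes a norm inequality for all of
  them. A finite cover of K makes every v-norm over B finite, so the truncated v-norms are pointwise
  bounded functionals. Uniform boundedness bounds them jointly, and monotone convergence removes the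
  truncation.\<close>

lemma weight_comparison:
  assumes D: "open D" and c: "0 < c" "\<And>y. y \<in> D \<Longrightarrow> ennreal c \<le> w y"
    and w: "w \<in> borel_measurable borel" and v: "v \<in> borel_measurable borel"
    and K: "compact K" "K \<subseteq> D" and B: "B \<in> sets borel" "B \<subseteq> K"
    and loc: "\<And>f x. f \<in> hol_space w D \<Longrightarrow> x \<in> K \<Longrightarrow> \<exists>U. open U \<and> x \<in> U \<and> sq_int (weight_on v U) f < \<infinity>"
  obtains C where "0 \<le> C" "\<forall>f\<in>hol_space w D. sq_int (weight_on v B) f \<le> ennreal C * sq_int (weight_on w D) f"
proof -
  interpret quadratic_space "hol_space w D" "wnorm w D" by (rule quadratic_space_hol_space[OF D c w])
  have Db: "D \<in> sets borel" using D by simp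
  note [measurable] = w v Db B(1) hol_spaceD(1)
  \<comment> \<open>Truncation at k makes the functional bounded with the explicit factor k / c, as
    \<open>uniform_boundedness\<close> demands of each member of the family.\<close>
  define vk where "vk k y = inf (v y) (of_nat k)" for k :: nat and y
  have [measurable]: "vk k \<in> borel_measurable borel" for k unfolding vk_def inf_min by measurable
  define T where "T k f = enn2real (sq_int (weight_on (vk k) B) f)" for k f
  have fin: "sq_int (weight_on v B) f < \<infinity>" if f: "f \<in> hol_space w D" for f
  proof -
    note [measurable] = hol_spaceD(1)[OF f]
    have "\<forall>x\<in>K. \<exists>U. open U \<and> x \<in> U \<and> sq_int (weight_on v U) f < \<infinity>" using loc[OF f] by blast
    from bchoice[OF this] obtain U where U: "\<And>x. x \<in> K \<Longrightarrow> open (U x) \<and> x \<in> U x \<and> sq_int (weight_on v (U x)) f < \<infinity>" by blast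
    from compactE_image[OF K(1), of K U] U obtain S where S: "S \<subseteq> K" "finite S" "K \<subseteq> (\<Union>x\<in>S. U x)"
      by (metis UN_iff subsetI)
    have [measurable]: "x \<in> S \<Longrightarrow> U x \<in> sets borel" for x using U S(1) by auto
    have "sq_int (weight_on v B) f \<le> (\<integral>\<^sup>+y. (\<Sum>x\<in>S. ennreal ((cmod (f y))\<^sup>2) * weight_on v (U x) y) \<partial>dV)"
      unfolding sq_int_def
    proof (intro nn_integral_mono)
      fix y
      show "ennreal ((cmod (f y))\<^sup>2) * weight_on v B y \<le> (\<Sum>x\<in>S. ennreal ((cmod (f y))\<^sup>2) * weight_on v (U x) y)"
      proof (cases "y \<in> B")
        case True
        then obtain x where x: "x \<in> S" "y \<in> U x" using S(3) B(2) by blast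
        have "ennreal ((cmod (f y))\<^sup>2) * weight_on v (U x) y \<le> (\<Sum>x\<in>S. ennreal ((cmod (f y))\<^sup>2) * weight_on v (U x) y)"
          by (rule member_le_sum[OF x(1) _ S(2)]) simp
        then show ?thesis using x True by (simp add: weight_on_def)
      qed (simp add: weight_on_def)
    qed
    also have "\<dots> = (\<Sum>x\<in>S. sq_int (weight_on v (U x)) f)"
      unfolding sq_int_def by (rule nn_integral_sum) measurable
    also have "\<dots> < \<infinity>" using U S by (simp add: less_top[symmetric]) (metis subsetD)
    finally show ?thesis .
  qed
  have vle: "weight_on (vk k) B y \<le> weight_on v B y" for k y by (simp add: weight_on_def vk_def mult_right_mono)
  have Tfin: "sq_int (weight_on (vk k) B) f < \<infinity>" if "f \<in> hol_space w D" for k f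
    using fin[OF that] sq_int_mono[OF vle] by (rule le_less_trans[rotated])
  have eT: "ennreal (T k f) = sq_int (weight_on (vk k) B) f" if "f \<in> hol_space w D" for k f
    using Tfin[OF that] by (simp add: T_def)
  have Tnn: "0 \<le> T k f" for k f by (simp add: T_def)
  have "\<exists>C\<ge>0. \<forall>k. \<forall>f\<in>hol_space w D. T k f \<le> C * wnorm w D f"
  proof (rule uniform_boundedness)
    show "0 \<le> T k f" for k f by (simp add: T_def)
    show "T k (\<lambda>x. a * f x) = (cmod a)\<^sup>2 * T k f" if "f \<in> hol_space w D" for k f a
      using sq_int_scale[OF hol_spaceD(1)[OF that], of "weight_on (vk k) B" a] by (simp add: T_def enn2real_mult)
    show "T k (\<lambda>x. f x + g x) + T k (\<lambda>x. f x - g x) = 2 * T k f + 2 * T k g"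
      if f: "f \<in> hol_space w D" and g: "g \<in> hol_space w D" for k f g
    proof -
      have "ennreal (T k (\<lambda>x. f x + g x) + T k (\<lambda>x. f x - g x)) = ennreal (2 * T k f + 2 * T k g)"
        using sq_int_parallelogram[OF hol_spaceD(1)[OF f] hol_spaceD(1)[OF g], of "weight_on (vk k) B"]
        by (simp add: eT[OF add_mem[OF f g], symmetric] eT[OF diff_mem[OF f g], symmetric]
            eT[OF f, symmetric] eT[OF g, symmetric] ennreal_mult' Tnn)
      then show ?thesis by (subst (asm) ennreal_inj) (auto simp: T_def)
    qed
    show "\<exists>C. \<forall>f\<in>hol_space w D. T k f \<le> C * wnorm w D f" for k
    proof (intro exI[of _ "real k / c"] ballI)
      fix f assume f: "f \<in> hol_space w D"
      note [measurable] = hol_spaceD(1)[OF f]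
      have "sq_int (weight_on (vk k) B) f \<le> (\<integral>\<^sup>+y. ennreal (real k / c) * (ennreal ((cmod (f y))\<^sup>2) * weight_on w D y) \<partial>dV)"
        unfolding sq_int_def
      proof (intro nn_integral_mono)
        fix y
        show "ennreal ((cmod (f y))\<^sup>2) * weight_on (vk k) B y \<le> ennreal (real k / c) * (ennreal ((cmod (f y))\<^sup>2) * weight_on w D y)"
        proof (cases "y \<in> B")
          case True
          then have yD: "y \<in> D" using B K by auto
          have "vk k y \<le> of_nat k" by (simp add: vk_def)
          also have "\<dots> = ennreal (real k / c) * ennreal c"
            using c(1) by (simp add: ennreal_mult'[symmetric] ennreal_of_nat_eq_real_of_nat)
          also have "\<dots> \<le> ennreal (real k / c) * w y" using c(2)[OF yD] by (intro mult_left_mono) auto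
          finally have "ennreal ((cmod (f y))\<^sup>2) * vk k y \<le> ennreal ((cmod (f y))\<^sup>2) * (ennreal (real k / c) * w y)"
            by (rule mult_left_mono) simp
          then show ?thesis using True yD by (simp add: weight_on_def mult_ac)
        qed (simp add: weight_on_def)
      qed
      also have "\<dots> = ennreal (real k / c) * sq_int (weight_on w D) f"
        unfolding sq_int_def by (rule nn_integral_cmult) measurable
      also have "\<dots> = ennreal (real k / c * wnorm w D f)"
        using c(1) by (simp add: ennreal_wnorm[OF f, symmetric] ennreal_mult'[symmetric])
      finally have "ennreal (T k f) \<le> ennreal (real k / c * wnorm w D f)" by (simp add: eT[OF f])
      then show "T k f \<le> real k / c * wnorm w D f"
        using c(1) by (subst (asm) ennreal_le_iff) (auto simp: wnorm_def)
    qed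
    show "\<exists>M. \<forall>k. T k f \<le> M" if "f \<in> hol_space w D" for f
      using fin[OF that] sq_int_mono[OF vle]
      by (intro exI[of _ "enn2real (sq_int (weight_on v B) f)"]) (auto simp: T_def intro!: enn2real_mono)
  qed
  then obtain C where C: "0 \<le> C" "\<forall>k. \<forall>f\<in>hol_space w D. T k f \<le> C * wnorm w D f" by blast
  have "sq_int (weight_on v B) f \<le> ennreal C * sq_int (weight_on w D) f" if f: "f \<in> hol_space w D" for f
  proof -
    note [measurable] = hol_spaceD(1)[OF f]
    have sup: "(SUP k. vk k y) = v y" for y
    proof -
      have "(SUP k. vk k y) = inf (v y) (SUP k. of_nat k)" unfolding vk_def by (rule inf_SUP[symmetric])
      then show ?thesis by (simp add: ennreal_SUP_of_nat_eq_top)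
    qed
    have "sq_int (weight_on v B) f = (\<integral>\<^sup>+y. (SUP k. ennreal ((cmod (f y))\<^sup>2) * weight_on (vk k) B y) \<partial>dV)"
      unfolding sq_int_def weight_on_def
      by (intro nn_integral_cong) (simp add: SUP_mult_left_ennreal[symmetric] SUP_mult_right_ennreal[symmetric] sup)
    also have "\<dots> = (SUP k. sq_int (weight_on (vk k) B) f)"
      unfolding sq_int_def
    proof (rule nn_integral_monotone_convergence_SUP)
      show "incseq (\<lambda>k y. ennreal ((cmod (f y))\<^sup>2) * weight_on (vk k) B y)"
        by (auto simp: incseq_def le_fun_def weight_on_def vk_def intro!: mult_left_mono mult_right_mono inf_mono)
    qed measurable
    also have "\<dots> \<le> ennreal C * sq_int (weight_on w D) f"
    proof (rule SUP_least)
      fix k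
      have "ennreal (T k f) \<le> ennreal (C * wnorm w D f)" using C f by (intro ennreal_leI) blast
      then show "sq_int (weight_on (vk k) B) f \<le> ennreal C * sq_int (weight_on w D) f"
        using C(1) by (simp add: eT[OF f] ennreal_wnorm[OF f, symmetric] ennreal_mult')
    qed
    finally show ?thesis .
  qed
  with C(1) show ?thesis using that by blast
qed

end

section \<open>The kernel of a weighted space\<close>

text \<open>One factor N + 1 is absorbed by the bounded sequence (N + 1) * sqrt \<theta> ^ N, at the
  price of replacing \<theta> by its square root.\<close>

lemma summable_polynomial_times_geometric:
  fixes \<theta> :: real
  assumes "0 \<le> \<theta>" "\<theta> < 1"
  shows "summable (\<lambda>N. real (Suc N) ^ k * \<theta> ^ N)"
  using assms
proof (induction k arbitrary: \<theta>)
  case 0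
  then show ?case by (simp add: summable_geometric)
next
  case (Suc k)
  define \<phi> where "\<phi> = sqrt \<theta>"
  have \<phi>: "0 \<le> \<phi>" "\<phi> < 1" "\<phi> * \<phi> = \<theta>" using Suc.prems by (auto simp: \<phi>_def)
  have "(\<lambda>N. real N * \<phi> ^ N + \<phi> ^ N) \<longlonglongrightarrow> 0 + 0"
    using \<phi> by (intro tendsto_add powser_times_n_limit_0 LIMSEQ_power_zero) auto
  then have "Bseq (\<lambda>N. real N * \<phi> ^ N + \<phi> ^ N)" using convergentI convergent_imp_Bseq by blast
  then obtain B where B: "\<And>N. \<bar>real N * \<phi> ^ N + \<phi> ^ N\<bar> \<le> B" by (auto simp: Bseq_def)
  show ?case
  proof (rule summable_comparison_test')
    show "summable (\<lambda>N. B * (real (Suc N) ^ k * \<phi> ^ N))" by (intro summable_mult Suc.IH \<phi>)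
    fix N :: nat
    have "real (Suc N) ^ Suc k * \<theta> ^ N = (real N * \<phi> ^ N + \<phi> ^ N) * (real (Suc N) ^ k * \<phi> ^ N)"
      by (simp add: \<phi>(3)[symmetric] power_mult_distrib algebra_simps)
    also have "\<dots> \<le> B * (real (Suc N) ^ k * \<phi> ^ N)"
      using B[of N] \<phi>(1) by (intro mult_right_mono) auto
    finally show "norm (real (Suc N) ^ Suc k * \<theta> ^ N) \<le> B * (real (Suc N) ^ k * \<phi> ^ N)"
      using Suc.prems by simp
  qed
qed

lemma emeasure_polydisc_finite:
  assumes "finite I"
  shows "emeasure (\<Pi>\<^sub>M i\<in>I. lborel) (polydisc I a r) < \<infinity>"
proof -
  interpret product_sigma_finite "\<lambda>_. lborel :: complex measure" by standard
  have "emeasure (\<Pi>\<^sub>M i\<in>I. lborel) (polydisc I a r) = (\<Prod>i\<in>I. emeasure lborel (ball (a i) r))"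
    unfolding polydisc_def by (rule emeasure_PiM[OF assms]) auto
  also have "\<dots> < \<infinity>"
    using emeasure_lborel_ball_finite[where 'a = complex] by (simp add: less_top[symmetric] ennreal_prod_eq_top)
  finally show ?thesis .
qed

context volume_manifold
begin

lemma finite_measure_neighbourhood:
  obtains U where "open U" "x \<in> U" "emeasure dV U < \<infinity>"
proof -
  obtain V \<kappa> where c: "(V, \<kappa>) \<in> A" "x \<in> V" using chart_at .
  obtain U' C where U': "open U'" "x \<in> U'" "U' \<subseteq> V" and C: "0 < C"
    and le1: "\<forall>F B. (\<lambda>y. F y * indicator B y) \<in> borel_measurable borel \<longrightarrow> B \<in> sets borel \<longrightarrow> B \<subseteq> U' \<longrightarrow>
      (\<integral>\<^sup>+y\<in>B. F y \<partial>dV) \<le> ennreal C * (\<integral>\<^sup>+z\<in>\<kappa> ` B. F (inv_into V \<kappa> z) \<partial>Leb n)"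
    and le2: "\<forall>F B. (\<lambda>y. F y * indicator B y) \<in> borel_measurable borel \<longrightarrow> B \<in> sets borel \<longrightarrow> B \<subseteq> U' \<longrightarrow>
      (\<integral>\<^sup>+z\<in>\<kappa> ` B. F (inv_into V \<kappa> z) \<partial>Leb n) \<le> ennreal C * (\<integral>\<^sup>+y\<in>B. F y \<partial>dV)"
    using volume_comparable[OF c] .
  let ?P = "polydisc {..<n} (\<kappa> x) 1"
  define U where "U = U' \<inter> (V \<inter> \<kappa> -` ?P)"
  have U: "open U" unfolding U_def by (intro open_Int U' chart_preimage_open[OF c(1) open_in_Cn_polydisc])
  have xU: "x \<in> U" using c(2) U' open_in_Cn_subset[OF chart_image_open[OF c(1)]]
    by (auto simp: U_def intro!: center_mem_polydisc)
  have Ub: "U \<in> sets borel" using U by simp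
  have "emeasure dV U = (\<integral>\<^sup>+y\<in>U. 1 \<partial>dV)" using Ub by simp
  also have "\<dots> \<le> ennreal C * (\<integral>\<^sup>+z\<in>\<kappa> ` U. 1 \<partial>Leb n)"
    by (rule le1[rule_format]) (use Ub in \<open>auto simp: U_def intro: borel_measurable_indicator\<close>)
  also have "\<dots> \<le> ennreal C * (\<integral>\<^sup>+z. indicator ?P z \<partial>Leb n)"
    by (intro mult_left_mono nn_integral_mono) (auto simp: U_def indicator_def)
  also have "\<dots> = ennreal C * emeasure (Leb n) ?P"
    using open_in_Cn_polydisc[of n "\<kappa> x" 1]
    by (subst nn_integral_indicator) (auto intro!: borel_sets_Leb open_in_Cn_borel open_in_Cn_subset)
  also have "\<dots> < \<infinity>" using emeasure_polydisc_finite[of "{..<n}"] by (simp add: ennreal_mult_less_top)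
  finally show ?thesis using that U xU by blast
qed

text \<open>The orthonormal system is adapted to the grids with 1, 2, 3, \<dots> points per coordinate: the
  members at stage N vanish on the N-th grid, hence are of size about \<open>2 ^ - N\<close>, so that their
  w-norms over a smaller polydisc decay exponentially by \<open>w \<le> t v + t ^ - b\<close> with \<open>t\<close> exponentially
  small.\<close>

lemma exists_kernel:
  assumes w: "w \<in> borel_measurable borel" and v: "v \<in> borel_measurable borel"
    and O: "open O'" "x \<in> O'" "emeasure dV O' < \<infinity>" and c: "0 < c" "\<And>y. y \<in> O' \<Longrightarrow> ennreal c \<le> w y"
    and b: "0 < b" and interp: "\<And>y t. y \<in> O' \<Longrightarrow> 0 < t \<Longrightarrow> t \<le> 1 \<Longrightarrow> w y \<le> ennreal t * v y + ennreal (t powr (- b))"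
    and loc: "\<And>D f y. open D \<Longrightarrow> D \<subseteq> O' \<Longrightarrow> f \<in> hol_space w D \<Longrightarrow> y \<in> D \<Longrightarrow>
      \<exists>U. open U \<and> y \<in> U \<and> sq_int (weight_on v U) f < \<infinity>"
  obtains B D G where "open B" "open D" "x \<in> B" "B \<subseteq> D" "D \<subseteq> O'" "G \<in> borel_measurable borel"
    "(\<integral>\<^sup>+y\<in>B. G y * v y \<partial>dV) < \<infinity>"
    "\<forall>f\<in>hol_space w D. \<exists>C<\<infinity>. \<forall>y\<in>B. ennreal ((cmod (f y))\<^sup>2) \<le> C * G y"
proof -
  obtain V \<kappa> where ch: "(V, \<kappa>) \<in> A" "x \<in> V" using chart_at .
  define \<iota> where "\<iota> = inv_into V \<kappa>"
  define a where "a = \<kappa> x"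
  have "open_in_Cn n (\<kappa> ` (O' \<inter> V))"
    using O chart_open[OF ch(1)] by (intro chart_image_open_subset[OF ch(1)]) auto
  then obtain R where R: "0 < R" "cpolydisc {..<n} a R \<subseteq> \<kappa> ` (O' \<inter> V)"
    using open_in_Cn_contains_cpolydisc[of n "\<kappa> ` (O' \<inter> V)" a] O ch(2) unfolding a_def by blast
  \<comment> \<open>A quarter of R, so that the radius 2 \<rho> used by the interpolation bound
    stays below R.\<close>
  define \<rho> where "\<rho> = R / 4"
  have \<rho>: "0 < \<rho>" "2 * \<rho> < R" using R by (auto simp: \<rho>_def)
  define Dr where "Dr r = V \<inter> \<kappa> -` polydisc {..<n} a r" for r
  define Kr where "Kr r = \<iota> ` cpolydisc {..<n} a r" for r
  have sub: "cpolydisc {..<n} a r \<subseteq> \<kappa> ` (O' \<inter> V)" if "r \<le> R" for r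
    using cpolydisc_mono[OF that] R(2) by blast
  have inv: "\<iota> z \<in> V" "\<kappa> (\<iota> z) = z" "\<iota> z \<in> O'" if "z \<in> cpolydisc {..<n} a r" "r \<le> R" for z r
  proof -
    have z: "z \<in> \<kappa> ` (O' \<inter> V)" using sub[OF that(2)] that(1) by blast
    then have "z \<in> \<kappa> ` V" by blast
    then show "\<iota> z \<in> V" "\<kappa> (\<iota> z) = z" unfolding \<iota>_def by (simp_all add: chart_inv_mem[OF ch(1)] inv_chart[OF ch(1)])
    show "\<iota> z \<in> O'" using z chart_inv[OF ch(1)] by (auto simp: \<iota>_def)
  qed
  have oD: "open (Dr r)" for r
    unfolding Dr_def by (rule chart_preimage_open[OF ch(1) open_in_Cn_polydisc])
  have cK: "compact (Kr r)" if "r \<le> R" for r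
    unfolding Kr_def
  proof (rule compact_continuous_image[OF _ compact_cpolydisc])
    show "continuous_on (cpolydisc {..<n} a r) \<iota>"
      unfolding \<iota>_def by (rule continuous_on_subset[OF chart_inv_continuous[OF ch(1)]]) (use sub[OF that] in auto)
  qed
  have DK: "Dr r \<subseteq> Kr r" for r
  proof
    fix y assume y: "y \<in> Dr r"
    then have "\<iota> (\<kappa> y) = y" using chart_inv[OF ch(1)] by (auto simp: Dr_def \<iota>_def)
    moreover have "\<kappa> y \<in> cpolydisc {..<n} a r" using y polydisc_subset_cpolydisc by (auto simp: Dr_def)
    ultimately show "y \<in> Kr r" unfolding Kr_def by (metis imageI)
  qed
  have KD: "Kr r \<subseteq> Dr s" if "r < s" "r \<le> R" for r s
    using inv[OF _ that(2)] cpolydisc_subset_polydisc[OF that(1), of "{..<n}" a]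
    by (auto simp: Kr_def Dr_def)
  have DO: "Dr r \<subseteq> O'" if "r \<le> R" for r
    using DK[of r] inv[OF _ that] by (auto simp: Kr_def)
  have xD: "x \<in> Dr r" if "0 < r" for r
    using ch(2) that open_in_Cn_subset[OF chart_image_open[OF ch(1)]] by (auto simp: Dr_def a_def intro!: center_mem_polydisc)
  \<comment> \<open>\<open>D3\<close> carries the function space, on \<open>D2\<close> vanishing on
    grids forces decay, and over \<open>D1\<close> the kernel is shown to be integrable.\<close>
  define D3 where "D3 = Dr R"
  define D2 where "D2 = Dr \<rho>"
  define D1 where "D1 = Dr (\<rho> / 2)"
  have D3: "open D3" "D3 \<subseteq> O'" and D2: "open D2" "D2 \<subseteq> O'" "D2 \<subseteq> D3" and D1: "open D1" "D1 \<subseteq> D2"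
    using oD DO DK[of \<rho>] KD[of \<rho> R] DK[of "\<rho> / 2"] KD[of "\<rho> / 2" \<rho>] \<rho> by (auto simp: D3_def D2_def D1_def)
  have Db [measurable]: "D3 \<in> sets borel" "D2 \<in> sets borel" "D1 \<in> sets borel" using D3 D2 D1 by auto
  note [measurable] = w v hol_spaceD(1)
  let ?E = "hol_space w D3" and ?Q = "wnorm w D3"
  have c3: "\<And>y. y \<in> D3 \<Longrightarrow> ennreal c \<le> w y" using c D3 by blast
  interpret quadratic_space ?E ?Q by (rule quadratic_space_hol_space[OF D3(1) c(1) c3 w])
  obtain M2 where M2: "0 < M2" "\<forall>f\<in>?E. \<forall>y\<in>Kr (2 * \<rho>). (cmod (f y))\<^sup>2 \<le> M2 * ?Q f"
  proof (rule hol_space_sup_bound[OF D3(1) cK _ c(1) c3 w])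
    show "2 * \<rho> \<le> R" using \<rho> by simp
    show "Kr (2 * \<rho>) \<subseteq> D3" unfolding D3_def by (rule KD) (use \<rho> in auto)
  qed
  have K\<rho>: "Kr \<rho> \<subseteq> Kr (2 * \<rho>)" unfolding Kr_def by (intro image_mono cpolydisc_mono) (use \<rho> in simp)
  \<comment> \<open>The first comparison gives one bound, without any smallness, for the v-norms
    over \<open>D2\<close> of all members of the system.\<close>
  obtain Ca where Ca: "0 \<le> Ca" "\<forall>f\<in>hol_space w D3. sq_int (weight_on v D2) f \<le> ennreal Ca * sq_int (weight_on w D3) f"
  proof (rule weight_comparison[OF D3(1) c(1) c3 w v cK _ Db(2)])
    show "\<rho> \<le> R" using \<rho> by simp
    show "Kr \<rho> \<subseteq> D3" unfolding D3_def by (rule KD) (use \<rho> in auto)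
    show "D2 \<subseteq> Kr \<rho>" unfolding D2_def by (rule DK)
    show "\<exists>U. open U \<and> y \<in> U \<and> sq_int (weight_on v U) f < \<infinity>" if "f \<in> hol_space w D3" "y \<in> Kr \<rho>" for f y
      by (rule loc[OF D3 that(1)]) (use that(2) KD[of \<rho> R] \<rho> in \<open>auto simp: D3_def\<close>)
  qed
  have c2: "\<And>y. y \<in> D2 \<Longrightarrow> ennreal c \<le> w y" using c D2 by blast
  \<comment> \<open>The second comparison converts a small w-norm over \<open>D2\<close> into a
    small v-norm over \<open>D1\<close>.\<close>
  obtain Cb where Cb: "0 \<le> Cb" "\<forall>f\<in>hol_space w D2. sq_int (weight_on v D1) f \<le> ennreal Cb * sq_int (weight_on w D2) f"
  proof (rule weight_comparison[OF D2(1) c(1) c2 w v cK _ Db(3)])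
    show "\<rho> / 2 \<le> R" using \<rho> by simp
    show "Kr (\<rho> / 2) \<subseteq> D2" unfolding D2_def by (rule KD) (use \<rho> in auto)
    show "D1 \<subseteq> Kr (\<rho> / 2)" unfolding D1_def by (rule DK)
    show "\<exists>U. open U \<and> y \<in> U \<and> sq_int (weight_on v U) f < \<infinity>" if "f \<in> hol_space w D2" "y \<in> Kr (\<rho> / 2)" for f y
      by (rule loc[OF D2(1,2) that(1)]) (use that(2) KD[of "\<rho> / 2" \<rho>] \<rho> in \<open>auto simp: D2_def\<close>)
  qed
  \<comment> \<open>The shift by one starts with one point per coordinate. Vanishing on S (N - 1)
    thus means vanishing on the grid with N points per coordinate.\<close>
  define S where "S N = \<iota> ` grid n a \<rho> (Suc N)" for N
  have finS: "finite (S N)" for N unfolding S_def by (intro finite_imageI finite_grid)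
  have cardS: "card (S N) \<le> Suc N ^ n" for N
    unfolding S_def using card_image_le[OF finite_grid] card_grid order_trans by blast
  have SK: "S N \<subseteq> Kr (2 * \<rho>)" for N
    unfolding S_def using grid_subset[of \<rho> n a "Suc N"] \<rho> K\<rho> by (auto simp: Kr_def)
  have ev: "\<exists>C. \<forall>f\<in>?E. (cmod (f p))\<^sup>2 \<le> C * ?Q f" if "p \<in> S N" for N p
    using M2(2) SK that by blast
  obtain e where e: "\<And>N p. p \<in> S N \<Longrightarrow> e N p \<in> ?E" "\<And>N p. p \<in> S N \<Longrightarrow> ?Q (e N p) \<le> 1"
      "\<And>N p M q. p \<in> S N \<Longrightarrow> M < N \<Longrightarrow> q \<in> S M \<Longrightarrow> e N p q = 0"
    and expand: "\<And>f. f \<in> ?E \<Longrightarrow> \<exists>a r. \<forall>N. (\<Sum>M<N. \<Sum>p\<in>S M. (cmod (a M p))\<^sup>2) \<le> ?Q f \<and> r N \<in> ?E \<and> ?Q (r N) \<le> ?Q f \<and>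
        (\<forall>M<N. \<forall>q\<in>S M. r N q = 0) \<and> (\<forall>x. f x = (\<Sum>M<N. \<Sum>p\<in>S M. a M p * e M p x) + r N x)"
  proof (rule adapted_expansion[where S = S, OF quadratic_space_axioms finS ev])
    fix e
    assume "\<And>N p. p \<in> S N \<Longrightarrow> e N p \<in> ?E" "\<And>N p. p \<in> S N \<Longrightarrow> ?Q (e N p) \<le> 1"
      "\<And>N p M q. p \<in> S N \<Longrightarrow> M < N \<Longrightarrow> q \<in> S M \<Longrightarrow> e N p q = 0"
      "\<And>f. f \<in> ?E \<Longrightarrow> \<exists>a r. \<forall>N. (\<Sum>M<N. \<Sum>p\<in>S M. (cmod (a M p))\<^sup>2) \<le> ?Q f \<and> r N \<in> ?E \<and> ?Q (r N) \<le> ?Q f \<and>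
        (\<forall>M<N. \<forall>q\<in>S M. r N q = 0) \<and> (\<forall>x. f x = (\<Sum>M<N. \<Sum>p\<in>S M. a M p * e M p x) + r N x)"
    then show thesis by (rule that)
  qed
  define \<beta> where "\<beta> N = 4 * real n * real N ^ n * (1/2) ^ N" for N :: nat
  have decay: "cmod (f y) \<le> \<beta> N * m"
    if f: "f \<in> ?E" and m: "0 \<le> m" "M2 * ?Q f \<le> m\<^sup>2" and N: "N \<noteq> 0" and van: "\<And>q. q \<in> S (N - 1) \<Longrightarrow> f q = 0"
      and y: "y \<in> D2" for f m N y
  proof -
    let ?g = "\<lambda>z. f (inv_into V \<kappa> z)"
    have PV: "\<kappa> ` D3 = polydisc {..<n} a R"
      using R(2) polydisc_subset_cpolydisc[of "{..<n}" a R] by (auto simp: D3_def Dr_def)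
    have hol: "holomorphic_Cn n (polydisc {..<n} a R) ?g"
      using holomorphic_fun_chart[OF hol_spaceD(2)[OF f] ch(1), of D3] by (simp add: PV) (auto simp: D3_def Dr_def)
    have "cmod (?g (\<kappa> y)) \<le> 4 * real n * m * real N ^ n * (1/2) ^ N"
    proof (rule vanishing_on_grid_bound[OF hol \<rho>(2,1) _ N])
      fix z assume z: "z \<in> cpolydisc {..<n} a (2 * \<rho>)"
      have "(cmod (f (\<iota> z)))\<^sup>2 \<le> M2 * ?Q f" using M2(2) f z by (auto simp: Kr_def)
      also have "\<dots> \<le> m\<^sup>2" by (rule m)
      finally show "cmod (?g z) \<le> m" unfolding \<iota>_def by (rule power2_le_imp_le[OF _ m(1)])
    next
      fix z assume "z \<in> grid n a \<rho> N"
      then show "?g z = 0" using van[of "\<iota> z"] N by (auto simp: S_def \<iota>_def)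
    next
      show "\<kappa> y \<in> cpolydisc {..<n} a \<rho>" using y polydisc_subset_cpolydisc by (auto simp: D2_def Dr_def)
    qed
    moreover have "?g (\<kappa> y) = f y" using y chart_inv[OF ch(1)] by (auto simp: D2_def Dr_def)
    ultimately show ?thesis by (simp add: \<beta>_def mult_ac)
  qed
  define vol where "vol = enn2real (emeasure dV D2)"
  have vol: "emeasure dV D2 = ennreal vol" "0 \<le> vol"
    using le_less_trans[OF emeasure_mono[OF D2(2)] O(3)] O(1) by (auto simp: vol_def)
  \<comment> \<open>Chosen such that t = \<theta>^N gives t powr (- b) = 2^N. Squared sup norms
    decay like 4^(-N) up to a polynomial factor, so they still decay like 2^(-N) after
    multiplication by this.\<close>
  define \<theta> where "\<theta> = 2 powr (- 1 / b)"
  have \<theta>: "0 < \<theta>" "\<theta> < 1" using b by (auto simp: \<theta>_def powr_less_one)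
  have \<theta>p: "(\<theta> ^ N) powr (- b) = 2 ^ N" for N
  proof -
    have "(\<theta> ^ N) powr (- b) = (\<theta> powr (- b)) ^ N"
      using \<theta> by (simp add: powr_realpow[symmetric] powr_powr mult.commute)
    also have "\<theta> powr (- b) = 2" using b by (simp add: \<theta>_def powr_powr)
    finally show ?thesis .
  qed
  \<comment> \<open>The first summand comes from t * v and the first comparison, the second from t
    powr (- b) and the sup norm. At stage 0 nothing is known to vanish, and the plain sup bound
    replaces the decay.\<close>
  define q where "q N = Ca * \<theta> ^ N + 2 ^ N * (M2 * (if N = 0 then 1 else (\<beta> N)\<^sup>2)) * vol" for N
  have q0: "0 \<le> q N" for N using Ca M2 \<theta> vol(2) by (auto simp: q_def)
  have small: "sq_int (weight_on w D2) (e N p) \<le> ennreal (q N)" if p: "p \<in> S N" for N p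
  proof -
    note eE = e(1)[OF p]
    note [measurable] = hol_spaceD(1)[OF eE]
    let ?B = "M2 * (if N = 0 then 1 else (\<beta> N)\<^sup>2)"
    have B0: "0 \<le> ?B" using M2 by simp
    have pt: "(cmod (e N p y))\<^sup>2 \<le> ?B" if y: "y \<in> D2" for y
    proof (cases "N = 0")
      case True
      have "y \<in> Kr (2 * \<rho>)" using y DK[of \<rho>] K\<rho> by (auto simp: D2_def)
      then have "(cmod (e N p y))\<^sup>2 \<le> M2 * ?Q (e N p)" using M2(2) eE by blast
      also have "\<dots> \<le> M2 * 1" using M2(1) e(2)[OF p] by (intro mult_left_mono) auto
      finally show ?thesis using True by simp
    next
      case False
      have "cmod (e N p y) \<le> \<beta> N * sqrt M2"
      proof (rule decay[OF eE _ _ False _ y])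
        show "M2 * ?Q (e N p) \<le> (sqrt M2)\<^sup>2" using M2(1) e(2)[OF p] by (simp add: mult_left_le)
        show "e N p q = 0" if "q \<in> S (N - 1)" for q using e(3)[OF p _ that] False by simp
      qed (use M2 in simp)
      then have "(cmod (e N p y))\<^sup>2 \<le> (\<beta> N * sqrt M2)\<^sup>2" by (rule power_mono) simp
      then show ?thesis using M2(1) False by (simp add: power_mult_distrib mult.commute)
    qed
    have "sq_int (weight_on w D2) (e N p) \<le> (\<integral>\<^sup>+y. ennreal (\<theta> ^ N) * (ennreal ((cmod (e N p y))\<^sup>2) * weight_on v D2 y)
        + ennreal (2 ^ N * ?B) * indicator D2 y \<partial>dV)"
      unfolding sq_int_def
    proof (intro nn_integral_mono)
      fix y
      show "ennreal ((cmod (e N p y))\<^sup>2) * weight_on w D2 y \<le> ennreal (\<theta> ^ N) * (ennreal ((cmod (e N p y))\<^sup>2) * weight_on v D2 y)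
        + ennreal (2 ^ N * ?B) * indicator D2 y"
      proof (cases "y \<in> D2")
        case True
        then have "w y \<le> ennreal (\<theta> ^ N) * v y + ennreal ((\<theta> ^ N) powr (- b))"
          using D2(2) \<theta> by (intro interp) (auto simp: power_le_one)
        then have "ennreal ((cmod (e N p y))\<^sup>2) * w y
            \<le> ennreal ((cmod (e N p y))\<^sup>2) * (ennreal (\<theta> ^ N) * v y + ennreal (2 ^ N))"
          unfolding \<theta>p by (rule mult_left_mono) simp
        also have "\<dots> = ennreal (\<theta> ^ N) * (ennreal ((cmod (e N p y))\<^sup>2) * v y) + ennreal (2 ^ N * (cmod (e N p y))\<^sup>2)"
          by (simp add: distrib_left ennreal_mult' mult_ac)
        also have "\<dots> \<le> ennreal (\<theta> ^ N) * (ennreal ((cmod (e N p y))\<^sup>2) * v y) + ennreal (2 ^ N * ?B)"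
          using pt[OF True] by (intro add_left_mono ennreal_leI mult_left_mono) auto
        finally show ?thesis using True by (simp add: weight_on_def)
      qed (simp add: weight_on_def)
    qed
    also have "\<dots> = ennreal (\<theta> ^ N) * sq_int (weight_on v D2) (e N p) + ennreal (2 ^ N * ?B) * emeasure dV D2"
      unfolding sq_int_def by (subst nn_integral_add) (auto simp: nn_integral_cmult nn_integral_cmult_indicator)
    also have "\<dots> \<le> ennreal (\<theta> ^ N) * (ennreal Ca * 1) + ennreal (2 ^ N * ?B) * ennreal vol"
    proof (intro add_mono mult_left_mono)
      have "sq_int (weight_on v D2) (e N p) \<le> ennreal Ca * sq_int (weight_on w D3) (e N p)" using Ca(2) eE by blast
      also have "sq_int (weight_on w D3) (e N p) \<le> 1"
        using ennreal_leI[OF e(2)[OF p]] by (simp add: ennreal_wnorm[OF eE])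
      then have "ennreal Ca * sq_int (weight_on w D3) (e N p) \<le> ennreal Ca * 1" by (rule mult_left_mono) simp
      finally show "sq_int (weight_on v D2) (e N p) \<le> ennreal Ca * 1" .
    qed (use vol in auto)
    also have "\<dots> = ennreal (q N)"
      using Ca(1) B0 \<theta> vol(2) unfolding q_def
      by (simp add: ennreal_plus[symmetric] ennreal_mult'[symmetric] mult.commute del: ennreal_plus)
    finally show ?thesis .
  qed
  define G where "G y = (\<Sum>N. \<Sum>p\<in>S N. ennreal ((cmod (e N p y))\<^sup>2))" for y
  have em: "(\<lambda>y. \<Sum>p\<in>S N. ennreal ((cmod (e N p y))\<^sup>2)) \<in> borel_measurable borel" for N
  proof (rule borel_measurable_sum)
    fix p assume "p \<in> S N"
    from hol_spaceD(1)[OF e(1)[OF this]] show "(\<lambda>y. ennreal ((cmod (e N p y))\<^sup>2)) \<in> borel_measurable borel" by measurable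
  qed
  have Gm: "G \<in> borel_measurable borel" unfolding G_def by (rule borel_measurable_suminf_order) (rule em)
  have sq: "summable (\<lambda>N. real (Suc N) ^ n * q N)"
  proof -
    have s1: "summable (\<lambda>N. Ca * (real (Suc N) ^ n * \<theta> ^ N))"
      using \<theta> by (intro summable_mult summable_polynomial_times_geometric) auto
    have s2: "summable (\<lambda>N. real (Suc N) ^ n * (2 ^ N * (M2 * (if N = 0 then 1 else (\<beta> N)\<^sup>2)) * vol))"
    proof (rule summable_comparison_test')
      \<comment> \<open>Of the exponent 3 n, one n accounts for the number of grid points and 2 n
        for the square of \<beta> N.\<close>
      show "summable (\<lambda>N. 16 * (real n)\<^sup>2 * M2 * vol * (real (Suc N) ^ (3 * n) * (1/2) ^ N))"
        by (intro summable_mult summable_polynomial_times_geometric) auto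
      fix N :: nat assume "1 \<le> N"
      then have N: "N \<noteq> 0" by simp
      have "2 ^ N * (\<beta> N)\<^sup>2 = 16 * (real n)\<^sup>2 * (real N ^ n)\<^sup>2 * (1/2) ^ N"
      proof -
        define h :: real where "h = (1/2) ^ N"
        have h: "2 ^ N * (h * h) = h"
          unfolding h_def by (simp add: mult.assoc[symmetric] power_mult_distrib[symmetric])
        have "2 ^ N * (\<beta> N)\<^sup>2 = 16 * (real n)\<^sup>2 * (real N ^ n)\<^sup>2 * (2 ^ N * (h * h))"
          unfolding \<beta>_def h_def[symmetric] by (simp add: power2_eq_square mult_ac)
        then show ?thesis unfolding h by (simp only: h_def)
      qed
      also have "\<dots> \<le> 16 * (real n)\<^sup>2 * (real (Suc N) ^ n)\<^sup>2 * (1/2) ^ N"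
        by (intro mult_right_mono mult_left_mono power_mono) auto
      finally have "real (Suc N) ^ n * (2 ^ N * (\<beta> N)\<^sup>2) * (M2 * vol)
          \<le> real (Suc N) ^ n * (16 * (real n)\<^sup>2 * (real (Suc N) ^ n)\<^sup>2 * (1/2) ^ N) * (M2 * vol)"
        using M2 vol by (intro mult_right_mono mult_left_mono) auto
      also have "\<dots> = 16 * (real n)\<^sup>2 * M2 * vol * (real (Suc N) ^ (3 * n) * (1/2) ^ N)"
        by (simp add: power_mult power3_eq_cube power2_eq_square mult.commute[of 3 n] mult_ac del: of_nat_Suc)
      finally show "norm (real (Suc N) ^ n * (2 ^ N * (M2 * (if N = 0 then 1 else (\<beta> N)\<^sup>2)) * vol))
          \<le> 16 * (real n)\<^sup>2 * M2 * vol * (real (Suc N) ^ (3 * n) * (1/2) ^ N)"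
        using N M2 vol by (simp add: abs_mult mult_ac del: of_nat_Suc)
    qed
    show ?thesis using summable_add[OF s1 s2] by (simp add: q_def algebra_simps del: of_nat_Suc)
  qed
  have GI: "(\<integral>\<^sup>+y\<in>D1. G y * v y \<partial>dV) < \<infinity>"
  proof -
    have "(\<integral>\<^sup>+y\<in>D1. G y * v y \<partial>dV) = (\<integral>\<^sup>+y. (\<Sum>N. (\<Sum>p\<in>S N. ennreal ((cmod (e N p y))\<^sup>2)) * weight_on v D1 y) \<partial>dV)"
      unfolding G_def weight_on_def by (simp add: ennreal_suminf_multc mult.assoc)
    also have "\<dots> = (\<Sum>N. \<integral>\<^sup>+y. (\<Sum>p\<in>S N. ennreal ((cmod (e N p y))\<^sup>2)) * weight_on v D1 y \<partial>dV)"
      by (rule nn_integral_suminf) (use em in measurable)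
    also have "\<dots> \<le> (\<Sum>N. ennreal (Cb * (real (Suc N) ^ n * q N)))"
    proof (rule suminf_le)
      fix N
      have "(\<integral>\<^sup>+y. (\<Sum>p\<in>S N. ennreal ((cmod (e N p y))\<^sup>2)) * weight_on v D1 y \<partial>dV) = (\<Sum>p\<in>S N. sq_int (weight_on v D1) (e N p))"
        unfolding sq_int_def sum_distrib_right
      proof (rule nn_integral_sum)
        fix p assume "p \<in> S N"
        note [measurable] = hol_spaceD(1)[OF e(1)[OF this]]
        show "(\<lambda>y. ennreal ((cmod (e N p y))\<^sup>2) * weight_on v D1 y) \<in> borel_measurable dV" by measurable
      qed
      also have "\<dots> \<le> (\<Sum>p\<in>S N. ennreal (Cb * q N))"
      proof (rule sum_mono)
        fix p assume p: "p \<in> S N"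
        have "e N p \<in> hol_space w D2" using e(1)[OF p] hol_space_subset[OF D2(3)] by blast
        then have "sq_int (weight_on v D1) (e N p) \<le> ennreal Cb * sq_int (weight_on w D2) (e N p)" using Cb(2) by blast
        also have "\<dots> \<le> ennreal Cb * ennreal (q N)" by (intro mult_left_mono small p) simp
        finally show "sq_int (weight_on v D1) (e N p) \<le> ennreal (Cb * q N)" using Cb(1) q0 by (simp add: ennreal_mult')
      qed
      also have "\<dots> = ennreal (real (card (S N)) * (Cb * q N))"
        using Cb(1) q0 by (simp add: ennreal_mult' ennreal_of_nat_eq_real_of_nat)
      also have "\<dots> \<le> ennreal (real (Suc N) ^ n * (Cb * q N))"
      proof (intro ennreal_leI mult_right_mono)
        show "real (card (S N)) \<le> real (Suc N) ^ n" using cardS[of N] by (simp only: of_nat_power[symmetric] of_nat_le_iff)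
      qed (use Cb q0 in auto)
      finally show "(\<integral>\<^sup>+y. (\<Sum>p\<in>S N. ennreal ((cmod (e N p y))\<^sup>2)) * weight_on v D1 y \<partial>dV) \<le> ennreal (Cb * (real (Suc N) ^ n * q N))"
        by (simp add: mult_ac)
    qed auto
    also have "\<dots> < \<infinity>"
      using Cb(1) q0 summable_mult[OF sq, of Cb] by (subst suminf_ennreal2) auto
    finally show ?thesis .
  qed
  have \<beta>0: "(\<lambda>N. \<beta> (Suc N) * m) \<longlonglongrightarrow> 0" for m
  proof -
    have "(\<lambda>N. (4 * real n * (1/2) * m) * (real (Suc N) ^ n * (1/2) ^ N)) \<longlonglongrightarrow> (4 * real n * (1/2) * m) * 0"
      by (intro tendsto_intros summable_LIMSEQ_zero summable_polynomial_times_geometric) auto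
    then show ?thesis by (simp add: \<beta>_def mult_ac del: of_nat_Suc)
  qed
  have Gbound: "\<exists>C<\<infinity>. \<forall>y\<in>D1. ennreal ((cmod (f y))\<^sup>2) \<le> C * G y" if f: "f \<in> ?E" for f
  \<comment> \<open>The summand 1 is for points with infinite G: if Q f = 0, the product 0 *
    infinity would be 0.\<close>
  proof (intro exI[of _ "ennreal (?Q f + 1)"] conjI ballI)
    show "ennreal (?Q f + 1) < \<infinity>" by simp
    fix y assume y: "y \<in> D1"
    obtain a r where ar: "\<And>N. (\<Sum>M<N. \<Sum>p\<in>S M. (cmod (a M p))\<^sup>2) \<le> ?Q f" "\<And>N. r N \<in> ?E" "\<And>N. ?Q (r N) \<le> ?Q f"
        "\<And>N M q. M < N \<Longrightarrow> q \<in> S M \<Longrightarrow> r N q = 0"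
        "\<And>N x. f x = (\<Sum>M<N. \<Sum>p\<in>S M. a M p * e M p x) + r N x"
      using expand[OF f] by blast
    have Q1: "0 < ?Q f + 1" by (simp add: add_nonneg_pos)
    show "ennreal ((cmod (f y))\<^sup>2) \<le> ennreal (?Q f + 1) * G y"
    proof (cases "G y = \<infinity>")
      case True
      then show ?thesis using Q1 by (simp add: ennreal_mult_top)
    next
      case False
      then obtain g where g: "G y = ennreal g" "0 \<le> g" by (cases "G y") auto
      have part: "(\<Sum>M<N. \<Sum>p\<in>S M. (cmod (e M p y))\<^sup>2) \<le> g" for N
      proof -
        have "ennreal (\<Sum>M<N. \<Sum>p\<in>S M. (cmod (e M p y))\<^sup>2) = (\<Sum>M<N. \<Sum>p\<in>S M. ennreal ((cmod (e M p y))\<^sup>2))"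
          by (simp add: sum_nonneg)
        also have "\<dots> \<le> G y" unfolding G_def by (rule sum_le_suminf) auto
        finally show ?thesis using g by (simp add: ennreal_le_iff)
      qed
      \<comment> \<open>Cauchy-Schwarz and Bessel's inequality bound the partial sum. The remainder
        vanishes on the last grid used, so it is subject to the same decay as the system.\<close>
      have "cmod (f y) \<le> sqrt (?Q f) * sqrt g + \<beta> (Suc N) * sqrt (M2 * ?Q f)" for N
      proof -
        let ?I = "Sigma {..<Suc N} S"
        have sg: "(\<Sum>M<Suc N. \<Sum>p\<in>S M. h M p) = (\<Sum>i\<in>?I. h (fst i) (snd i))" for h :: "nat \<Rightarrow> 'a \<Rightarrow> 'b::comm_monoid_add"
          by (subst sum.Sigma) (use finS in \<open>auto simp: split_beta\<close>)
        have "cmod (\<Sum>M<Suc N. \<Sum>p\<in>S M. a M p * e M p y) \<le> (\<Sum>i\<in>?I. cmod (a (fst i) (snd i)) * cmod (e (fst i) (snd i) y))"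
          unfolding sg by (rule sum_norm_le) (simp add: norm_mult)
        also have "\<dots> \<le> sqrt (\<Sum>i\<in>?I. (cmod (a (fst i) (snd i)))\<^sup>2) * sqrt (\<Sum>i\<in>?I. (cmod (e (fst i) (snd i) y))\<^sup>2)"
          using L2_set_mult_ineq[of "\<lambda>i. cmod (a (fst i) (snd i))" "\<lambda>i. cmod (e (fst i) (snd i) y)" ?I]
          by (simp add: L2_set_def)
        also have "\<dots> \<le> sqrt (?Q f) * sqrt g"
          using ar(1)[of "Suc N"] part[of "Suc N"] unfolding sg
          by (intro mult_mono real_sqrt_le_mono) (auto simp: g sum_nonneg)
        finally have 1: "cmod (\<Sum>M<Suc N. \<Sum>p\<in>S M. a M p * e M p y) \<le> sqrt (?Q f) * sqrt g" .
        have 2: "cmod (r (Suc N) y) \<le> \<beta> (Suc N) * sqrt (M2 * ?Q f)"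
        proof (rule decay[OF ar(2)])
          show "M2 * ?Q (r (Suc N)) \<le> (sqrt (M2 * ?Q f))\<^sup>2" using M2(1) ar(3) by (simp add: mult_left_mono)
          show "r (Suc N) q = 0" if "q \<in> S (Suc N - 1)" for q using ar(4)[of N "Suc N" q] that by simp
        qed (use M2 y D1 in auto)
        show ?thesis
          unfolding ar(5)[of y "Suc N"] using norm_triangle_ineq 1 2 add_mono order_trans by blast
      qed
      moreover have "(\<lambda>N. sqrt (?Q f) * sqrt g + \<beta> (Suc N) * sqrt (M2 * ?Q f)) \<longlonglongrightarrow> sqrt (?Q f) * sqrt g + 0"
        by (intro tendsto_add tendsto_const \<beta>0)
      ultimately have "cmod (f y) \<le> sqrt (?Q f) * sqrt g + 0" by (intro LIMSEQ_le_const) auto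
      then have "(cmod (f y))\<^sup>2 \<le> (sqrt (?Q f) * sqrt g)\<^sup>2" by (intro power_mono) auto
      also have "\<dots> = ?Q f * g" using g by (simp add: power_mult_distrib)
      also have "\<dots> \<le> (?Q f + 1) * g" using g by (intro mult_right_mono) auto
      finally have "ennreal ((cmod (f y))\<^sup>2) \<le> ennreal ((?Q f + 1) * g)" by (rule ennreal_leI)
      also have "\<dots> = ennreal (?Q f + 1) * ennreal g" by (rule ennreal_mult) (use g Q1 in auto)
      finally show ?thesis unfolding g(1) .
    qed
  qed
  show ?thesis
  proof (rule that[OF D1(1) D3(1) _ _ D3(2) Gm GI])
    show "x \<in> D1" unfolding D1_def using \<rho> by (intro xD) auto
    show "D1 \<subseteq> D3" using D1 D2 by blast
  qed (use Gbound in blast)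
qed

end

section \<open>Weights and their powers\<close>

lemma measurable_exp_ext [measurable (raw)]:
  assumes [measurable]: "f \<in> borel_measurable M"
  shows "(\<lambda>x. exp_ext (f x)) \<in> borel_measurable M"
proof -
  have "exp_ext e = (if e = \<infinity> then \<infinity> else if e = -\<infinity> then 0 else ennreal (exp (real_of_ereal e)))" for e
    by (cases e) (auto simp: exp_ext_def)
  then show ?thesis by simp
qed

lemma exp_ext_ge: "\<phi> \<le> ereal M \<Longrightarrow> ennreal (exp (- 2 * M)) \<le> exp_ext (- 2 * \<phi>)"
  by (cases \<phi>) (auto simp: exp_ext_def intro!: ennreal_leI)

text \<open>Raising the exponent lowers the weight only where \<phi> is positive, and there by a
  factor bounded in terms of the upper bound M. At poles both sides are infinite.\<close>

lemma exp_ext_mono_exponent: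
  assumes "\<phi> \<le> ereal M" "0 \<le> \<sigma>" "\<sigma> \<le> \<tau>" "\<tau> \<le> S"
  shows "exp_ext (- 2 * ereal (1 + \<sigma>) * \<phi>) \<le> ennreal (exp (2 * S * \<bar>M\<bar>)) * exp_ext (- 2 * (ereal (1 + \<tau>) * \<phi>))"
proof (cases \<phi>)
  case (real r)
  have "(\<tau> - \<sigma>) * r \<le> (\<tau> - \<sigma>) * \<bar>M\<bar>" using assms real by (intro mult_left_mono) auto
  also have "\<dots> \<le> S * \<bar>M\<bar>" using assms by (intro mult_right_mono) auto
  finally have "- 2 * (1 + \<sigma>) * r \<le> 2 * S * \<bar>M\<bar> + - 2 * ((1 + \<tau>) * r)" by (simp add: algebra_simps)
  then have "exp (- 2 * (1 + \<sigma>) * r) \<le> exp (2 * S * \<bar>M\<bar>) * exp (- 2 * ((1 + \<tau>) * r))"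
    by (simp add: exp_add[symmetric])
  then show ?thesis using real by (simp add: exp_ext_def ennreal_mult'[symmetric] ennreal_leI)
next
  case MInf
  have "0 < 1 + \<tau>" using assms by simp
  then have "ereal (1 + \<tau>) * \<phi> = -\<infinity>" using MInf by simp
  then have eq: "- 2 * (ereal (1 + \<tau>) * \<phi>) = \<infinity>" by simp
  show ?thesis unfolding eq by (simp add: exp_ext_def ennreal_mult_top)
qed (use assms in auto)

text \<open>For s = exp (- 2 \<phi>) the threshold is t powr (- 1 / \<beta>): below it the second
  term suffices, above it t * s powr \<sigma> >= 1. The lower bound \<beta> of \<sigma> makes the
  power of t uniform on a neighbourhood, although the exponent of the weight varies.\<close>

lemma exp_ext_interpolation:
  assumes \<phi>: "\<phi> < \<infinity>" and \<beta>: "0 < \<beta>" "\<beta> \<le> \<sigma>" and t: "0 < t" "t \<le> 1"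
  shows "exp_ext (- 2 * \<phi>) \<le> ennreal t * exp_ext (- 2 * (ereal (1 + \<sigma>) * \<phi>)) + ennreal (t powr (- (1 / \<beta>)))"
proof (cases \<phi>)
  case (real r)
  define s where "s = exp (- 2 * r)"
  have s: "0 < s" by (simp add: s_def)
  have sp: "exp (- 2 * ((1 + \<sigma>) * r)) = s powr (1 + \<sigma>)" by (simp add: s_def powr_def algebra_simps)
  have "s \<le> t * s powr (1 + \<sigma>) + t powr (- (1 / \<beta>))"
  proof (cases "s \<le> t powr (- (1 / \<beta>))")
    case True
    then show ?thesis using t s by (simp add: add_increasing)
  next
    case False
    have "1 = 1 powr (- (1 / \<beta>))" by simp
    also have "\<dots> \<le> t powr (- (1 / \<beta>))" using t \<beta> by (intro powr_mono2') auto
    finally have s1: "1 \<le> s" using False by simp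
    have "(t powr (- (1 / \<beta>))) powr \<beta> = t powr (- 1)" unfolding powr_powr using \<beta> by simp
    then have "1 / t = (t powr (- (1 / \<beta>))) powr \<beta>" using t by (simp add: powr_minus_divide)
    also have "\<dots> \<le> s powr \<beta>" using False \<beta> by (intro powr_mono2) auto
    also have "\<dots> \<le> s powr \<sigma>" using s1 \<beta> by (intro powr_mono) auto
    finally have "1 \<le> t * s powr \<sigma>" using t by (simp add: field_simps)
    then have "s * 1 \<le> s * (t * s powr \<sigma>)" using s by (intro mult_left_mono) auto
    also have "\<dots> = t * s powr (1 + \<sigma>)" using s by (simp add: powr_add)
    finally show ?thesis by (simp add: add_increasing2)
  qed
  then have "ennreal s \<le> ennreal (t * s powr (1 + \<sigma>) + t powr (- (1 / \<beta>)))" by (rule ennreal_leI)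
  then show ?thesis using real t sp by (simp add: exp_ext_def ennreal_mult' s_def)
next
  case MInf
  have "0 < 1 + \<sigma>" using \<beta> by simp
  then have "ereal (1 + \<sigma>) * \<phi> = -\<infinity>" using MInf by simp
  then have eq: "- 2 * (ereal (1 + \<sigma>) * \<phi>) = \<infinity>" by simp
  show ?thesis unfolding eq using t by (simp add: exp_ext_def ennreal_mult_top)
qed (use \<phi> in auto)

text \<open>A variable exponent e is traded for the fixed p. The base max 1 T makes the remaining
  power, whose exponent 2 (p - e) is nonnegative, monotone in that exponent.\<close>

lemma powr_bounded_exponent:
  fixes t :: real
  assumes "0 < t" "t \<le> T" "- S \<le> e" "e \<le> p"
  shows "t powr (- 2 * e) \<le> (max 1 T) powr (2 * (p + S)) * t powr (- 2 * p)"
proof -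
  have "t powr (- 2 * e) = t powr (2 * (p - e)) * t powr (- 2 * p)"
    by (simp add: powr_add[symmetric] algebra_simps)
  also have "t powr (2 * (p - e)) \<le> max 1 T powr (2 * (p - e))" using assms by (intro powr_mono2) auto
  also have "\<dots> \<le> max 1 T powr (2 * (p + S))" using assms by (intro powr_mono) auto
  finally show ?thesis by (simp add: mult_right_mono)
qed

text \<open>At t = 0 the right side is infinite, so zeros of the section are covered by the same
  inequality.\<close>

lemma inverse_pow_ext_bound:
  assumes "0 \<le> t" "t \<le> T" "- S \<le> e" "e \<le> p" "0 < p"
  shows "inverse (pow_ext t (2 * e)) \<le> ennreal ((max 1 T) powr (2 * (p + S))) * pow_ext t (- 2 * p)"
proof (cases "t = 0")
  case True
  have "max 1 T \<noteq> 0" by (simp add: max_def)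
  then show ?thesis using True assms by (simp add: pow_ext_def ennreal_mult_top)
next
  case False
  then have t: "0 < t" using assms by simp
  then have "inverse (pow_ext t (2 * e)) = ennreal (t powr (- 2 * e))"
    by (simp add: pow_ext_def inverse_ennreal powr_minus)
  then show ?thesis using powr_bounded_exponent[OF t assms(2-4)] t
    by (simp add: pow_ext_def ennreal_mult'[symmetric] ennreal_leI)
qed

text \<open>Young's inequality \<open>b \<le> a b\<^sup>1\<^sup>+\<^sup>\<sigma> + a powr (- 1 / \<sigma>)\<close> with \<open>a = t powr (2 (\<epsilon> - 1))\<close>.\<close>

lemma exp_ext_young:
  assumes \<phi>: "\<phi> < \<infinity>" and \<sigma>: "0 < \<sigma>" and t: "0 \<le> t" "t \<le> T"
    and e: "- S \<le> (\<epsilon> - 1) / \<sigma>" "(\<epsilon> - 1) / \<sigma> \<le> p" and p: "0 < p"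
  shows "exp_ext (- 2 * \<phi>) \<le> inverse (pow_ext t (2 * (1 - \<epsilon>))) * exp_ext (- 2 * ereal (1 + \<sigma>) * \<phi>)
    + ennreal ((max 1 T) powr (2 * (p + S))) * pow_ext t (- 2 * p)"
proof (cases "t = 0")
  case True
  have "max 1 T \<noteq> 0" by (simp add: max_def)
  then show ?thesis using True p by (simp add: pow_ext_def ennreal_mult_top)
next
  case False
  then have t0: "0 < t" using t by simp
  define a where "a = t powr (2 * (\<epsilon> - 1))"
  have a: "0 < a" using t0 by (simp add: a_def)
  have ia: "inverse (pow_ext t (2 * (1 - \<epsilon>))) = ennreal a"
    using t0 by (simp add: pow_ext_def inverse_ennreal a_def powr_minus[symmetric] algebra_simps)
  have K: "a powr (- 1 / \<sigma>) \<le> (max 1 T) powr (2 * (p + S)) * t powr (- 2 * p)"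
  proof -
    have "2 * (\<epsilon> - 1) * (- 1 / \<sigma>) = - 2 * ((\<epsilon> - 1) / \<sigma>)" using \<sigma> by (simp add: field_simps)
    then have "a powr (- 1 / \<sigma>) = t powr (- 2 * ((\<epsilon> - 1) / \<sigma>))" by (simp only: a_def powr_powr)
    then show ?thesis using powr_bounded_exponent[OF t0 t(2) e] by (simp only:)
  qed
  show ?thesis
  proof (cases \<phi>)
    case (real r)
    define s where "s = exp (- 2 * r)"
    have s: "0 < s" by (simp add: s_def)
    have sp: "exp (- 2 * (1 + \<sigma>) * r) = s powr (1 + \<sigma>)" by (simp add: s_def powr_def algebra_simps)
    have "s \<le> a * s powr (1 + \<sigma>) + a powr (- 1 / \<sigma>)"
    proof (cases "1 \<le> a * s powr \<sigma>")
      case True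
      then have "s * 1 \<le> s * (a * s powr \<sigma>)" using s by (intro mult_left_mono) auto
      also have "\<dots> = a * s powr (1 + \<sigma>)" using s by (simp add: powr_add)
      finally show ?thesis by (simp add: add_increasing2)
    next
      case False
      then have "s powr \<sigma> \<le> a powr (- 1)" using a by (simp add: powr_minus_divide field_simps)
      then have "(s powr \<sigma>) powr (1 / \<sigma>) \<le> (a powr (- 1)) powr (1 / \<sigma>)" using \<sigma> by (intro powr_mono2) auto
      moreover have "(s powr \<sigma>) powr (1 / \<sigma>) = s" using \<sigma> s by (simp add: powr_powr)
      moreover have "(a powr (- 1)) powr (1 / \<sigma>) = a powr (- 1 / \<sigma>)" unfolding powr_powr by simp
      ultimately have "s \<le> a powr (- 1 / \<sigma>)" by (simp only:)
      then show ?thesis using a s by (simp add: add_increasing)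
    qed
    also have "\<dots> \<le> a * s powr (1 + \<sigma>) + (max 1 T) powr (2 * (p + S)) * t powr (- 2 * p)" using K by simp
    finally have "ennreal s \<le> ennreal (a * s powr (1 + \<sigma>) + (max 1 T) powr (2 * (p + S)) * t powr (- 2 * p))"
      by (rule ennreal_leI)
    then show ?thesis using real a t0 sp ia by (simp add: exp_ext_def ennreal_mult' s_def pow_ext_def)
  next
    case MInf
    have eq: "- 2 * ereal (1 + \<sigma>) * \<phi> = \<infinity>" using MInf \<sigma> by simp
    show ?thesis unfolding eq ia using a by (simp add: exp_ext_def ennreal_mult_top)
  qed (use \<phi> in auto)
qed

text \<open>Upper semicontinuity of the plurisubharmonic part and continuity of the smooth part add
  up to upper semicontinuity of \<phi>. This is the source of its measurability and of its local
  upper bounds.\<close>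

lemma (in volume_manifold) quasi_psh_open_sublevel:
  assumes \<phi>: "quasi_psh n A \<phi>"
  shows "open {y. \<phi> y < c}" and "\<phi> x < \<infinity>"
proof -
  have loc: "\<exists>V \<kappa> U u g. (V, \<kappa>) \<in> A \<and> open U \<and> x \<in> U \<and> U \<subseteq> V \<and>
      psh_Cn n (\<kappa> ` U) u \<and> smooth_Cn n (\<kappa> ` U) g \<and> (\<forall>y\<in>U. \<phi> y = u (\<kappa> y) + ereal (g (\<kappa> y)))" for x
    using \<phi> unfolding quasi_psh_def by fast
  show "\<phi> x < \<infinity>"
  proof -
    obtain V \<kappa> U u g where "x \<in> U" "psh_Cn n (\<kappa> ` U) u" "\<forall>y\<in>U. \<phi> y = u (\<kappa> y) + ereal (g (\<kappa> y))"
      using loc[of x] by blast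
    then show ?thesis by (auto simp: psh_Cn_def)
  qed
  show "open {y. \<phi> y < c}"
  proof (subst open_subopen, intro ballI)
    fix x assume "x \<in> {y. \<phi> y < c}"
    then have x: "\<phi> x < c" by simp
    obtain V \<kappa> U u g where ch: "(V, \<kappa>) \<in> A" and U: "open U" "x \<in> U" "U \<subseteq> V"
      and u: "psh_Cn n (\<kappa> ` U) u" and g: "smooth_Cn n (\<kappa> ` U) g" and eq: "\<forall>y\<in>U. \<phi> y = u (\<kappa> y) + ereal (g (\<kappa> y))"
      using loc[of x] by blast
    have ux: "u (\<kappa> x) < \<infinity>" using u U by (auto simp: psh_Cn_def)
    have "u (\<kappa> x) < c - ereal (g (\<kappa> x))" using x eq U ux by (cases "u (\<kappa> x)"; cases c) auto
    \<comment> \<open>The strict inequality is divided: u stays below d and g below r - d near the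
      image of x, with r < c.\<close>
    then obtain d where d: "u (\<kappa> x) < ereal d" "ereal d < c - ereal (g (\<kappa> x))" using ereal_dense2 by blast
    have "ereal (d + g (\<kappa> x)) < c" using d(2) by (cases c) auto
    then obtain r where r: "d + g (\<kappa> x) < r" "ereal r < c" using ereal_dense2 by (metis less_ereal.simps(1))
    have oU: "open_in_Cn n (\<kappa> ` U)" by (rule chart_image_open_subset[OF ch U(1,3)])
    have cg: "continuous_on (\<kappa> ` U) g" using g unfolding smooth_Cn_def by (auto dest: spec[of _ 0])
    have o1: "open_in_Cn n {z\<in>\<kappa> ` U. u z < ereal d}"
      using u oU unfolding psh_Cn_def open_in_Cn_def using openin_trans by blast
    have "openin (top_of_set (\<kappa> ` U)) (\<kappa> ` U \<inter> g -` {..<r - d})"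
      by (rule continuous_openin_preimage_gen[OF cg]) auto
    then have o2: "open_in_Cn n (\<kappa> ` U \<inter> g -` {..<r - d})"
      using oU unfolding open_in_Cn_def using openin_trans by blast
    define T where "T = U \<inter> (V \<inter> \<kappa> -` {z\<in>\<kappa> ` U. u z < ereal d}) \<inter> (V \<inter> \<kappa> -` (\<kappa> ` U \<inter> g -` {..<r - d}))"
    have "open T" unfolding T_def by (intro open_Int U chart_preimage_open[OF ch] o1 o2)
    moreover have "x \<in> T" using U d r by (auto simp: T_def)
    moreover have "T \<subseteq> {y. \<phi> y < c}"
    proof
      fix y assume y: "y \<in> T"
      then have uy: "u (\<kappa> y) < ereal d" "g (\<kappa> y) < r - d" "y \<in> U" by (auto simp: T_def)
      then have "u (\<kappa> y) + ereal (g (\<kappa> y)) < ereal r" by (cases "u (\<kappa> y)") auto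
      then show "y \<in> {y. \<phi> y < c}" using eq uy(3) r(2) by auto
    qed
    ultimately show "\<exists>T. open T \<and> x \<in> T \<and> T \<subseteq> {y. \<phi> y < c}" by blast
  qed
qed

lemma (in volume_manifold) quasi_psh_measurable:
  assumes \<phi>: "quasi_psh n A \<phi>"
  shows "\<phi> \<in> borel_measurable borel"
  by (rule borel_measurableI_less) (use quasi_psh_open_sublevel(1)[OF \<phi>] in auto)

section \<open>Sections of line bundles\<close>

lemma trivialization_eqI:
  assumes "local_trivialization L T h" "proj L v = proj L w" "proj L v \<in> T" "h v = h w"
  shows "v = w"
proof -
  have "inj_on (\<lambda>v. (proj L v, h v)) {v. proj L v \<in> T}"
    using assms(1) by (auto simp: local_trivialization_def bij_betw_def)
  then show ?thesis using assms by (auto dest: inj_onD)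
qed

locale section_space = volume_manifold n A dV
  for n :: nat and A :: "('a::{t2_space, second_countable_topology}) chart set" and dV :: "'a measure" +
  fixes L :: "('a, 'l) line_bundle" and W :: "('a \<Rightarrow> 'l) set"
  assumes lbundle: "holomorphic_line_bundle n A L"
    and subspace: "sec_subspace n A L W"
    and generates: "generates_fibers L W"
begin

lemma trivialization: "(T, h) \<in> trivs L \<Longrightarrow> local_trivialization L T h"
  using lbundle by (auto simp: holomorphic_line_bundle_def)

lemma trivialization_open: "(T, h) \<in> trivs L \<Longrightarrow> open T"
  using trivialization by (auto simp: local_trivialization_def)

lemma trivialization_at: obtains T h where "(T, h) \<in> trivs L" "x \<in> T"
proof -
  have "x \<in> (\<Union>(U, h)\<in>trivs L. U)" using lbundle by (simp add: holomorphic_line_bundle_def)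
  then show ?thesis using that by blast
qed

lemma section_proj: "s \<in> W \<Longrightarrow> proj L (s x) = x"
  using subspace by (auto simp: sec_subspace_def hol_sections_def)

lemma section_holomorphic: "s \<in> W \<Longrightarrow> (T, h) \<in> trivs L \<Longrightarrow> holomorphic_fun n A T (\<lambda>x. h (s x))"
  using subspace by (auto simp: sec_subspace_def hol_sections_def)

lemma section_continuous: "s \<in> W \<Longrightarrow> (T, h) \<in> trivs L \<Longrightarrow> continuous_on T (\<lambda>x. h (s x))"
  using holomorphic_fun_continuous[OF section_holomorphic trivialization_open] by blast

lemma sec_scale_trivialized:
  "s \<in> W \<Longrightarrow> (T, h) \<in> trivs L \<Longrightarrow> x \<in> T \<Longrightarrow> h (sec_scale L c s x) = c * h (s x)"
  using trivialization[of T h] section_proj by (auto simp: local_trivialization_def sec_scale_def)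

lemma sec_scale_mem: "s \<in> W \<Longrightarrow> sec_scale L c s \<in> W"
  using subspace by (auto simp: sec_subspace_def)

lemma section_eqI:
  assumes "s \<in> W" "s' \<in> W" "\<And>T h x. (T, h) \<in> trivs L \<Longrightarrow> x \<in> T \<Longrightarrow> h (s x) = h (s' x)"
  shows "s = s'"
proof
  fix x
  obtain T h where T: "(T, h) \<in> trivs L" "x \<in> T" by (rule trivialization_at)
  show "s x = s' x"
    by (rule trivialization_eqI[OF trivialization[OF T(1)]]) (use assms section_proj T in auto)
qed

lemma lzero_mem: "lzero L \<in> W"
  using subspace by (auto simp: sec_subspace_def)

lemma lzero_trivialized: "(T, h) \<in> trivs L \<Longrightarrow> x \<in> T \<Longrightarrow> h (lzero L x) = 0"
  using trivialization[of T h] by (auto simp: local_trivialization_def)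

lemma line_of_eqD:
  assumes s: "s \<in> W" "s \<noteq> lzero L" and s': "s' \<in> W" and eq: "line_of L s = line_of L s'"
  obtains c where "c \<noteq> 0" "s = sec_scale L c s'"
proof -
  have "s = sec_scale L 1 s"
  proof (rule section_eqI[OF s(1) sec_scale_mem[OF s(1)]])
    fix T h x assume T: "(T, h) \<in> trivs L" "x \<in> T"
    show "h (s x) = h (sec_scale L 1 s x)" using sec_scale_trivialized[OF s(1) T, of 1] by simp
  qed
  then have "s \<in> line_of L s" unfolding line_of_def by blast
  then obtain c where c: "s = sec_scale L c s'" unfolding eq by (auto simp: line_of_def)
  have "c \<noteq> 0"
  proof
    assume "c = 0"
    have "s = lzero L"
    proof (rule section_eqI[OF s(1) lzero_mem])
      fix T h x assume T: "(T, h) \<in> trivs L" "x \<in> T"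
      show "h (s x) = h (lzero L x)" unfolding c lzero_trivialized[OF T]
        using sec_scale_trivialized[OF s' T] \<open>c = 0\<close> by simp
    qed
    then show False using s by simp
  qed
  then show ?thesis using that c by blast
qed

lemma lincomb_mem: "(\<And>i. i < d \<Longrightarrow> b i \<in> W) \<Longrightarrow> lincomb L b d z \<in> W"
  by (induction d) (use subspace in \<open>auto simp: sec_subspace_def\<close>)

lemma sec_add_trivialized:
  "s \<in> W \<Longrightarrow> s' \<in> W \<Longrightarrow> (T, h) \<in> trivs L \<Longrightarrow> x \<in> T \<Longrightarrow> h (sec_add L s s' x) = h (s x) + h (s' x)"
  using trivialization[of T h] section_proj by (auto simp: local_trivialization_def sec_add_def)

lemma lincomb_trivialized:
  assumes "\<And>i. i < d \<Longrightarrow> b i \<in> W" "(T, h) \<in> trivs L" "x \<in> T"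
  shows "h (lincomb L b d z x) = (\<Sum>i<d. z i * h (b i x))"
  using assms
proof (induction d)
  case 0
  then show ?case by (simp add: lzero_trivialized)
next
  case (Suc d)
  then show ?case
    using lincomb_mem[of d b z] sec_scale_mem[of "b d"]
    by (simp add: sec_add_trivialized sec_scale_trivialized)
qed

text \<open>Some vector over x has coordinate 1, it is the value of a section in W, and this section
  is a combination of the basis.\<close>

lemma basis_nonvanishing:
  assumes b: "basis_sec L W d b" and T: "(T, h) \<in> trivs L" "x \<in> T"
  shows "\<exists>i<d. h (b i x) \<noteq> 0"
proof (rule ccontr)
  assume "\<not> ?thesis"
  then have zero: "h (b i x) = 0" if "i < d" for i using that by blast
  have bW: "\<And>i. i < d \<Longrightarrow> b i \<in> W" using b by (auto simp: basis_sec_def)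
  have "(x, 1) \<in> (\<lambda>v. (proj L v, h v)) ` {v. proj L v \<in> T}"
    using trivialization[OF T(1)] T(2) by (auto simp: local_trivialization_def bij_betw_def)
  then obtain v where v: "proj L v = x" "h v = 1" by auto
  have "(\<lambda>s. s x) ` W = {v. proj L v = x}" using generates by (simp add: generates_fibers_def)
  then have "v \<in> (\<lambda>s. s x) ` W" using v by simp
  then obtain s where s: "s \<in> W" "s x = v" by blast
  obtain z where "s = lincomb L b d z" using b s by (auto simp: basis_sec_def bij_betw_def)
  then have "h v = (\<Sum>i<d. z i * h (b i x))" using lincomb_trivialized[OF bW T] s by auto
  also have "\<dots> = 0" using zero by (intro sum.neutral) auto
  finally show False using v by simp
qed

end

section \<open>Integrability for almost every linear combination\<close>

text \<open>The constant must not depend on the coefficients, since they will vary with the point of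
  the manifold. If one of the first m coefficients is at least d, the integral over that coordinate
  is bounded uniformly in the others by \<open>nn_integral_pow_ext_disc\<close>. Otherwise the
  constant term dominates and the integrand is bounded on the polydisc.\<close>

lemma nn_integral_pow_ext_affine:
  fixes p :: real
  assumes p: "0 < p" "p < 1" and \<delta>: "0 < \<delta>" and R: "0 < R"
  shows "\<exists>C<\<infinity>. \<forall>c :: nat \<Rightarrow> complex. (\<exists>i\<le>m. \<delta> \<le> cmod (c i)) \<longrightarrow>
    (\<integral>\<^sup>+z. indicator (polydisc {..<m} (\<lambda>_. 0) R) z * pow_ext (cmod ((\<Sum>i<m. z i * c i) + c m)) (- 2 * p) \<partial>Leb m) \<le> (C::ennreal)"
proof -
  interpret product_sigma_finite "\<lambda>_. lborel :: complex measure" by standard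
  let ?P = "\<lambda>I. polydisc I (\<lambda>_. 0) R"
  \<comment> \<open>Small enough that linear coefficients below d contribute at most \<delta> / 2 on
    the polydisc, and at most \<delta> so that the coefficient of size \<delta> must then be the
    constant term.\<close>
  define d where "d = min \<delta> (\<delta> / (2 * (real m + 1) * R))"
  have d: "0 < d" "d \<le> \<delta>" using \<delta> R by (auto simp: d_def)
  have dm: "real m * R * d \<le> \<delta> / 2"
  proof -
    have "real m * R * d \<le> (real m + 1) * R * (\<delta> / (2 * (real m + 1) * R))"
      using R d \<delta> by (intro mult_mono) (auto simp: d_def)
    also have "\<dots> = \<delta> / 2"
    proof -
      define X where "X = (real m + 1) * R"
      have "0 < X" unfolding X_def using R by (intro mult_pos_pos) auto
      then have "X * (\<delta> / (2 * X)) = \<delta> / 2" by simp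
      then show ?thesis by (simp only: X_def mult.assoc)
    qed
    finally show ?thesis .
  qed
  obtain C where C: "C < \<infinity>" "\<And>b. (\<integral>\<^sup>+w. indicator (ball 0 R) w * pow_ext (cmod (w + b)) (- 2 * p) \<partial>lborel) \<le> C"
    using nn_integral_pow_ext_disc[OF p, of R] by blast
  \<comment> \<open>Summing over all index sets gives one bound, whichever coordinate is integrated
    out first.\<close>
  define vol where "vol = (\<Sum>I\<in>Pow {..<m}. emeasure (\<Pi>\<^sub>M i\<in>I. lborel) (?P I))"
  have vol: "emeasure (\<Pi>\<^sub>M i\<in>I. lborel) (?P I) \<le> vol" if "I \<subseteq> {..<m}" for I
    unfolding vol_def by (rule member_le_sum) (use that in auto)
  have vfin: "vol < \<infinity>"
  proof -
    have "emeasure (\<Pi>\<^sub>M i\<in>I. lborel) (?P I) \<noteq> \<infinity>" if "I \<in> Pow {..<m}" for I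
      using emeasure_polydisc_finite[of I "\<lambda>_. 0" R] finite_subset[of I "{..<m}"] that by auto
    then show ?thesis unfolding vol_def by (simp add: less_top[symmetric])
  qed
  define K where "K = ennreal (d powr (- 2 * p))"
  define K' where "K' = ennreal ((\<delta> / 2) powr (- 2 * p))"
  have Pm: "?P I \<in> sets (\<Pi>\<^sub>M i\<in>I. lborel)" if "finite I" for I
    unfolding polydisc_def by (rule sets_PiM_I_finite) (use that in auto)
  show ?thesis
  proof (intro exI[of _ "K * C * vol + K' * vol"] conjI allI impI)
    show "K * C * vol + K' * vol < \<infinity>"
      using C(1) vfin by (simp add: K_def K'_def ennreal_mult_less_top less_top[symmetric] ennreal_mult_eq_top_iff)
    fix c :: "nat \<Rightarrow> complex" assume c: "\<exists>i\<le>m. \<delta> \<le> cmod (c i)"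
    let ?f = "\<lambda>z. indicator (?P {..<m}) z * pow_ext (cmod ((\<Sum>i<m. z i * c i) + c m)) (- 2 * p)"
    show "(\<integral>\<^sup>+z. ?f z \<partial>Leb m) \<le> K * C * vol + K' * vol"
    proof (cases "\<exists>i<m. d \<le> cmod (c i)")
      case True
      then obtain i where i: "i < m" "d \<le> cmod (c i)" by blast
      define I where "I = {..<m} - {i}"
      have I: "{..<m} = insert i I" "finite I" "i \<notin> I" using i by (auto simp: I_def)
      have ci: "0 < cmod (c i)" using d(1) i(2) by linarith
      have [measurable]: "?P {..<m} \<in> sets (Leb m)" by (rule Pm) simp
      have fm: "?f \<in> borel_measurable (Leb m)" by measurable
      have inner: "(\<integral>\<^sup>+y. ?f (x(i := y)) \<partial>lborel) \<le> (K * C) * indicator (?P I) x"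
        if x: "x \<in> space (\<Pi>\<^sub>M i\<in>I. lborel)" for x
      proof (cases "x \<in> ?P I")
        case True
        define b where "b = ((\<Sum>j\<in>I. x j * c j) + c m) / c i"
        have sum: "(\<Sum>j<m. (x(i := y)) j * c j) + c m = c i * (y + b)" for y
        proof -
          have "(\<Sum>j<m. (x(i := y)) j * c j) = y * c i + (\<Sum>j\<in>I. x j * c j)"
            unfolding I(1) using I(2,3) by (subst sum.insert) (auto intro!: sum.cong)
          then show ?thesis using ci by (simp add: b_def field_simps)
        qed
        have "?f (x(i := y)) \<le> K * (indicator (ball 0 R) y * pow_ext (cmod (y + b)) (- 2 * p))" for y
        proof (cases "x(i := y) \<in> ?P {..<m}")
          case True
          then have y: "y \<in> ball 0 R" using i by (auto simp: polydisc_def PiE_iff dest: bspec[of _ _ i])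
          have "pow_ext (cmod (c i * (y + b))) (- 2 * p) = ennreal (cmod (c i) powr (- 2 * p)) * pow_ext (cmod (y + b)) (- 2 * p)"
            unfolding norm_mult by (rule pow_ext_mult[OF ci]) simp
          also have "\<dots> \<le> K * pow_ext (cmod (y + b)) (- 2 * p)"
            unfolding K_def using p d(1) i(2) by (intro mult_right_mono ennreal_leI powr_mono2') auto
          finally have "pow_ext (cmod ((\<Sum>j<m. (x(i := y)) j * c j) + c m)) (- 2 * p) \<le> K * pow_ext (cmod (y + b)) (- 2 * p)"
            unfolding sum .
          then show ?thesis using True y by simp
        qed simp
        then have "(\<integral>\<^sup>+y. ?f (x(i := y)) \<partial>lborel) \<le> (\<integral>\<^sup>+y. K * (indicator (ball 0 R) y * pow_ext (cmod (y + b)) (- 2 * p)) \<partial>lborel)"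
          by (intro nn_integral_mono)
        also have "\<dots> = K * (\<integral>\<^sup>+y. indicator (ball 0 R) y * pow_ext (cmod (y + b)) (- 2 * p) \<partial>lborel)"
        proof (rule nn_integral_cmult)
          have [measurable]: "ball 0 R \<in> sets (borel :: complex measure)" by simp
          show "(\<lambda>y. indicator (ball 0 R) y * pow_ext (cmod (y + b)) (- 2 * p)) \<in> borel_measurable lborel" by measurable
        qed
        also have "\<dots> \<le> K * C" by (intro mult_left_mono C(2)) simp
        finally show ?thesis using True by simp
      next
        case False
        have "indicator (?P {..<m}) (x(i := y)) = (0 :: ennreal)" for y
        proof -
          have "x(i := y) \<notin> ?P {..<m}"
          proof
            assume xy: "x(i := y) \<in> ?P {..<m}"
            have "x j \<in> ball 0 R" if "j \<in> I" for j
            proof -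
              have "j \<noteq> i" "j < m" using that I by auto
              then show ?thesis using xy by (auto simp: polydisc_def PiE_iff dest!: bspec[of _ _ j])
            qed
            then have "x \<in> ?P I" using x by (auto simp: polydisc_def PiE_iff space_PiM)
            with False show False by simp
          qed
          then show ?thesis by simp
        qed
        then show ?thesis by simp
      qed
      have "(\<integral>\<^sup>+z. ?f z \<partial>Leb m) = (\<integral>\<^sup>+x. (\<integral>\<^sup>+y. ?f (x(i := y)) \<partial>lborel) \<partial>(\<Pi>\<^sub>M i\<in>I. lborel))"
        using product_nn_integral_insert[OF I(2,3), of ?f] fm unfolding I(1) by simp
      also have "\<dots> \<le> (\<integral>\<^sup>+x. (K * C) * indicator (?P I) x \<partial>(\<Pi>\<^sub>M i\<in>I. lborel))"
        by (intro nn_integral_mono inner)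
      also have "\<dots> = (K * C) * emeasure (\<Pi>\<^sub>M i\<in>I. lborel) (?P I)"
        by (rule nn_integral_cmult_indicator) (rule Pm[OF I(2)])
      also have "\<dots> \<le> (K * C) * vol" by (intro mult_left_mono vol) (auto simp: I_def)
      finally show ?thesis by (simp add: add_increasing2)
    next
      case False
      then have small: "cmod (c i) \<le> d" if "i < m" for i using that by force
      have cm: "\<delta> \<le> cmod (c m)"
      proof -
        obtain i where i: "i \<le> m" "\<delta> \<le> cmod (c i)" using c by blast
        have "i = m"
        proof (rule ccontr)
          assume "i \<noteq> m"
          then have "i < m" using i by simp
          then show False using False d(2) i(2) by force
        qed
        then show ?thesis using i by simp
      qed
      have "?f z \<le> K' * indicator (?P {..<m}) z" for z
      proof (cases "z \<in> ?P {..<m}")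
        case True
        have "cmod (\<Sum>i<m. z i * c i) \<le> (\<Sum>i<m. R * d)"
        proof (rule sum_norm_le)
          fix i assume "i \<in> {..<m}"
          then have "cmod (z i) \<le> R" using True polydisc_dist[of z "{..<m}" "\<lambda>_. 0" R i] by simp
          then show "cmod (z i * c i) \<le> R * d" unfolding norm_mult
            using small \<open>i \<in> {..<m}\<close> R by (intro mult_mono) auto
        qed
        also have "\<dots> \<le> \<delta> / 2" using dm by (simp add: mult_ac)
        finally have "\<delta> / 2 \<le> cmod ((\<Sum>i<m. z i * c i) + c m)"
          using cm norm_diff_ineq[of "c m" "\<Sum>i<m. z i * c i"] by (simp add: add.commute)
        then have "pow_ext (cmod ((\<Sum>i<m. z i * c i) + c m)) (- (2 * p)) \<le> pow_ext (\<delta> / 2) (- (2 * p))"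
          using p \<delta> by (intro pow_ext_mono_neg) auto
        then show ?thesis using True \<delta> by (simp add: K'_def pow_ext_def)
      qed simp
      then have "(\<integral>\<^sup>+z. ?f z \<partial>Leb m) \<le> (\<integral>\<^sup>+z. K' * indicator (?P {..<m}) z \<partial>Leb m)" by (intro nn_integral_mono)
      also have "\<dots> = K' * emeasure (Leb m) (?P {..<m})"
        by (rule nn_integral_cmult_indicator) (rule Pm, simp)
      also have "\<dots> \<le> K' * vol" by (intro mult_left_mono vol) auto
      finally show ?thesis by (simp add: add_increasing)
    qed
  qed
qed

text \<open>Tonelli's theorem in z and y: for each y in B the integral over z in a polydisc is
  bounded by one constant, because compactness bounds the largest coefficient from below. The double
  integral is then finite, hence the inner integral for almost every z.\<close>

lemma (in volume_manifold) AE_integrable_linear_combination: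
  fixes c :: "nat \<Rightarrow> 'a \<Rightarrow> complex" and H :: "'a \<Rightarrow> ennreal"
  assumes p: "0 < p" "p < 1" and K: "compact K" and B: "B \<in> sets borel" "B \<subseteq> K"
    and c: "\<And>i. i \<le> m \<Longrightarrow> continuous_on K (c i)" and nv: "\<And>y. y \<in> K \<Longrightarrow> \<exists>i\<le>m. c i y \<noteq> 0"
    and H: "H \<in> borel_measurable borel" "(\<integral>\<^sup>+y\<in>B. H y \<partial>dV) < \<infinity>"
  shows "AE z in Leb m. (\<integral>\<^sup>+y\<in>B. H y * pow_ext (cmod ((\<Sum>i<m. z i * c i y) + c m y)) (- 2 * p) \<partial>dV) < \<infinity>"
proof -
  interpret product_sigma_finite "\<lambda>_. lborel :: complex measure" by standard
  interpret fp: finite_product_sigma_finite "\<lambda>_. lborel :: complex measure" "{..<m}" by standard simp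
  have Kb [measurable]: "K \<in> sets borel" "B \<in> sets borel" using borel_closed[OF compact_imp_closed[OF K]] B by auto
  note [measurable] = H(1)
  obtain \<delta> where \<delta>: "0 < \<delta>" "\<And>y. y \<in> K \<Longrightarrow> \<exists>i\<le>m. \<delta> \<le> cmod (c i y)"
  proof (cases "K = {}")
    case True
    then show ?thesis using that[of 1] by auto
  next
    case False
    have "continuous_on K (\<lambda>y. \<Sum>i\<le>m. cmod (c i y))" by (intro continuous_intros c) auto
    from continuous_attains_inf[OF K False this] obtain y0 where
      y0: "y0 \<in> K" "\<And>y. y \<in> K \<Longrightarrow> (\<Sum>i\<le>m. cmod (c i y0)) \<le> (\<Sum>i\<le>m. cmod (c i y))" by blast
    define S where "S = (\<Sum>i\<le>m. cmod (c i y0))"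
    have S: "0 < S"
    proof -
      obtain i where i: "i \<le> m" "c i y0 \<noteq> 0" using nv[OF y0(1)] by blast
      have "cmod (c i y0) \<le> S" unfolding S_def by (rule member_le_sum) (use i in auto)
      then show ?thesis using i by (smt (verit) zero_less_norm_iff)
    qed
    \<comment> \<open>Pigeonhole: a sum of m + 1 moduli that is at least S has a member of size at
      least S / (m + 1).\<close>
    have "\<exists>i\<le>m. S / (m + 1) \<le> cmod (c i y)" if y: "y \<in> K" for y
    proof (rule ccontr)
      assume "\<not> ?thesis"
      then have "(\<Sum>i\<le>m. cmod (c i y)) < (\<Sum>i\<le>m. S / (m + 1))" by (intro sum_strict_mono) auto
      also have "\<dots> = S" by simp
      finally show False using y0(2)[OF y] by (simp add: S_def)
    qed
    then show ?thesis using that[of "S / (m + 1)"] S by auto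
  qed
  define c' where "c' i y = indicator K y *\<^sub>R c i y" for i y
  have c'm [measurable]: "c' i \<in> borel_measurable borel" if "i \<le> m" for i
    unfolding c'_def using c[OF that] Kb(1) by (intro borel_measurable_continuous_on_indicator) auto
  \<comment> \<open>Absorbing H and B into the measure makes it finite, so Tonelli's theorem for
    sigma-finite measures applies.\<close>
  define MB where "MB = density dV (\<lambda>y. H y * indicator B y)"
  have sMB [measurable_cong, simp]: "sets MB = sets borel" by (simp add: MB_def)
  have Hm: "(\<lambda>y. H y * indicator B y) \<in> borel_measurable dV"
    by (intro borel_measurable_times_ennreal borel_measurable_indicator) (use H Kb in auto)
  interpret MB: finite_measure MB
  proof
    have "emeasure MB (space MB) = (\<integral>\<^sup>+y\<in>B. H y \<partial>dV)"
      unfolding MB_def by (subst emeasure_density[OF Hm]) (auto simp: sets_eq_imp_space_eq[OF sets_dV] intro!: nn_integral_cong)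
    then show "emeasure MB (space MB) \<noteq> \<infinity>" using H(2) by simp
  qed
  interpret pair: pair_sigma_finite "Leb m" MB by standard
  let ?g = "\<lambda>z y. pow_ext (cmod ((\<Sum>i<m. z i * c' i y) + c' m y)) (- 2 * p)"
  have gm: "(\<lambda>(z, y). ?g z y) \<in> borel_measurable (Leb m \<Otimes>\<^sub>M MB)"
  proof -
    have 1: "(\<lambda>x. fst x i) \<in> borel_measurable (Leb m \<Otimes>\<^sub>M MB)" if "i < m" for i
      by (rule measurable_compose[OF measurable_fst]) (use measurable_component_singleton[of i "{..<m}" "\<lambda>_. lborel"] that in simp)
    have 2: "(\<lambda>x. c' i (snd x)) \<in> borel_measurable (Leb m \<Otimes>\<^sub>M MB)" if "i \<le> m" for i
      by (rule measurable_compose[OF measurable_snd]) (use c'm[OF that] in simp)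
    show ?thesis unfolding split_beta
      by (intro measurable_pow_ext borel_measurable_norm borel_measurable_add borel_measurable_sum borel_measurable_times 1 2) auto
  qed
  have intMB: "(\<integral>\<^sup>+y\<in>B. H y * pow_ext (cmod ((\<Sum>i<m. z i * c i y) + c m y)) (- 2 * p) \<partial>dV) = (\<integral>\<^sup>+y. ?g z y \<partial>MB)" for z
  proof -
    have "(\<lambda>y. ?g z y) \<in> borel_measurable borel"
      by (intro measurable_pow_ext borel_measurable_norm borel_measurable_add borel_measurable_sum borel_measurable_times c'm) auto
    then have "(\<integral>\<^sup>+y. ?g z y \<partial>MB) = (\<integral>\<^sup>+y. H y * indicator B y * ?g z y \<partial>dV)"
      unfolding MB_def by (subst nn_integral_density[OF Hm]) auto
    also have "\<dots> = (\<integral>\<^sup>+y\<in>B. H y * pow_ext (cmod ((\<Sum>i<m. z i * c i y) + c m y)) (- 2 * p) \<partial>dV)"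
      by (intro nn_integral_cong) (use B(2) in \<open>auto simp: indicator_def c'_def mult_ac\<close>)
    finally show ?thesis by simp
  qed
  have R: "AE z in Leb m. z \<in> polydisc {..<m} (\<lambda>_. 0) R \<longrightarrow> (\<integral>\<^sup>+y. ?g z y \<partial>MB) < \<infinity>" if R: "0 < R" for R
  proof -
    let ?P = "polydisc {..<m} (\<lambda>_. 0) R"
    have Pm [measurable]: "?P \<in> sets (Leb m)"
      unfolding polydisc_def by (rule sets_PiM_I_finite) auto
    obtain C where C: "C < \<infinity>" "\<And>c :: nat \<Rightarrow> complex. (\<exists>i\<le>m. \<delta> \<le> cmod (c i)) \<Longrightarrow>
        (\<integral>\<^sup>+z. indicator ?P z * pow_ext (cmod ((\<Sum>i<m. z i * c i) + c m)) (- 2 * p) \<partial>Leb m) \<le> C"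
      using nn_integral_pow_ext_affine[OF p \<delta>(1) R, of m] by blast
    have gm': "(\<lambda>(z, y). indicator ?P z * ?g z y) \<in> borel_measurable (Leb m \<Otimes>\<^sub>M MB)"
      using gm unfolding split_beta by (intro borel_measurable_times_ennreal measurable_compose[OF measurable_fst borel_measurable_indicator[OF Pm]]) auto
    have im: "(\<lambda>z. \<integral>\<^sup>+y. indicator ?P z * ?g z y \<partial>MB) \<in> borel_measurable (Leb m)"
      using MB.borel_measurable_nn_integral[OF gm'] by simp
    have "(\<integral>\<^sup>+z. (\<integral>\<^sup>+y. indicator ?P z * ?g z y \<partial>MB) \<partial>Leb m) = (\<integral>\<^sup>+y. (\<integral>\<^sup>+z. indicator ?P z * ?g z y \<partial>Leb m) \<partial>MB)"
      using pair.Fubini'[OF gm'] by simp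
    also have "\<dots> \<le> (\<integral>\<^sup>+y. C \<partial>MB)"
    proof (rule nn_integral_mono_AE)
      have "AE y in MB. y \<in> B"
        unfolding MB_def by (subst AE_density[OF Hm]) (auto simp: indicator_def)
      then show "AE y in MB. (\<integral>\<^sup>+z. indicator ?P z * ?g z y \<partial>Leb m) \<le> C"
      proof eventually_elim
        case (elim y)
        then have y: "y \<in> K" using B by auto
        have "c' i y = c i y" for i using y by (simp add: c'_def)
        then show ?case using C(2)[of "\<lambda>i. c i y"] \<delta>(2)[OF y] by simp
      qed
    qed
    also have "\<dots> < \<infinity>" using C(1) MB.emeasure_finite[of "space MB"]
      by (simp add: less_top[symmetric] ennreal_mult_eq_top_iff)
    finally have "AE z in Leb m. (\<integral>\<^sup>+y. indicator ?P z * ?g z y \<partial>MB) \<noteq> \<infinity>"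
      by (intro nn_integral_PInf_AE im) simp
    then show ?thesis
      by eventually_elim (auto simp: less_top[symmetric])
  qed
  \<comment> \<open>Polydiscs with natural radii exhaust the space of coefficients, and countably
    many null sets are discarded.\<close>
  have "AE z in Leb m. \<forall>k. z \<in> polydisc {..<m} (\<lambda>_. 0) (real (Suc k)) \<longrightarrow> (\<integral>\<^sup>+y. ?g z y \<partial>MB) < \<infinity>"
    unfolding AE_all_countable by (intro allI R) simp
  then show ?thesis
  proof (rule AE_mp, intro AE_I2 impI)
    fix z assume z: "z \<in> space (Leb m)"
      and fin: "\<forall>k. z \<in> polydisc {..<m} (\<lambda>_. 0) (real (Suc k)) \<longrightarrow> (\<integral>\<^sup>+y. ?g z y \<partial>MB) < \<infinity>"
    obtain k where k: "(\<Sum>i<m. cmod (z i)) < real k" using reals_Archimedean2 by blast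
    have "cmod (z i) < real (Suc k)" if "i < m" for i
    proof -
      have "cmod (z i) \<le> (\<Sum>i<m. cmod (z i))" by (rule member_le_sum) (use that in auto)
      then show ?thesis using k by simp
    qed
    then have "z \<in> polydisc {..<m} (\<lambda>_. 0) (real (Suc k))" using z by (auto simp: polydisc_def space_PiM PiE_iff)
    then show "(\<integral>\<^sup>+y\<in>B. H y * pow_ext (cmod ((\<Sum>i<m. z i * c i y) + c m y)) (- 2 * p) \<partial>dV) < \<infinity>"
      unfolding intMB using fin by blast
  qed
qed

section \<open>The exceptional set\<close>

lemma measurable_pow_ext_variable [measurable (raw)]:
  assumes [measurable]: "f \<in> borel_measurable M" "a \<in> borel_measurable M"
  shows "(\<lambda>x. pow_ext (f x) (a x)) \<in> borel_measurable M"
  unfolding pow_ext_def by measurable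

lemma (in volume_manifold) relatively_compact_neighbourhood:
  fixes x :: 'a
  assumes T: "open T" "x \<in> T"
  obtains B K where "open B" "x \<in> B" "B \<subseteq> K" "compact K" "K \<subseteq> T"
proof -
  obtain V \<kappa> where ch: "(V, \<kappa>) \<in> A" "x \<in> V" using chart_at .
  have "open_in_Cn n (\<kappa> ` (T \<inter> V))"
    using T chart_open[OF ch(1)] by (intro chart_image_open_subset[OF ch(1)]) auto
  then obtain r where r: "0 < r" "cpolydisc {..<n} (\<kappa> x) r \<subseteq> \<kappa> ` (T \<inter> V)"
    using open_in_Cn_contains_cpolydisc[of n "\<kappa> ` (T \<inter> V)" "\<kappa> x"] T ch(2) by blast
  define K where "K = inv_into V \<kappa> ` cpolydisc {..<n} (\<kappa> x) r"
  define B where "B = V \<inter> \<kappa> -` polydisc {..<n} (\<kappa> x) r"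
  show ?thesis
  proof (rule that[of B K])
    show "open B" unfolding B_def by (rule chart_preimage_open[OF ch(1) open_in_Cn_polydisc])
    show "x \<in> B" using ch(2) r open_in_Cn_subset[OF chart_image_open[OF ch(1)]]
      by (auto simp: B_def intro!: center_mem_polydisc)
    show "B \<subseteq> K"
    proof
      fix y assume y: "y \<in> B"
      then have "inv_into V \<kappa> (\<kappa> y) = y" using chart_inv[OF ch(1)] by (auto simp: B_def)
      moreover have "\<kappa> y \<in> cpolydisc {..<n} (\<kappa> x) r" using y polydisc_subset_cpolydisc by (auto simp: B_def)
      ultimately show "y \<in> K" unfolding K_def by (metis imageI)
    qed
    show "compact K"
      unfolding K_def
    proof (rule compact_continuous_image[OF _ compact_cpolydisc])
      show "continuous_on (cpolydisc {..<n} (\<kappa> x) r) (inv_into V \<kappa>)"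
        by (rule continuous_on_subset[OF chart_inv_continuous[OF ch(1)]]) (use r in auto)
    qed
    show "K \<subseteq> T"
    proof
      fix y assume "y \<in> K"
      then obtain z where z: "z \<in> \<kappa> ` (T \<inter> V)" "y = inv_into V \<kappa> z" using r(2) unfolding K_def by blast
      then show "y \<in> T" using chart_inv[OF ch(1)] by auto
    qed
  qed
qed

locale multiplier_setting = section_space n A dV L W
  for n :: nat and A :: "('a::{t2_space, second_countable_topology}) chart set" and dV :: "'a measure"
    and L :: "('a, 'l) line_bundle" and W :: "('a \<Rightarrow> 'l) set" +
  fixes \<phi> :: "'a \<Rightarrow> ereal" and \<sigma>\<^sub>0 :: "'a \<Rightarrow> real"
  assumes quasi_psh: "quasi_psh n A \<phi>"
    and cont\<sigma>\<^sub>0: "continuous_on UNIV \<sigma>\<^sub>0" and \<sigma>\<^sub>0_pos: "\<And>x. 0 < \<sigma>\<^sub>0 x"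
    and ideals_eq: "\<And>x. multiplier_ideal n A \<phi> x = multiplier_ideal n A (\<lambda>y. ereal (1 + \<sigma>\<^sub>0 y) * \<phi> y) x"
begin

definition w :: "'a \<Rightarrow> ennreal" where "w y = exp_ext (- 2 * \<phi> y)"
definition w\<^sub>0 :: "'a \<Rightarrow> ennreal" where "w\<^sub>0 y = exp_ext (- 2 * (ereal (1 + \<sigma>\<^sub>0 y) * \<phi> y))"

lemma \<phi>_less: "\<phi> y < \<infinity>" and \<phi>_measurable [measurable]: "\<phi> \<in> borel_measurable borel"
  using quasi_psh_open_sublevel(2)[OF quasi_psh] quasi_psh_measurable[OF quasi_psh] by auto

lemma \<sigma>\<^sub>0_measurable [measurable]: "\<sigma>\<^sub>0 \<in> borel_measurable borel"
  using cont\<sigma>\<^sub>0 by (rule borel_measurable_continuous_onI)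

lemma weights_measurable [measurable]: "w \<in> borel_measurable borel" "w\<^sub>0 \<in> borel_measurable borel"
  unfolding w_def w\<^sub>0_def by measurable

text \<open>This is where equality of the ideals is used: the germ of f has a representative that is
  square integrable against \<open>w\<^sub>0\<close>, and f agrees with that representative near
  y.\<close>

lemma hol_space_locally_integrable:
  assumes D: "open D" and f: "f \<in> hol_space w D" and y: "y \<in> D"
  shows "\<exists>U. open U \<and> y \<in> U \<and> sq_int (weight_on w\<^sub>0 U) f < \<infinity>"
proof -
  have "germ y f \<in> multiplier_ideal n A \<phi> y"
    using multiplier_ideal_volume[of \<phi> y] D y hol_spaceD(2,3)[OF f] weights_measurable(1)
    unfolding sq_int_weight_on w_def by blast
  then have "germ y f \<in> multiplier_ideal n A (\<lambda>y. ereal (1 + \<sigma>\<^sub>0 y) * \<phi> y) y" by (simp add: ideals_eq)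
  then obtain f' U where f': "germ y f = germ y f'" and U: "open U" "y \<in> U"
    and fin: "(\<integral>\<^sup>+y\<in>U. ennreal ((cmod (f' y))\<^sup>2) * w\<^sub>0 y \<partial>dV) < \<infinity>"
    using multiplier_ideal_volume[of "\<lambda>y. ereal (1 + \<sigma>\<^sub>0 y) * \<phi> y" y] weights_measurable(2)
    unfolding w\<^sub>0_def by blast
  have "f \<in> germ y f" by (simp add: germ_def)
  then have "\<forall>\<^sub>F z in nhds y. f z = f' z" unfolding f' by (simp add: germ_def)
  then obtain S where S: "open S" "y \<in> S" "\<And>z. z \<in> S \<Longrightarrow> f z = f' z" by (auto simp: eventually_nhds)
  have "sq_int (weight_on w\<^sub>0 (U \<inter> S)) f \<le> (\<integral>\<^sup>+y\<in>U. ennreal ((cmod (f' y))\<^sup>2) * w\<^sub>0 y \<partial>dV)"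
    unfolding sq_int_weight_on by (intro nn_integral_mono) (auto simp: indicator_def S(3))
  then show ?thesis using fin U S by (intro exI[of _ "U \<inter> S"]) (auto intro: le_less_trans)
qed

text \<open>H stands for the kernel times \<open>w\<^sub>0\<close>, increased by 1: it dominates all
  functions of the space over D simultaneously on B. The lower bound 1 lets H also control integrals
  of negative powers of |s| alone. The compact set between B and T provides bounds and nonvanishing
  up to the boundary of B.\<close>

definition good :: "'a set \<Rightarrow> 'a set \<Rightarrow> 'a set \<Rightarrow> ('l \<Rightarrow> complex) \<Rightarrow> ('a \<Rightarrow> ennreal) \<Rightarrow> bool" where
  "good B D T h H \<longleftrightarrow> open B \<and> open D \<and> B \<subseteq> D \<and> (T, h) \<in> trivs L \<and> (\<exists>K. compact K \<and> B \<subseteq> K \<and> K \<subseteq> T) \<and>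
     H \<in> borel_measurable borel \<and> (\<forall>y. 1 \<le> H y) \<and> (\<integral>\<^sup>+y\<in>B. H y \<partial>dV) < \<infinity> \<and>
     (\<forall>f\<in>hol_space w D. \<exists>C<\<infinity>. \<forall>y\<in>B. ennreal ((cmod (f y))\<^sup>2) * w\<^sub>0 y \<le> C * H y)"

text \<open>A sequence in the open unit interval converging to 1. Countably many exponents then
  suffice for all \<epsilon>; the shift by 2 keeps the member for k = 0 positive.\<close>

definition exponent :: "nat \<Rightarrow> real" where "exponent k = 1 - 1 / (real k + 2)"

lemma exponent: "0 < exponent k" "exponent k < 1"
  by (auto simp: exponent_def)

lemma exponent_exceeds: "a < 1 \<Longrightarrow> \<exists>k. a < exponent k"
proof -
  assume a: "a < 1"
  obtain k :: nat where k: "1 / (1 - a) < real k" using reals_Archimedean2 by blast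
  have "1 < (1 - a) * real k" using k a by (simp add: pos_divide_less_eq mult.commute)
  also have "\<dots> \<le> (1 - a) * (real k + 2)" using a by (intro mult_left_mono) auto
  finally have "1 / (real k + 2) < 1 - a" by (simp add: pos_divide_less_eq)
  then show ?thesis unfolding exponent_def by (intro exI[of _ k]) linarith
qed

definition section_power_integral :: "'a set \<Rightarrow> ('l \<Rightarrow> complex) \<Rightarrow> ('a \<Rightarrow> ennreal) \<Rightarrow> nat \<Rightarrow> ('a \<Rightarrow> 'l) \<Rightarrow> ennreal" where
  "section_power_integral B h H k s = (\<integral>\<^sup>+y\<in>B. H y * pow_ext (cmod (h (s y))) (- 2 * exponent k) \<partial>dV)"

text \<open>D is fixed as a basic set before the kernel is built inside it, and B is chosen
  afterwards as a basic set inside the neighbourhood delivered by the kernel. As restriction embeds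
  the space over D into the smaller one, the domination survives, while (B, D) ranges over pairs of
  basic sets only.\<close>

lemma good_exists:
  assumes \<B>: "topological_basis \<B>" and U: "open U" "x \<in> U"
  obtains B D T h H where "B \<in> \<B>" "D \<in> \<B>" "good B D T h H" "x \<in> B" "D \<subseteq> U"
proof -
  obtain D where D: "D \<in> \<B>" "x \<in> D" "D \<subseteq> U" using topological_basisE[OF \<B> U] .
  have oD: "open D" using D(1) \<B> topological_basis_open by blast
  obtain F where F: "open F" "x \<in> F" "emeasure dV F < \<infinity>" by (rule finite_measure_neighbourhood)
  obtain T h where T: "(T, h) \<in> trivs L" "x \<in> T" by (rule trivialization_at)
  obtain B1 K where B1: "open B1" "x \<in> B1" "B1 \<subseteq> K" "compact K" "K \<subseteq> T"
    by (rule relatively_compact_neighbourhood[OF trivialization_open[OF T(1)] T(2)])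
  obtain M where M: "\<phi> x < ereal M" using \<phi>_less[of x] ereal_dense2 by blast
  \<comment> \<open>On this set w has the lower bound exp (- 2 M), and
    \<sigma>\<open_marker_removed> is bounded below as the interpolation of the weights
    requires.\<close>
  define S where "S = {y. \<phi> y < ereal M} \<inter> {y. \<sigma>\<^sub>0 x / 2 < \<sigma>\<^sub>0 y}"
  have "open {y. \<sigma>\<^sub>0 x / 2 < \<sigma>\<^sub>0 y}" using cont\<sigma>\<^sub>0 by (intro open_Collect_less continuous_on_const)
  then have S: "open S" "x \<in> S"
    using quasi_psh_open_sublevel(1)[OF quasi_psh, of "ereal M"] M \<sigma>\<^sub>0_pos[of x] by (auto simp: S_def)
  define O' where "O' = D \<inter> F \<inter> S"
  have O': "open O'" "x \<in> O'" using oD D F S by (auto simp: O'_def)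
  have Ofin: "emeasure dV O' < \<infinity>"
    by (rule le_less_trans[OF emeasure_mono F(3)]) (use F in \<open>auto simp: O'_def\<close>)
  define b where "b = 1 / (\<sigma>\<^sub>0 x / 2)"
  have b: "0 < b" using \<sigma>\<^sub>0_pos by (simp add: b_def)
  have c: "ennreal (exp (- 2 * M)) \<le> w y" if "y \<in> O'" for y
    unfolding w_def by (rule exp_ext_ge) (use that in \<open>auto simp: O'_def S_def\<close>)
  have interp: "w y \<le> ennreal t * w\<^sub>0 y + ennreal (t powr (- b))" if "y \<in> O'" "0 < t" "t \<le> 1" for y t
    unfolding w_def w\<^sub>0_def b_def
    by (rule exp_ext_interpolation) (use that \<phi>_less \<sigma>\<^sub>0_pos in \<open>auto simp: O'_def S_def\<close>)
  have loc: "\<exists>U. open U \<and> y \<in> U \<and> sq_int (weight_on w\<^sub>0 U) f < \<infinity>"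
    if "open D'" "D' \<subseteq> O'" "f \<in> hol_space w D'" "y \<in> D'" for D' f y
    by (rule hol_space_locally_integrable[OF that(1,3,4)])
  obtain B2 D2 G where B2: "open B2" "open D2" "x \<in> B2" "B2 \<subseteq> D2" "D2 \<subseteq> O'" and G: "G \<in> borel_measurable borel"
    "(\<integral>\<^sup>+y\<in>B2. G y * w\<^sub>0 y \<partial>dV) < \<infinity>"
    "\<forall>f\<in>hol_space w D2. \<exists>C<\<infinity>. \<forall>y\<in>B2. ennreal ((cmod (f y))\<^sup>2) \<le> C * G y"
    using exists_kernel[OF weights_measurable O' Ofin exp_gt_zero c b interp loc] .
  note [measurable] = G(1)
  have "open (B1 \<inter> B2)" "x \<in> B1 \<inter> B2" using B1 B2 by auto
  from topological_basisE[OF \<B> this] obtain B where B: "B \<in> \<B>" "x \<in> B" "B \<subseteq> B1 \<inter> B2" .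
  have oB: "open B" using B(1) \<B> topological_basis_open by blast
  \<comment> \<open>Adding 1 keeps H integrable over B because B lies in a set of finite
    volume.\<close>
  define H where "H y = G y * w\<^sub>0 y + 1" for y
  have "good B D T h H"
    unfolding good_def
  proof (intro conjI)
    show "B \<subseteq> D" using B B2 by (auto simp: O'_def)
    show "\<exists>K. compact K \<and> B \<subseteq> K \<and> K \<subseteq> T" using B1 B by blast
    show "H \<in> borel_measurable borel" unfolding H_def by measurable
    show "\<forall>y. 1 \<le> H y" by (simp add: H_def)
    have Bb: "B \<in> sets borel" using oB by simp
    have "(\<integral>\<^sup>+y\<in>B. H y \<partial>dV) = (\<integral>\<^sup>+y. G y * w\<^sub>0 y * indicator B y + indicator B y \<partial>dV)"
      by (intro nn_integral_cong) (simp add: H_def distrib_right)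
    also have "\<dots> = (\<integral>\<^sup>+y\<in>B. G y * w\<^sub>0 y \<partial>dV) + emeasure dV B"
      by (subst nn_integral_add)
        (use Bb in \<open>auto intro!: borel_measurable_times_ennreal borel_measurable_indicator\<close>)
    also have "\<dots> \<le> (\<integral>\<^sup>+y\<in>B2. G y * w\<^sub>0 y \<partial>dV) + emeasure dV O'"
      by (intro add_mono nn_integral_mono emeasure_mono) (use B B2 O' in \<open>auto simp: indicator_def\<close>)
    also have "\<dots> < \<infinity>" using G(2) Ofin by simp
    finally show "(\<integral>\<^sup>+y\<in>B. H y \<partial>dV) < \<infinity>" .
    show "\<forall>f\<in>hol_space w D. \<exists>C<\<infinity>. \<forall>y\<in>B. ennreal ((cmod (f y))\<^sup>2) * w\<^sub>0 y \<le> C * H y"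
    proof
      fix f assume "f \<in> hol_space w D"
      then have "f \<in> hol_space w D2" using hol_space_subset[of D2 D w] B2 by (auto simp: O'_def)
      then obtain C where C: "C < \<infinity>" "\<And>y. y \<in> B2 \<Longrightarrow> ennreal ((cmod (f y))\<^sup>2) \<le> C * G y" using G(3) by blast
      have "ennreal ((cmod (f y))\<^sup>2) * w\<^sub>0 y \<le> C * H y" if "y \<in> B" for y
      proof -
        have "ennreal ((cmod (f y))\<^sup>2) * w\<^sub>0 y \<le> C * G y * w\<^sub>0 y"
          using that B by (intro mult_right_mono C(2)) auto
        also have "\<dots> \<le> C * H y" unfolding H_def mult.assoc by (intro mult_left_mono) auto
        finally show ?thesis .
      qed
      with C(1) show "\<exists>C<\<infinity>. \<forall>y\<in>B. ennreal ((cmod (f y))\<^sup>2) * w\<^sub>0 y \<le> C * H y" by blast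
    qed
  qed (use oB oD T in auto)
  with B D show ?thesis using that by blast
qed

lemma section_measurable:
  assumes s: "s \<in> W" and T: "(T, h) \<in> trivs L" and B: "B \<in> sets borel" "B \<subseteq> T"
  shows "(\<lambda>y. indicator B y *\<^sub>R h (s y)) \<in> borel_measurable borel"
  by (intro borel_measurable_continuous_on_indicator B continuous_on_subset[OF section_continuous[OF s T]])

lemma section_power_integral_measurable:
  assumes s: "s \<in> W" and T: "(T, h) \<in> trivs L" and B: "B \<in> sets borel" "B \<subseteq> T" and H: "H \<in> borel_measurable borel"
  shows "(\<lambda>y. H y * pow_ext (cmod (h (s y))) a * indicator B y) \<in> borel_measurable borel"
proof -
  note [measurable] = section_measurable[OF s T B] H B(1)
  have "(\<lambda>y. H y * pow_ext (cmod (indicator B y *\<^sub>R h (s y))) a * indicator B y) \<in> borel_measurable borel"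
    by measurable
  moreover have "(\<lambda>y. H y * pow_ext (cmod (indicator B y *\<^sub>R h (s y))) a * indicator B y)
      = (\<lambda>y. H y * pow_ext (cmod (h (s y))) a * indicator B y)"
    by (intro ext) (auto simp: indicator_def)
  ultimately show ?thesis by simp
qed

lemma section_power_integral_AE:
  assumes g: "good B D T h H" and b: "basis_sec L W (Suc m) b"
  shows "AE z in Leb m. section_power_integral B h H k (sec_add L (lincomb L b m z) (b m)) < \<infinity>"
proof -
  obtain K where K: "compact K" "B \<subseteq> K" "K \<subseteq> T" and T: "(T, h) \<in> trivs L"
    and H: "H \<in> borel_measurable borel" "(\<integral>\<^sup>+y\<in>B. H y \<partial>dV) < \<infinity>" and oB: "open B"
    using g by (auto simp: good_def)
  have bW: "\<And>i. i < Suc m \<Longrightarrow> b i \<in> W" using b by (auto simp: basis_sec_def)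
  have Bb: "B \<in> sets borel" using oB by simp
  have "AE z in Leb m. (\<integral>\<^sup>+y\<in>B. H y * pow_ext (cmod ((\<Sum>i<m. z i * h (b i y)) + h (b m y))) (- 2 * exponent k) \<partial>dV) < \<infinity>"
  proof (rule AE_integrable_linear_combination[OF exponent K(1) Bb K(2) _ _ H])
    show "continuous_on K (\<lambda>y. h (b i y))" if "i \<le> m" for i
      using that bW K by (intro continuous_on_subset[OF section_continuous[OF _ T]]) auto
    show "\<exists>i\<le>m. h (b i y) \<noteq> 0" if "y \<in> K" for y
      using basis_nonvanishing[OF b T, of y] that K by (auto simp: less_Suc_eq_le)
  qed
  then show ?thesis
  proof (rule AE_mp, intro AE_I2 impI)
    fix z assume fin: "(\<integral>\<^sup>+y\<in>B. H y * pow_ext (cmod ((\<Sum>i<m. z i * h (b i y)) + h (b m y))) (- 2 * exponent k) \<partial>dV) < \<infinity>"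
    have "h (sec_add L (lincomb L b m z) (b m) y) = (\<Sum>i<m. z i * h (b i y)) + h (b m y)" if "y \<in> B" for y
    proof -
      have y: "y \<in> T" using that K by auto
      show ?thesis
        using sec_add_trivialized[OF lincomb_mem bW T y, of m b m z] lincomb_trivialized[OF _ T y, of m b z] bW by simp
    qed
    then have "section_power_integral B h H k (sec_add L (lincomb L b m z) (b m))
        = (\<integral>\<^sup>+y\<in>B. H y * pow_ext (cmod ((\<Sum>i<m. z i * h (b i y)) + h (b m y))) (- 2 * exponent k) \<partial>dV)"
      unfolding section_power_integral_def by (intro nn_integral_cong) (auto simp: indicator_def)
    then show "section_power_integral B h H k (sec_add L (lincomb L b m z) (b m)) < \<infinity>" using fin by simp
  qed
qed

text \<open>Finiteness of these integrals depends only on the line of s, which makes it a condition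
  on points of the projective space.\<close>

lemma section_power_integral_scale:
  assumes g: "good B D T h H" and s: "s \<in> W" and c: "c \<noteq> 0" and fin: "section_power_integral B h H k s < \<infinity>"
  shows "section_power_integral B h H k (sec_scale L c s) < \<infinity>"
proof -
  have BT: "B \<subseteq> T" and T: "(T, h) \<in> trivs L" and H: "H \<in> borel_measurable borel" and oB: "open B"
    using g by (auto simp: good_def)
  have Bb: "B \<in> sets borel" using oB by simp
  let ?C = "ennreal (cmod c powr (- 2 * exponent k))"
  have "section_power_integral B h H k (sec_scale L c s)
      = (\<integral>\<^sup>+y. ?C * (H y * pow_ext (cmod (h (s y))) (- 2 * exponent k) * indicator B y) \<partial>dV)"
    unfolding section_power_integral_def
  proof (intro nn_integral_cong)
    fix y
    show "H y * pow_ext (cmod (h (sec_scale L c s y))) (- 2 * exponent k) * indicator B y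
      = ?C * (H y * pow_ext (cmod (h (s y))) (- 2 * exponent k) * indicator B y)"
    proof (cases "y \<in> B")
      case True
      then have "h (sec_scale L c s y) = c * h (s y)" using sec_scale_trivialized[OF s T] BT by blast
      then have "pow_ext (cmod (h (sec_scale L c s y))) (- 2 * exponent k) = ?C * pow_ext (cmod (h (s y))) (- 2 * exponent k)"
        using c pow_ext_mult[of "cmod c" "cmod (h (s y))" "- 2 * exponent k"] by (simp add: norm_mult)
      then show ?thesis by (simp only: mult_ac)
    qed simp
  qed
  also have "\<dots> = ?C * section_power_integral B h H k s"
    unfolding section_power_integral_def by (rule nn_integral_cmult) (use section_power_integral_measurable[OF s T Bb BT H] in simp)
  also have "\<dots> < \<infinity>" using fin by (simp add: ennreal_mult_less_top)
  finally show ?thesis .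
qed

text \<open>What remains of the choice of s: near every point there are arbitrarily small good data
  whose integrals are finite for all exponents. Neither a germ nor \<sigma> or \<epsilon> occurs in
  it.\<close>

definition generic :: "('a \<Rightarrow> 'l) \<Rightarrow> bool" where
  "generic s \<longleftrightarrow> (\<forall>x U. open U \<longrightarrow> x \<in> U \<longrightarrow> (\<exists>B D T h H. good B D T h H \<and> x \<in> B \<and> D \<subseteq> U \<and> (\<forall>k. section_power_integral B h H k s < \<infinity>)))"

lemma generic_at:
  assumes "generic s" "open U" "x \<in> U"
  obtains B D T h H where "good B D T h H" "x \<in> B" "D \<subseteq> U" "\<forall>k. section_power_integral B h H k s < \<infinity>"
proof -
  have "\<exists>B D T h H. good B D T h H \<and> x \<in> B \<and> D \<subseteq> U \<and> (\<forall>k. section_power_integral B h H k s < \<infinity>)"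
    using assms(1)[unfolded generic_def, rule_format, OF assms(2,3)] .
  then show ?thesis by (elim exE conjE) (rule that)
qed

section \<open>The two inclusions\<close>

text \<open>Near x the integrand is at most a constant times H * |s| powr (- 2 p) for a fixed
  exponent p < 1: raising 1 + \<sigma> to \<open>1 + \<sigma>\<^sub>0\<close> costs a constant
  because \<phi> is bounded above, and 1 - \<epsilon> is raised to p because |s| is bounded.\<close>

lemma multiplier_ideal_subset_section_ideal:
  assumes s: "s \<in> W" "generic s" and cont: "continuous_on UNIV \<sigma>" "continuous_on UNIV \<epsilon>"
    and \<sigma>: "\<And>y. 0 < \<sigma> y \<and> \<sigma> y \<le> \<sigma>\<^sub>0 y" and \<epsilon>: "\<And>y. 0 < \<epsilon> y \<and> \<epsilon> y < \<sigma> y"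
  shows "multiplier_ideal n A \<phi> x \<subseteq> section_ideal n A L dV \<phi> s \<sigma> \<epsilon> x"
proof
  fix G assume "G \<in> multiplier_ideal n A \<phi> x"
  then obtain f U where G: "G = germ x f" and U: "open U" "x \<in> U" and f: "holomorphic_fun n A U f"
    and fin: "(\<integral>\<^sup>+y\<in>U. ennreal ((cmod (f y))\<^sup>2) * w y \<partial>dV) < \<infinity>"
    using multiplier_ideal_volume[of \<phi> x] weights_measurable(1) unfolding w_def by blast
  obtain M where M: "\<phi> x < ereal M" using \<phi>_less[of x] ereal_dense2 by blast
  have "1 - \<epsilon> x < 1" using \<epsilon> by simp
  \<comment> \<open>By continuity the inequality persists near x, so one p replaces the variable
    exponent 1 - \<epsilon>.\<close>
  then obtain k where k: "1 - \<epsilon> x < exponent k" using exponent_exceeds by blast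
  define p where "p = exponent k"
  have p: "0 < p" using exponent by (simp add: p_def)
  define S where "S = \<sigma>\<^sub>0 x + 1"
  define U2 where "U2 = U \<inter> {y. 1 - \<epsilon> y < p} \<inter> {y. \<epsilon> y < \<epsilon> x + 1} \<inter> {y. \<sigma>\<^sub>0 y < S} \<inter> {y. \<phi> y < ereal M}"
  have oU2: "open U2" unfolding U2_def
    by (intro open_Int U open_Collect_less continuous_intros cont cont\<sigma>\<^sub>0 quasi_psh_open_sublevel(1)[OF quasi_psh])
  have xU2: "x \<in> U2" using U k M by (auto simp: U2_def S_def p_def)
  obtain B D T h H where g: "good B D T h H" and B: "x \<in> B" "D \<subseteq> U2"
    and pint: "\<forall>k. section_power_integral B h H k s < \<infinity>"
    using generic_at[OF s(2) oU2 xU2] .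
  obtain K where K: "compact K" "B \<subseteq> K" "K \<subseteq> T" and T: "(T, h) \<in> trivs L" and oB: "open B" "open D" "B \<subseteq> D"
    and H: "H \<in> borel_measurable borel"
    and dom: "\<forall>f\<in>hol_space w D. \<exists>C<\<infinity>. \<forall>y\<in>B. ennreal ((cmod (f y))\<^sup>2) * w\<^sub>0 y \<le> C * H y"
    using g by (auto simp: good_def)
  have DU: "D \<subseteq> U" using B by (auto simp: U2_def)
  \<comment> \<open>Members of \<open>hol_space\<close> are Borel everywhere, while f is arbitrary
    off U.\<close>
  define f1 where "f1 y = indicator D y *\<^sub>R f y" for y
  have f1m: "f1 \<in> borel_measurable borel"
    unfolding f1_def using oB DU
    by (intro borel_measurable_continuous_on_indicator continuous_on_subset[OF holomorphic_fun_continuous[OF f U(1)]]) auto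
  have "holomorphic_fun n A D f1"
    by (rule holomorphic_fun_cong[OF holomorphic_fun_subset[OF f DU] oB(2)]) (simp add: f1_def)
  moreover have "sq_int (weight_on w D) f1 \<le> (\<integral>\<^sup>+y\<in>U. ennreal ((cmod (f y))\<^sup>2) * w y \<partial>dV)"
    unfolding sq_int_weight_on by (intro nn_integral_mono) (use DU in \<open>auto simp: indicator_def f1_def\<close>)
  ultimately have "f1 \<in> hol_space w D" using f1m fin by (auto simp: hol_space_def intro: le_less_trans)
  then obtain C where C: "C < \<infinity>" "\<And>y. y \<in> B \<Longrightarrow> ennreal ((cmod (f1 y))\<^sup>2) * w\<^sub>0 y \<le> C * H y" using dom by blast
  have "compact ((\<lambda>y. h (s y)) ` K)"
    by (rule compact_continuous_image[OF continuous_on_subset[OF section_continuous[OF s(1) T] K(3)] K(1)])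
  then obtain T0 where T0: "\<And>y. y \<in> K \<Longrightarrow> cmod (h (s y)) \<le> T0"
    using compact_imp_bounded bounded_iff by (metis imageI)
  \<comment> \<open>On \<open>U2\<close> one has \<epsilon> y < \<epsilon> x + 1, so - \<epsilon> x
    is a lower bound for the exponent 1 - \<epsilon> y.\<close>
  define K1 where "K1 = (max 1 T0) powr (2 * (p + \<epsilon> x))"
  define K2 where "K2 = exp (2 * S * \<bar>M\<bar>)"
  let ?F = "\<lambda>y. ennreal ((cmod (f y))\<^sup>2) / pow_ext (cmod (h (s y))) (2 * (1 - \<epsilon> y)) * exp_ext (- 2 * ereal (1 + \<sigma> y) * \<phi> y)"
  have pt: "?F y \<le> ennreal K1 * ennreal K2 * C * (H y * pow_ext (cmod (h (s y))) (- 2 * p))" if y: "y \<in> B" for y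
  proof -
    have yU: "y \<in> U2" and yK: "y \<in> K" using y oB B K by auto
    have 1: "inverse (pow_ext (cmod (h (s y))) (2 * (1 - \<epsilon> y))) \<le> ennreal K1 * pow_ext (cmod (h (s y))) (- 2 * p)"
      unfolding K1_def by (rule inverse_pow_ext_bound) (use T0[OF yK] yU p in \<open>auto simp: U2_def\<close>)
    have 2: "exp_ext (- 2 * ereal (1 + \<sigma> y) * \<phi> y) \<le> ennreal K2 * w\<^sub>0 y"
      unfolding K2_def w\<^sub>0_def by (rule exp_ext_mono_exponent) (use yU \<sigma>[of y] in \<open>auto simp: U2_def\<close>)
    have f1y: "f1 y = f y" using y oB by (auto simp: f1_def)
    have "?F y = ennreal ((cmod (f y))\<^sup>2) * inverse (pow_ext (cmod (h (s y))) (2 * (1 - \<epsilon> y))) * exp_ext (- 2 * ereal (1 + \<sigma> y) * \<phi> y)"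
      by (simp add: divide_ennreal_def)
    also have "\<dots> \<le> ennreal ((cmod (f y))\<^sup>2) * (ennreal K1 * pow_ext (cmod (h (s y))) (- 2 * p)) * (ennreal K2 * w\<^sub>0 y)"
      by (intro mult_mono 1 2 order_refl) auto
    also have "\<dots> = ennreal K1 * ennreal K2 * pow_ext (cmod (h (s y))) (- 2 * p) * (ennreal ((cmod (f1 y))\<^sup>2) * w\<^sub>0 y)"
      by (simp only: f1y mult_ac)
    also have "\<dots> \<le> ennreal K1 * ennreal K2 * pow_ext (cmod (h (s y))) (- 2 * p) * (C * H y)"
      by (intro mult_left_mono C(2) y) auto
    finally show ?thesis by (simp only: mult_ac)
  qed
  have Bb: "B \<in> sets borel" using oB by simp
  have "(\<integral>\<^sup>+y\<in>B. ?F y \<partial>dV) \<le> (\<integral>\<^sup>+y. ennreal K1 * ennreal K2 * C * (H y * pow_ext (cmod (h (s y))) (- 2 * p) * indicator B y) \<partial>dV)"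
    by (intro nn_integral_mono) (use pt in \<open>auto simp: indicator_def\<close>)
  also have "\<dots> = ennreal K1 * ennreal K2 * C * section_power_integral B h H k s"
    unfolding section_power_integral_def p_def
    by (rule nn_integral_cmult) (use section_power_integral_measurable[OF s(1) T Bb _ H] K in auto)
  also have "\<dots> < \<infinity>" using C(1) pint[rule_format, of k] by (simp add: ennreal_mult_less_top)
  finally have "(\<integral>\<^sup>+y\<in>B. ?F y \<partial>dV) < \<infinity>" .
  moreover have "holomorphic_fun n A B f" by (rule holomorphic_fun_subset[OF f]) (use oB DU in auto)
  moreover have "B \<subseteq> T" using K by auto
  ultimately show "G \<in> section_ideal n A L dV \<phi> s \<sigma> \<epsilon> x"
    unfolding section_ideal_def G using T oB B
    by (intro CollectI exI[of _ f] conjI refl bexI[OF _ T]) (auto intro!: exI[of _ B])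
qed

lemma section_integrand_measurable:
  assumes s: "s \<in> W" and T: "(T, h) \<in> trivs L" and U: "open U" "U \<subseteq> T" and f: "holomorphic_fun n A U f"
    and cont: "continuous_on UNIV \<sigma>" "continuous_on UNIV \<epsilon>" and B: "B \<in> sets borel" "B \<subseteq> U"
  shows "(\<lambda>y. ennreal ((cmod (f y))\<^sup>2) / pow_ext (cmod (h (s y))) (2 * (1 - \<epsilon> y)) * exp_ext (- 2 * ereal (1 + \<sigma> y) * \<phi> y) * indicator B y)
    \<in> borel_measurable borel"
proof -
  have [measurable]: "\<sigma> \<in> borel_measurable borel" "\<epsilon> \<in> borel_measurable borel"
    using cont by (auto intro: borel_measurable_continuous_onI)
  have BT: "B \<subseteq> T" using B U by auto
  have [measurable]: "(\<lambda>y. indicator B y *\<^sub>R f y) \<in> borel_measurable borel"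
    by (intro borel_measurable_continuous_on_indicator B continuous_on_subset[OF holomorphic_fun_continuous[OF f U(1)]])
  note [measurable] = section_measurable[OF s T B(1) BT] B(1)
  have "(\<lambda>y. ennreal ((cmod (indicator B y *\<^sub>R f y))\<^sup>2) / pow_ext (cmod (indicator B y *\<^sub>R h (s y))) (2 * (1 - \<epsilon> y))
      * exp_ext (- 2 * ereal (1 + \<sigma> y) * \<phi> y) * indicator B y) \<in> borel_measurable borel"
    by measurable
  moreover have "(\<lambda>y. ennreal ((cmod (indicator B y *\<^sub>R f y))\<^sup>2) / pow_ext (cmod (indicator B y *\<^sub>R h (s y))) (2 * (1 - \<epsilon> y))
      * exp_ext (- 2 * ereal (1 + \<sigma> y) * \<phi> y) * indicator B y)
    = (\<lambda>y. ennreal ((cmod (f y))\<^sup>2) / pow_ext (cmod (h (s y))) (2 * (1 - \<epsilon> y)) * exp_ext (- 2 * ereal (1 + \<sigma> y) * \<phi> y) * indicator B y)"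
    by (intro ext) (auto simp: indicator_def)
  ultimately show ?thesis by simp
qed

text \<open>Young's inequality bounds |f|^2 w by the given integrable function plus |f|^2 times a
  negative power of |s|. In the second term f is bounded near x and H >= 1, so a finite integral
  from genericity dominates it.\<close>

lemma section_ideal_subset_multiplier_ideal:
  assumes s: "s \<in> W" "generic s" and cont: "continuous_on UNIV \<sigma>" "continuous_on UNIV \<epsilon>"
    and \<epsilon>: "\<And>y. 0 < \<epsilon> y \<and> \<epsilon> y < \<sigma> y"
  shows "section_ideal n A L dV \<phi> s \<sigma> \<epsilon> x \<subseteq> multiplier_ideal n A \<phi> x"
proof
  fix G assume "G \<in> section_ideal n A L dV \<phi> s \<sigma> \<epsilon> x"
  then obtain f T' h' U where G: "G = germ x f" and T': "(T', h') \<in> trivs L" and U: "open U" "x \<in> U" "U \<subseteq> T'"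
    and f: "holomorphic_fun n A U f"
    and fin: "(\<integral>\<^sup>+y\<in>U. ennreal ((cmod (f y))\<^sup>2) / pow_ext (cmod (h' (s y))) (2 * (1 - \<epsilon> y))
        * exp_ext (- 2 * ereal (1 + \<sigma> y) * \<phi> y) \<partial>dV) < \<infinity>"
    unfolding section_ideal_def by blast
  have \<sigma>: "0 < \<sigma> y" for y using \<epsilon>[of y] by linarith
  \<comment> \<open>With a = |s| powr (2 (\<epsilon> - 1)), the second term a powr (- 1 / \<sigma>)
    is |s| powr (- 2 q). As q x < 1, a fixed p < 1 exceeds q near x.\<close>
  define q where "q y = (\<epsilon> y - 1) / \<sigma> y" for y
  have cq: "continuous_on UNIV q" unfolding q_def by (intro continuous_intros cont) (use \<sigma> in \<open>auto simp: less_le\<close>)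
  have "q x < 1" unfolding q_def using \<epsilon>[of x] \<sigma>[of x] by (simp add: pos_divide_less_eq)
  then obtain k where k: "q x < exponent k" using exponent_exceeds by blast
  define p where "p = exponent k"
  have p: "0 < p" using exponent by (simp add: p_def)
  define T0 where "T0 = cmod (h' (s x)) + 1"
  define F0 where "F0 = cmod (f x) + 1"
  have F0: "0 < F0" by (simp add: F0_def add_nonneg_pos)
  have oT': "open T'" by (rule trivialization_open[OF T'])
  define U2 where "U2 = (U \<inter> (\<lambda>y. cmod (f y)) -` {..<F0}) \<inter> (T' \<inter> (\<lambda>y. cmod (h' (s y))) -` {..<T0})
     \<inter> {y. q y < p} \<inter> {y. q x - 1 < q y}"
  have oU2: "open U2" unfolding U2_def
    by (intro open_Int open_Collect_less continuous_open_preimage continuous_intros cq U oT'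
        section_continuous[OF s(1) T'] holomorphic_fun_continuous[OF f] open_lessThan)
  have xU2: "x \<in> U2" using U k by (auto simp: U2_def p_def F0_def T0_def)
  obtain B D T h H where g: "good B D T h H" and B: "x \<in> B" "D \<subseteq> U2"
    and pint: "\<forall>k. section_power_integral B h H k s < \<infinity>"
    using generic_at[OF s(2) oU2 xU2] .
  have BT: "B \<subseteq> T" and T: "(T, h) \<in> trivs L" and oB: "open B" "open D" "B \<subseteq> D"
    and H: "H \<in> borel_measurable borel" "\<And>y. 1 \<le> H y"
    using g by (auto simp: good_def)
  have tr: "\<forall>(U, h)\<in>trivs L. \<forall>(U', h')\<in>trivs L. \<exists>g. holomorphic_fun n A (U \<inter> U') g \<and>
      (\<forall>v. proj L v \<in> U \<inter> U' \<longrightarrow> h' v = g (proj L v) * h v)"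
    using lbundle unfolding holomorphic_line_bundle_def by (elim conjE)
  \<comment> \<open>The ideal is tested in the trivialization \<open>h'\<close>, the good data use
    \<open>h\<close>. Only the bound |h s| <= \<Gamma> |h' s| is needed, as negative powers reverse
    it.\<close>
  have "\<exists>g. holomorphic_fun n A (T' \<inter> T) g \<and> (\<forall>v. proj L v \<in> T' \<inter> T \<longrightarrow> h v = g (proj L v) * h' v)"
    using bspec[OF bspec[OF tr T', simplified] T] by simp
  then obtain g where gh: "holomorphic_fun n A (T' \<inter> T) g" "\<And>v. proj L v \<in> T' \<inter> T \<Longrightarrow> h v = g (proj L v) * h' v"
    by blast
  define \<Gamma> where "\<Gamma> = cmod (g x) + 1"
  have \<Gamma>: "0 < \<Gamma>" by (simp add: \<Gamma>_def add_nonneg_pos)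
  have oTT: "open (T' \<inter> T)" using oT' trivialization_open[OF T] by auto
  define U3 where "U3 = B \<inter> ((T' \<inter> T) \<inter> (\<lambda>y. cmod (g y)) -` {..<\<Gamma>})"
  have U3: "open U3" unfolding U3_def
    by (intro open_Int oB continuous_open_preimage continuous_intros oTT holomorphic_fun_continuous[OF gh(1)] open_lessThan)
      (use oT' trivialization_open[OF T] in auto)
  have xU3: "x \<in> U3" using B U BT by (auto simp: U3_def \<Gamma>_def)
  have U3U: "U3 \<subseteq> U" and U3B: "U3 \<subseteq> B" using oB B by (auto simp: U3_def U2_def)
  \<comment> \<open>On \<open>U2\<close> one has q y > q x - 1, so - S is the required lower bound
    of the exponent.\<close>
  define S where "S = 1 - q x"
  define K1 where "K1 = (max 1 T0) powr (2 * (p + S))"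
  define C where "C = F0\<^sup>2 * K1 * \<Gamma> powr (2 * p)"
  let ?F = "\<lambda>y. ennreal ((cmod (f y))\<^sup>2) / pow_ext (cmod (h' (s y))) (2 * (1 - \<epsilon> y)) * exp_ext (- 2 * ereal (1 + \<sigma> y) * \<phi> y)"
  let ?P = "\<lambda>y. H y * pow_ext (cmod (h (s y))) (- 2 * p)"
  have pt: "ennreal ((cmod (f y))\<^sup>2) * w y \<le> ?F y + ennreal C * ?P y" if y: "y \<in> U3" for y
  proof -
    have yU: "y \<in> U2" "y \<in> T'" "y \<in> T" "cmod (g y) < \<Gamma>" using y oB B by (auto simp: U3_def)
    have 1: "w y \<le> inverse (pow_ext (cmod (h' (s y))) (2 * (1 - \<epsilon> y))) * exp_ext (- 2 * ereal (1 + \<sigma> y) * \<phi> y)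
        + ennreal K1 * pow_ext (cmod (h' (s y))) (- 2 * p)"
      unfolding w_def K1_def
      by (rule exp_ext_young) (use yU \<phi>_less \<sigma> p in \<open>auto simp: U2_def S_def q_def[symmetric]\<close>)
    have 2: "pow_ext (cmod (h' (s y))) (- 2 * p) \<le> ennreal (\<Gamma> powr (2 * p)) * pow_ext (cmod (h (s y))) (- 2 * p)"
    proof -
      have "h (s y) = g y * h' (s y)" using gh(2)[of "s y"] section_proj[OF s(1)] yU by simp
      then have "cmod (h (s y)) \<le> \<Gamma> * cmod (h' (s y))" using yU(4) by (simp add: norm_mult mult_right_mono)
      then have "pow_ext (\<Gamma> * cmod (h' (s y))) (- (2 * p)) \<le> pow_ext (cmod (h (s y))) (- (2 * p))"
        using p by (intro pow_ext_mono_neg) auto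
      then have "ennreal (\<Gamma> powr (- (2 * p))) * pow_ext (cmod (h' (s y))) (- (2 * p)) \<le> pow_ext (cmod (h (s y))) (- (2 * p))"
        using \<Gamma> by (simp add: pow_ext_mult)
      then have "ennreal (\<Gamma> powr (2 * p)) * (ennreal (\<Gamma> powr (- (2 * p))) * pow_ext (cmod (h' (s y))) (- (2 * p)))
          \<le> ennreal (\<Gamma> powr (2 * p)) * pow_ext (cmod (h (s y))) (- (2 * p))" by (rule mult_left_mono) simp
      moreover have "ennreal (\<Gamma> powr (2 * p)) * ennreal (\<Gamma> powr (- (2 * p))) = 1"
        using \<Gamma> by (simp add: ennreal_mult'[symmetric] powr_minus)
      ultimately show ?thesis by (simp add: mult.assoc[symmetric])
    qed
    have fF: "ennreal ((cmod (f y))\<^sup>2) \<le> ennreal (F0\<^sup>2)"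
      using yU F0 by (intro ennreal_leI power_mono) (auto simp: U2_def)
    have "ennreal ((cmod (f y))\<^sup>2) * w y \<le> ennreal ((cmod (f y))\<^sup>2)
        * (inverse (pow_ext (cmod (h' (s y))) (2 * (1 - \<epsilon> y))) * exp_ext (- 2 * ereal (1 + \<sigma> y) * \<phi> y)
          + ennreal K1 * pow_ext (cmod (h' (s y))) (- 2 * p))"
      by (intro mult_left_mono 1) simp
    also have "\<dots> = ?F y + ennreal ((cmod (f y))\<^sup>2) * (ennreal K1 * pow_ext (cmod (h' (s y))) (- 2 * p))"
      by (simp add: distrib_left divide_ennreal_def mult.assoc)
    also have "ennreal ((cmod (f y))\<^sup>2) * (ennreal K1 * pow_ext (cmod (h' (s y))) (- 2 * p))
        \<le> ennreal (F0\<^sup>2) * (ennreal K1 * (ennreal (\<Gamma> powr (2 * p)) * (H y * pow_ext (cmod (h (s y))) (- 2 * p))))"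
    proof (intro mult_mono fF order_refl order_trans[OF 2] mult_left_mono)
      show "pow_ext (cmod (h (s y))) (- 2 * p) \<le> H y * pow_ext (cmod (h (s y))) (- 2 * p)"
        using mult_right_mono[OF H(2)[of y], of "pow_ext (cmod (h (s y))) (- 2 * p)"] by simp
    qed auto
    also have "\<dots> = ennreal C * ?P y"
    proof -
      have "ennreal C = ennreal (F0\<^sup>2) * ennreal K1 * ennreal (\<Gamma> powr (2 * p))"
        by (simp add: C_def K1_def ennreal_mult)
      then show ?thesis by (simp only: mult.assoc)
    qed
    finally show ?thesis by (simp add: add_left_mono)
  qed
  have U3b: "U3 \<in> sets borel" using U3 by simp
  have m1: "(\<lambda>y. ?F y * indicator U3 y) \<in> borel_measurable borel"
    by (rule section_integrand_measurable[OF s(1) T' U(1,3) f cont U3b U3U])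
  have m2: "(\<lambda>y. ?P y * indicator U3 y) \<in> borel_measurable borel"
    by (rule section_power_integral_measurable[OF s(1) T U3b _ H(1)]) (use U3B BT in auto)
  have "(\<integral>\<^sup>+y\<in>U3. ennreal ((cmod (f y))\<^sup>2) * w y \<partial>dV) \<le> (\<integral>\<^sup>+y. ?F y * indicator U3 y + ennreal C * (?P y * indicator U3 y) \<partial>dV)"
    by (intro nn_integral_mono) (use pt in \<open>auto simp: indicator_def\<close>)
  also have "\<dots> = (\<integral>\<^sup>+y\<in>U3. ?F y \<partial>dV) + (\<integral>\<^sup>+y. ennreal C * (?P y * indicator U3 y) \<partial>dV)"
    by (rule nn_integral_add) (use m1 m2 in auto)
  also have "(\<integral>\<^sup>+y. ennreal C * (?P y * indicator U3 y) \<partial>dV) = ennreal C * (\<integral>\<^sup>+y\<in>U3. ?P y \<partial>dV)"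
    by (rule nn_integral_cmult) (use m2 in simp)
  also have "(\<integral>\<^sup>+y\<in>U3. ?F y \<partial>dV) + ennreal C * (\<integral>\<^sup>+y\<in>U3. ?P y \<partial>dV) \<le> (\<integral>\<^sup>+y\<in>U. ?F y \<partial>dV) + ennreal C * section_power_integral B h H k s"
    unfolding section_power_integral_def p_def
    by (intro add_mono mult_left_mono nn_integral_mono) (use U3U U3B in \<open>auto simp: indicator_def\<close>)
  also have "\<dots> < \<infinity>" using fin pint[rule_format, of k] by (simp add: ennreal_mult_less_top)
  finally have "(\<integral>\<^sup>+y\<in>U3. ennreal ((cmod (f y))\<^sup>2) * exp_ext (- 2 * \<phi> y) \<partial>dV) < \<infinity>" by (simp only: w_def)
  moreover have "holomorphic_fun n A U3 f" by (rule holomorphic_fun_subset[OF f U3U])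
  ultimately show "G \<in> multiplier_ideal n A \<phi> x"
    using multiplier_ideal_volume[of \<phi> x] weights_measurable(1) G U3 xU3 unfolding w_def by blast
qed

text \<open>Both volumes are comparable to Lebesgue measure in a chart around x, hence to each other
  near x. This makes the exceptional set, built from one volume, valid for all of them.\<close>

lemma section_ideal_volume_subset:
  assumes s: "s \<in> W" and cont: "continuous_on UNIV \<sigma>" "continuous_on UNIV \<epsilon>" and dV': "smooth_volume n A dV'"
  shows "section_ideal n A L dV \<phi> s \<sigma> \<epsilon> x \<subseteq> section_ideal n A L dV' \<phi> s \<sigma> \<epsilon> x"
    and "section_ideal n A L dV' \<phi> s \<sigma> \<epsilon> x \<subseteq> section_ideal n A L dV \<phi> s \<sigma> \<epsilon> x"
proof -
  interpret V': volume_manifold n A dV' by standard (rule manifold dV')+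
  obtain V \<kappa> where c: "(V, \<kappa>) \<in> A" "x \<in> V" using chart_at .
  obtain U1 C1 where U1: "open U1" "x \<in> U1" "U1 \<subseteq> V" and C1: "0 < C1"
    and le1: "\<forall>F B. (\<lambda>y. F y * indicator B y) \<in> borel_measurable borel \<longrightarrow> B \<in> sets borel \<longrightarrow> B \<subseteq> U1 \<longrightarrow>
      (\<integral>\<^sup>+y\<in>B. F y \<partial>dV) \<le> ennreal C1 * (\<integral>\<^sup>+z\<in>\<kappa> ` B. F (inv_into V \<kappa> z) \<partial>Leb n)"
    and ge1: "\<forall>F B. (\<lambda>y. F y * indicator B y) \<in> borel_measurable borel \<longrightarrow> B \<in> sets borel \<longrightarrow> B \<subseteq> U1 \<longrightarrow>
      (\<integral>\<^sup>+z\<in>\<kappa> ` B. F (inv_into V \<kappa> z) \<partial>Leb n) \<le> ennreal C1 * (\<integral>\<^sup>+y\<in>B. F y \<partial>dV)"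
    using volume_comparable[OF c] .
  obtain U2 C2 where U2: "open U2" "x \<in> U2" "U2 \<subseteq> V" and C2: "0 < C2"
    and le2: "\<forall>F B. (\<lambda>y. F y * indicator B y) \<in> borel_measurable borel \<longrightarrow> B \<in> sets borel \<longrightarrow> B \<subseteq> U2 \<longrightarrow>
      (\<integral>\<^sup>+y\<in>B. F y \<partial>dV') \<le> ennreal C2 * (\<integral>\<^sup>+z\<in>\<kappa> ` B. F (inv_into V \<kappa> z) \<partial>Leb n)"
    and ge2: "\<forall>F B. (\<lambda>y. F y * indicator B y) \<in> borel_measurable borel \<longrightarrow> B \<in> sets borel \<longrightarrow> B \<subseteq> U2 \<longrightarrow>
      (\<integral>\<^sup>+z\<in>\<kappa> ` B. F (inv_into V \<kappa> z) \<partial>Leb n) \<le> ennreal C2 * (\<integral>\<^sup>+y\<in>B. F y \<partial>dV')"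
    using V'.volume_comparable[OF c] .
  have step: "section_ideal n A L M \<phi> s \<sigma> \<epsilon> x \<subseteq> section_ideal n A L M' \<phi> s \<sigma> \<epsilon> x"
    if le: "\<And>F B. (\<lambda>y. F y * indicator B y) \<in> borel_measurable borel \<Longrightarrow> B \<in> sets borel \<Longrightarrow> B \<subseteq> U1 \<inter> U2 \<Longrightarrow>
      (\<integral>\<^sup>+y\<in>B. F y \<partial>M') \<le> ennreal C1 * (ennreal C2 * (\<integral>\<^sup>+y\<in>B. F y \<partial>M))" for M M' :: "'a measure"
  proof
    fix G assume "G \<in> section_ideal n A L M \<phi> s \<sigma> \<epsilon> x"
    then obtain f T h U where G: "G = germ x f" and T: "(T, h) \<in> trivs L" and U: "open U" "x \<in> U" "U \<subseteq> T"
      and f: "holomorphic_fun n A U f"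
      and fin: "(\<integral>\<^sup>+y\<in>U. ennreal ((cmod (f y))\<^sup>2) / pow_ext (cmod (h (s y))) (2 * (1 - \<epsilon> y))
        * exp_ext (- 2 * ereal (1 + \<sigma> y) * \<phi> y) \<partial>M) < \<infinity>"
      unfolding section_ideal_def by blast
    let ?F = "\<lambda>y. ennreal ((cmod (f y))\<^sup>2) / pow_ext (cmod (h (s y))) (2 * (1 - \<epsilon> y)) * exp_ext (- 2 * ereal (1 + \<sigma> y) * \<phi> y)"
    define U3 where "U3 = U \<inter> U1 \<inter> U2"
    have U3: "open U3" "x \<in> U3" "U3 \<subseteq> U" using U U1 U2 by (auto simp: U3_def)
    have U3b: "U3 \<in> sets borel" using U3 by simp
    have "(\<integral>\<^sup>+y\<in>U3. ?F y \<partial>M') \<le> ennreal C1 * (ennreal C2 * (\<integral>\<^sup>+y\<in>U3. ?F y \<partial>M))"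
      by (rule le[OF section_integrand_measurable[OF s T U(1,3) f cont U3b U3(3)] U3b]) (auto simp: U3_def)
    also have "\<dots> \<le> ennreal C1 * (ennreal C2 * (\<integral>\<^sup>+y\<in>U. ?F y \<partial>M))"
      by (intro mult_left_mono nn_integral_mono) (use U3 in \<open>auto simp: indicator_def\<close>)
    also have "\<dots> < \<infinity>" using fin by (simp add: ennreal_mult_less_top)
    finally have "(\<integral>\<^sup>+y\<in>U3. ?F y \<partial>M') < \<infinity>" .
    moreover have "holomorphic_fun n A U3 f" by (rule holomorphic_fun_subset[OF f U3(3)])
    moreover have "U3 \<subseteq> T" using U3 U by auto
    ultimately show "G \<in> section_ideal n A L M' \<phi> s \<sigma> \<epsilon> x"
      unfolding section_ideal_def G using T U3
      by (intro CollectI exI[of _ f] conjI refl bexI[OF _ T]) (auto intro!: exI[of _ U3])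
  qed
  show "section_ideal n A L dV \<phi> s \<sigma> \<epsilon> x \<subseteq> section_ideal n A L dV' \<phi> s \<sigma> \<epsilon> x"
  proof (rule step)
    fix F :: "'a \<Rightarrow> ennreal" and B
    assume h: "(\<lambda>y. F y * indicator B y) \<in> borel_measurable borel" "B \<in> sets borel" "B \<subseteq> U1 \<inter> U2"
    have "(\<integral>\<^sup>+y\<in>B. F y \<partial>dV') \<le> ennreal C2 * (\<integral>\<^sup>+z\<in>\<kappa> ` B. F (inv_into V \<kappa> z) \<partial>Leb n)"
      by (rule le2[rule_format]) (use h in auto)
    also have "\<dots> \<le> ennreal C2 * (ennreal C1 * (\<integral>\<^sup>+y\<in>B. F y \<partial>dV))"
      by (intro mult_left_mono ge1[rule_format]) (use h in auto)
    finally show "(\<integral>\<^sup>+y\<in>B. F y \<partial>dV') \<le> ennreal C1 * (ennreal C2 * (\<integral>\<^sup>+y\<in>B. F y \<partial>dV))" by (simp only: mult_ac)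
  qed
  show "section_ideal n A L dV' \<phi> s \<sigma> \<epsilon> x \<subseteq> section_ideal n A L dV \<phi> s \<sigma> \<epsilon> x"
  proof (rule step)
    fix F :: "'a \<Rightarrow> ennreal" and B
    assume h: "(\<lambda>y. F y * indicator B y) \<in> borel_measurable borel" "B \<in> sets borel" "B \<subseteq> U1 \<inter> U2"
    have "(\<integral>\<^sup>+y\<in>B. F y \<partial>dV) \<le> ennreal C1 * (\<integral>\<^sup>+z\<in>\<kappa> ` B. F (inv_into V \<kappa> z) \<partial>Leb n)"
      by (rule le1[rule_format]) (use h in auto)
    also have "\<dots> \<le> ennreal C1 * (ennreal C2 * (\<integral>\<^sup>+y\<in>B. F y \<partial>dV'))"
      by (intro mult_left_mono ge2[rule_format]) (use h in auto)
    finally show "(\<integral>\<^sup>+y\<in>B. F y \<partial>dV) \<le> ennreal C1 * (ennreal C2 * (\<integral>\<^sup>+y\<in>B. F y \<partial>dV'))" .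
  qed
qed

text \<open>Only pairs of basic sets index the conditions, and one choice of trivialization and H is
  made for each pair that admits good data. Together with the exponents this gives countably many
  conditions, each holding for almost every affine coordinate in every basis.\<close>

lemma exists_exceptional_set:
  obtains N where "N \<subseteq> proj_space L W" "measure_zero_proj L W N"
    "\<forall>s\<in>W - {lzero L}. line_of L s \<notin> N \<longrightarrow> generic s"
proof -
  obtain \<B> :: "'a set set" where \<B>: "countable \<B>" "topological_basis \<B>" using ex_countable_basis by blast
  define P where "P = {c \<in> \<B> \<times> \<B>. \<exists>d. good (fst c) (snd c) (fst d) (fst (snd d)) (snd (snd d))}"
  have cP: "countable P" unfolding P_def by (rule countable_subset[OF _ countable_SIGMA[OF \<B>(1) \<B>(1)]]) auto
  have "\<forall>c\<in>P. \<exists>d. good (fst c) (snd c) (fst d) (fst (snd d)) (snd (snd d))" by (simp add: P_def)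
  from bchoice[OF this] obtain d where
    d: "\<And>c. c \<in> P \<Longrightarrow> good (fst c) (snd c) (fst (d c)) (fst (snd (d c))) (snd (snd (d c)))" by blast
  define J where "J c k s = section_power_integral (fst c) (fst (snd (d c))) (snd (snd (d c))) k s" for c k s
  define bad where "bad s \<longleftrightarrow> (\<exists>c\<in>P. \<exists>k. \<not> J c k s < \<infinity>)" for s
  define N where "N = line_of L ` {s \<in> W - {lzero L}. bad s}"
  show ?thesis
  proof (rule that)
    show "N \<subseteq> proj_space L W" by (auto simp: N_def proj_space_def)
    show "measure_zero_proj L W N"
      unfolding measure_zero_proj_def
    proof (intro allI impI)
      fix m b assume b: "basis_sec L W (Suc m) b"
      let ?s = "\<lambda>z. sec_add L (lincomb L b m z) (b m)"
      have bW: "\<And>i. i < Suc m \<Longrightarrow> b i \<in> W" using b by (auto simp: basis_sec_def)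
      have sW: "?s z \<in> W" for z using lincomb_mem[of m b z] bW subspace by (auto simp: sec_subspace_def)
      have "AE z in Leb m. \<forall>c\<in>P. \<forall>k. J c k (?s z) < \<infinity>"
        unfolding AE_ball_countable[OF cP] AE_all_countable J_def using section_power_integral_AE[OF d b] by blast
      then have "AE z in Leb m. \<not> bad (?s z)" by eventually_elim (auto simp: bad_def)
      then obtain Z where Z: "Z \<in> null_sets (Leb m)" "{z \<in> space (Leb m). bad (?s z)} \<subseteq> Z"
        by (auto simp: eventually_ae_filter)
      have "{z \<in> Cn m. line_of L (?s z) \<in> N} \<subseteq> Z"
      proof
        fix z assume z: "z \<in> {z \<in> Cn m. line_of L (?s z) \<in> N}"
        \<comment> \<open>Membership of the line in N is witnessed by some bad s, a nonzero multiple
          of the affine representative; badness is carried over by scaling.\<close>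
        then obtain s where s: "s \<in> W" "s \<noteq> lzero L" "bad s" "line_of L (?s z) = line_of L s" by (auto simp: N_def)
        obtain c where c: "c \<noteq> 0" "s = sec_scale L c (?s z)" using line_of_eqD[OF s(1,2) sW s(4)[symmetric]] .
        have "bad (?s z)"
        proof (rule ccontr)
          assume "\<not> bad (?s z)"
          then have "J c' k (?s z) < \<infinity>" if "c' \<in> P" for c' k using that by (auto simp: bad_def)
          then have "J c' k s < \<infinity>" if "c' \<in> P" for c' k
            unfolding c(2) J_def using section_power_integral_scale[OF d[OF that] sW c(1)] that by (simp add: J_def)
          then show False using s(3) by (auto simp: bad_def)
        qed
        then show "z \<in> Z" using z Z(2) by (auto simp: Cn_def space_PiM)
      qed
      then show "{z \<in> Cn m. line_of L (?s z) \<in> N} \<in> null_sets (completion (Leb m))"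
        using Z(1) by (rule null_sets_completion_subset[OF _ null_sets_completionI])
    qed
    show "\<forall>s\<in>W - {lzero L}. line_of L s \<notin> N \<longrightarrow> generic s"
    proof (intro ballI impI)
      fix s assume s: "s \<in> W - {lzero L}" "line_of L s \<notin> N"
      then have nb: "\<not> bad s" by (auto simp: N_def)
      show "generic s"
        unfolding generic_def
      proof (intro allI impI)
        fix x :: 'a and U assume U: "open U" "x \<in> U"
        obtain B D T h H where g: "B \<in> \<B>" "D \<in> \<B>" "good B D T h H" "x \<in> B" "D \<subseteq> U"
          by (rule good_exists[OF \<B>(2) U])
        then have P: "(B, D) \<in> P" unfolding P_def by (auto intro!: exI[of _ "(T, h, H)"])
        \<comment> \<open>The data found at x only certify that the pair belongs to P; the data
          fixed for this pair in advance are the ones used.\<close>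
        from d[OF P] nb g P show "\<exists>B D T h H. good B D T h H \<and> x \<in> B \<and> D \<subseteq> U \<and> (\<forall>k. section_power_integral B h H k s < \<infinity>)"
          unfolding bad_def J_def by (metis fst_conv snd_conv)
      qed
    qed
  qed
qed

end

theorem theorem1p7:
  fixes n :: nat
    and A :: "('a::{t2_space, second_countable_topology}) chart set"
    and \<phi> :: "'a \<Rightarrow> ereal"
    and \<sigma>\<^sub>0 :: "'a \<Rightarrow> real"
    and L :: "('a, 'l) line_bundle"
    and W :: "('a \<Rightarrow> 'l) set"
  assumes "complex_manifold n A"
    and "quasi_psh n A \<phi>"
    and "continuous_on UNIV \<sigma>\<^sub>0" and "\<forall>x. 0 < \<sigma>\<^sub>0 x"
    and "\<forall>x. multiplier_ideal n A \<phi> x = multiplier_ideal n A (\<lambda>y. ereal (1 + \<sigma>\<^sub>0 y) * \<phi> y) x"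
    and "holomorphic_line_bundle n A L"
    and "sec_subspace n A L W" and "finite_dim_sec L W"
    and "generates_fibers L W"
  shows "\<exists>N \<subseteq> proj_space L W. measure_zero_proj L W N \<and>
     (\<forall>s \<in> W - {lzero L}. line_of L s \<notin> N \<longrightarrow>
        (\<forall>dV \<sigma> \<epsilon>. smooth_volume n A dV \<longrightarrow>
           continuous_on UNIV \<sigma> \<longrightarrow> continuous_on UNIV \<epsilon> \<longrightarrow>
           (\<forall>x. 0 < \<sigma> x \<and> \<sigma> x \<le> \<sigma>\<^sub>0 x) \<longrightarrow> (\<forall>x. 0 < \<epsilon> x \<and> \<epsilon> x < \<sigma> x) \<longrightarrow>
           (\<forall>x. multiplier_ideal n A \<phi> x = section_ideal n A L dV \<phi> s \<sigma> \<epsilon> x)))"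
proof (cases "\<exists>dV. smooth_volume n A dV")
  case False
  \<comment> \<open>Without a smooth volume the quantification over dV is empty and the empty set
    serves as N.\<close>
  have "measure_zero_proj L W {}" by (simp add: measure_zero_proj_def)
  with False show ?thesis by (intro exI[of _ "{}"]) auto
next
  case True
  \<comment> \<open>N must be found before dV is given, so it is built from an auxiliary
    volume.\<close>
  then obtain dV\<^sub>0 where "smooth_volume n A dV\<^sub>0" by blast
  then interpret multiplier_setting n A dV\<^sub>0 L W \<phi> \<sigma>\<^sub>0
    using assms by unfold_locales auto
  obtain N where N: "N \<subseteq> proj_space L W" "measure_zero_proj L W N"
    "\<forall>s\<in>W - {lzero L}. line_of L s \<notin> N \<longrightarrow> generic s"
    by (rule exists_exceptional_set)
  show ?thesis
  proof (intro exI[of _ N] conjI ballI allI impI N(1,2))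
    fix s dV \<sigma> \<epsilon> x
    assume s: "s \<in> W - {lzero L}" "line_of L s \<notin> N" and dV: "smooth_volume n A dV"
      and cont: "continuous_on UNIV \<sigma>" "continuous_on UNIV \<epsilon>"
      and \<sigma>: "\<forall>x. 0 < \<sigma> x \<and> \<sigma> x \<le> \<sigma>\<^sub>0 x" and \<epsilon>: "\<forall>x. 0 < \<epsilon> x \<and> \<epsilon> x < \<sigma> x"
    have sW: "s \<in> W" "generic s" using s N(3) by auto
    have "multiplier_ideal n A \<phi> x = section_ideal n A L dV\<^sub>0 \<phi> s \<sigma> \<epsilon> x"
      using multiplier_ideal_subset_section_ideal[OF sW cont] section_ideal_subset_multiplier_ideal[OF sW cont] \<sigma> \<epsilon>
      by (intro equalityI) auto
    also have "\<dots> = section_ideal n A L dV \<phi> s \<sigma> \<epsilon> x"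
      by (intro equalityI section_ideal_volume_subset[OF sW(1) cont dV])
    finally show "multiplier_ideal n A \<phi> x = section_ideal n A L dV \<phi> s \<sigma> \<epsilon> x" .
  qed
qed

end
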